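(* Let $\mathfrak A$ be a Banach algebra, let $\mathcal A,\mathcal B$ be Banach algebras which are Banach $\mathfrak A$-modules, and let $\mathcal M$ be a Banach $\mathcal A,\mathcal B$-module which is a commutative Banach $\mathfrak A$-module. Then the triangular Banach algebra $\mathcal T=\begin{bmatrix}\mathcal A&\mathcal M\\&\mathcal B\end{bmatrix}$ is module amenable (as a $\mathfrak T$-bimodule) if and only if $\mathcal A$ and $\mathcal B$ are module amenable (as Banach $\mathfrak A$-bimodules) and $\mathcal M=0$.
   Context: A Banach algebra $\mathcal A$ is called a Banach $\mathfrak A$-module (with compatible actions) if it is a Banach $\mathfrak A$-bimodule with $\alpha\cdot(ab)=(\alpha\cdot a)b$ and $(ab)\cdot\alpha=a(b\cdot\alpha)$ for all $a,b\in\mathcal A$, $\alpha\in\mathfrak A$. A Banach $\mathcal A$-$\mathfrak A$-module is a space $X$ that is a Banach $\mathcal A$-bimodule and a Banach $\mathfrak A$-bimodule satisfying, for all $a\in\mathcal A,\alpha\in\mathfrak A,x\in X$: $\alpha\cdot(a\cdot x)=(\alpha\cdot a)\cdot x$, $(\alpha\cdot x)\cdot a=\alpha\cdot(x\cdot a)$, $x\cdot(a\cdot\alpha)=(x\cdot a)\cdot\alpha$, $(a\cdot x)\cdot\alpha=a\cdot(x\cdot\alpha)$, $a\cdot(\alpha\cdot x)=(a\cdot\alpha)\cdot x$, $x\cdot(\alpha\cdot a)=(x\cdot\alpha)\cdot a$. It (or any Banach $\mathfrak A$-bimodule) is called commutative if $\alpha\cdot x=x\cdot\alpha$ for all $\alpha\in\mathfrak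 A$, $x\in X$. The dual $X^*$ carries the usual dual actions $\langle f\cdot\alpha,x\rangle=\langle f,\alpha\cdot x\rangle$, $\langle \alpha\cdot f,x\rangle=\langle f,x\cdot\alpha\rangle$, and likewise for $\mathcal A$. An $\mathfrak A$-module map is a map $T$ with $T(x\pm y)=T(x)\pm T(y)$, $T(\alpha\cdot x)=\alpha\cdot T(x)$, $T(x\cdot\alpha)=T(x)\cdot\alpha$ (not necessarily $\mathbb C$-linear). A module derivation $D:\mathcal A\to X$ is an $\mathfrak A$-module map which is bounded (there is $M>0$ with $\|D(a)\|\le M\|a\|$ for all $a$) and satisfies $D(ab)=D(a)\cdot b+a\cdot D(b)$. For $X$ commutative, the inner module derivations are the maps $D_x(a)=a\cdot x-x\cdot a$, $x\in X$. $\mathcal A$ is module amenable (as an $\mathfrak A$-module) if for every commutative Banach $\mathcal A$-$\mathfrak A$-module $X$ every module derivation $\mathcal A\to X^*$ is inner. A Banach $\mathcal A,\mathcal B$-module $\mathcal M$ is a left Banach $\mathcal A$-module and right Banach $\mathcal B$-module with $(a\cdot m)\cdot b=a\cdot(m\cdot b)$. It is also a Banach $\mathfrak A$-bimodule, with compatible actions $\alpha\cdot(a\cdot m)=(\alpha\cdot a)\cdot m$, $(\alpha\cdot m)\cdot b=\alpha\cdot(m\cdot b)$, $m\cdot(b\cdot\alpha)=(m\cdot b)\cdot\alpha$, $(a\cdot m)\cdot\alpha=a\cdot(m\cdot\alpha)$. $\mathcal T=\left\{\begin{bmatrix}a&m\\&b\end{bmatrix}:a\in\mathcal A,m\in\mathcal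 M,b\in\mathcal B\right\}$ has the usual $2\times2$ matrix operations and norm $\|a\|+\|m\|+\|b\|$. $\mathfrak T=\left\{\begin{bmatrix}\alpha&\\&\alpha\end{bmatrix}:\alpha\in\mathfrak A\right\}$ acts on $\mathcal T$ entrywise: $\begin{bmatrix}\alpha&\\&\alpha\end{bmatrix}\cdot\begin{bmatrix}a&m\\&b\end{bmatrix}=\begin{bmatrix}\alpha\cdot a&\alpha\cdot m\\&\alpha\cdot b\end{bmatrix}$, and similarly on the right; $\mathcal T$ is module amenable (as a $\mathfrak T$-bimodule) if for every commutative Banach $\mathcal T$-$\mathfrak T$-module $X$ (the definition of a commutative Banach $\mathcal A$-$\mathfrak A$-module with $\mathcal T$ in place of $\mathcal A$ and $\mathfrak T$ in place of $\mathfrak A$), every module derivation $D:\mathcal T\to X^*$, that is, every bounded $\mathfrak T$-module map with $D(st)=D(s)\cdot t+s\cdot D(t)$ for all $s,t\in\mathcal T$, is inner, i.e. of the form $D(t)=t\cdot f-f\cdot t$ for some $f\in X^*$.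
   Formalization: The actions on M are also assumed to satisfy a·(α·m)=(a·α)·m and m·(α·b)=(m·α)·b, without which the claim is false; module amenability is tested on modules whose underlying set lies in an arbitrary, sufficiently large fixed type, the same for T, A and B. *)

theory Defs
  imports "HOL-Algebra.Algebraic_Closure_Type" "HOL-Analysis.Abstract_Metric_Spaces"
begin

text \<open>
  Banach spaces are carrier-based (module amenability quantifies over all Banach modules, so these
  cannot be types). \<open>ring_of_type_algebra :: complex ring\<close> is the field of complex numbers. The field
  \<open>one\<close> of the record is never used, and \<open>monoid.mult\<close> only for algebras: no algebra is assumed unital.
\<close>

record 'x cnormed = "(complex, 'x) module" +
  nrm :: "'x \<Rightarrow> real"

text \<open>The value \<open>0\<close> outside the carrier only serves to make the distance a \<open>Metric_space\<close>.\<close>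

definition ndist :: "('x, 'z) cnormed_scheme \<Rightarrow> 'x \<Rightarrow> 'x \<Rightarrow> real" where
  "ndist E x y = (if x \<in> carrier E \<and> y \<in> carrier E then nrm E (x \<ominus>\<^bsub>E\<^esub> y) else 0)"

locale cbanach_space =
  module "ring_of_type_algebra :: complex ring" E for E :: "'x cnormed" (structure) +
  assumes nrm_nonneg: "x \<in> carrier E \<Longrightarrow> 0 \<le> nrm E x"
    and nrm_eq_0: "x \<in> carrier E \<Longrightarrow> nrm E x = 0 \<longleftrightarrow> x = \<zero>"
    and nrm_smult: "x \<in> carrier E \<Longrightarrow> nrm E (c \<odot> x) = cmod c * nrm E x"
    and nrm_add: "\<lbrakk>x \<in> carrier E; y \<in> carrier E\<rbrakk> \<Longrightarrow> nrm E (x \<oplus> y) \<le> nrm E x + nrm E y"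
    and complete: "Metric_space.mcomplete (carrier E) (ndist E)"

locale banach_algebra = cbanach_space A for A :: "'a cnormed" (structure) +
  assumes mult_closed: "\<lbrakk>a \<in> carrier A; b \<in> carrier A\<rbrakk> \<Longrightarrow> a \<otimes> b \<in> carrier A"
    and mult_assoc: "\<lbrakk>a \<in> carrier A; b \<in> carrier A; c \<in> carrier A\<rbrakk> \<Longrightarrow> (a \<otimes> b) \<otimes> c = a \<otimes> (b \<otimes> c)"
    and mult_add_left: "\<lbrakk>a \<in> carrier A; b \<in> carrier A; c \<in> carrier A\<rbrakk>
          \<Longrightarrow> (a \<oplus> b) \<otimes> c = a \<otimes> c \<oplus> b \<otimes> c"
    and mult_add_right: "\<lbrakk>a \<in> carrier A; b \<in> carrier A; c \<in> carrier A\<rbrakk>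
          \<Longrightarrow> a \<otimes> (b \<oplus> c) = a \<otimes> b \<oplus> a \<otimes> c"
    and mult_smult_left: "\<lbrakk>a \<in> carrier A; b \<in> carrier A\<rbrakk> \<Longrightarrow> (s \<odot> a) \<otimes> b = s \<odot> (a \<otimes> b)"
    and mult_smult_right: "\<lbrakk>a \<in> carrier A; b \<in> carrier A\<rbrakk> \<Longrightarrow> a \<otimes> (s \<odot> b) = s \<odot> (a \<otimes> b)"
    and nrm_mult: "\<lbrakk>a \<in> carrier A; b \<in> carrier A\<rbrakk> \<Longrightarrow> nrm A (a \<otimes> b) \<le> nrm A a * nrm A b"

text \<open>
  Banach modules are bounded with some constant \<open>C\<close>, which is not required to be \<open>1\<close>. The locales
  only speak about the operations of the acting algebra; that it is an algebra is assumed
  separately. Modules over unital algebras need not be unital.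
\<close>

locale banach_left_module = cbanach_space E
  for A :: "'a cnormed" and E :: "'x cnormed" and l :: "'a \<Rightarrow> 'x \<Rightarrow> 'x" +
  assumes l_closed: "\<lbrakk>a \<in> carrier A; x \<in> carrier E\<rbrakk> \<Longrightarrow> l a x \<in> carrier E"
    and l_add_left: "\<lbrakk>a \<in> carrier A; b \<in> carrier A; x \<in> carrier E\<rbrakk>
          \<Longrightarrow> l (a \<oplus>\<^bsub>A\<^esub> b) x = l a x \<oplus>\<^bsub>E\<^esub> l b x"
    and l_add_right: "\<lbrakk>a \<in> carrier A; x \<in> carrier E; y \<in> carrier E\<rbrakk>
          \<Longrightarrow> l a (x \<oplus>\<^bsub>E\<^esub> y) = l a x \<oplus>\<^bsub>E\<^esub> l a y"
    and l_smult_left: "\<lbrakk>a \<in> carrier A; x \<in> carrier E\<rbrakk> \<Longrightarrow> l (c \<odot>\<^bsub>A\<^esub> a) x = c \<odot>\<^bsub>E\<^esub> l a x"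
    and l_smult_right: "\<lbrakk>a \<in> carrier A; x \<in> carrier E\<rbrakk> \<Longrightarrow> l a (c \<odot>\<^bsub>E\<^esub> x) = c \<odot>\<^bsub>E\<^esub> l a x"
    and l_assoc: "\<lbrakk>a \<in> carrier A; b \<in> carrier A; x \<in> carrier E\<rbrakk>
          \<Longrightarrow> l (a \<otimes>\<^bsub>A\<^esub> b) x = l a (l b x)"
    and l_bounded: "\<exists>C. \<forall>a\<in>carrier A. \<forall>x\<in>carrier E. nrm E (l a x) \<le> C * nrm A a * nrm E x"

locale banach_right_module = cbanach_space E
  for B :: "'b cnormed" and E :: "'x cnormed" and r :: "'x \<Rightarrow> 'b \<Rightarrow> 'x" +
  assumes r_closed: "\<lbrakk>b \<in> carrier B; x \<in> carrier E\<rbrakk> \<Longrightarrow> r x b \<in> carrier E"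
    and r_add_right: "\<lbrakk>a \<in> carrier B; b \<in> carrier B; x \<in> carrier E\<rbrakk>
          \<Longrightarrow> r x (a \<oplus>\<^bsub>B\<^esub> b) = r x a \<oplus>\<^bsub>E\<^esub> r x b"
    and r_add_left: "\<lbrakk>b \<in> carrier B; x \<in> carrier E; y \<in> carrier E\<rbrakk>
          \<Longrightarrow> r (x \<oplus>\<^bsub>E\<^esub> y) b = r x b \<oplus>\<^bsub>E\<^esub> r y b"
    and r_smult_right: "\<lbrakk>b \<in> carrier B; x \<in> carrier E\<rbrakk> \<Longrightarrow> r x (c \<odot>\<^bsub>B\<^esub> b) = c \<odot>\<^bsub>E\<^esub> r x b"
    and r_smult_left: "\<lbrakk>b \<in> carrier B; x \<in> carrier E\<rbrakk> \<Longrightarrow> r (c \<odot>\<^bsub>E\<^esub> x) b = c \<odot>\<^bsub>E\<^esub> r x b"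
    and r_assoc: "\<lbrakk>a \<in> carrier B; b \<in> carrier B; x \<in> carrier E\<rbrakk>
          \<Longrightarrow> r x (a \<otimes>\<^bsub>B\<^esub> b) = r (r x a) b"
    and r_bounded: "\<exists>C. \<forall>b\<in>carrier B. \<forall>x\<in>carrier E. nrm E (r x b) \<le> C * nrm E x * nrm B b"

text \<open>A Banach \<open>A,B\<close>-module; a Banach \<open>A\<close>-bimodule is the case \<open>B = A\<close>.\<close>

locale banach_bimodule = banach_left_module A E l + banach_right_module B E r
  for A :: "'a cnormed" and B :: "'b cnormed" and E :: "'x cnormed"
    and l :: "'a \<Rightarrow> 'x \<Rightarrow> 'x" and r :: "'x \<Rightarrow> 'b \<Rightarrow> 'x" +
  assumes lr_assoc: "\<lbrakk>a \<in> carrier A; b \<in> carrier B; x \<in> carrier E\<rbrakk>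
          \<Longrightarrow> r (l a x) b = l a (r x b)"

definition commutative_actions ::
  "'k cnormed \<Rightarrow> 'x cnormed \<Rightarrow> ('k \<Rightarrow> 'x \<Rightarrow> 'x) \<Rightarrow> ('x \<Rightarrow> 'k \<Rightarrow> 'x) \<Rightarrow> bool" where
  "commutative_actions K E lk rk \<longleftrightarrow> (\<forall>\<alpha>\<in>carrier K. \<forall>x\<in>carrier E. lk \<alpha> x = rk x \<alpha>)"

text \<open>
  A Banach algebra \<open>A\<close> that is a Banach \<open>K\<close>-module with compatible actions. Note that
  \<open>(a \<cdot> \<alpha>) b = a (\<alpha> \<cdot> b)\<close> is not required.
\<close>

locale banach_algebra_module = banach_algebra A + banach_bimodule K K A l r
  for K :: "'k cnormed" and A :: "'a cnormed"
    and l :: "'k \<Rightarrow> 'a \<Rightarrow> 'a" and r :: "'a \<Rightarrow> 'k \<Rightarrow> 'a" +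
  assumes l_mult: "\<lbrakk>\<alpha> \<in> carrier K; a \<in> carrier A; b \<in> carrier A\<rbrakk>
          \<Longrightarrow> l \<alpha> (a \<otimes>\<^bsub>A\<^esub> b) = l \<alpha> a \<otimes>\<^bsub>A\<^esub> b"
    and r_mult: "\<lbrakk>\<alpha> \<in> carrier K; a \<in> carrier A; b \<in> carrier A\<rbrakk>
          \<Longrightarrow> r (a \<otimes>\<^bsub>A\<^esub> b) \<alpha> = a \<otimes>\<^bsub>A\<^esub> r b \<alpha>"

text \<open>
  Compatibility of an \<open>A,B\<close>-module structure \<open>l, r\<close> on \<open>E\<close> with a \<open>K\<close>-bimodule structure \<open>lk, rk\<close>
  on \<open>E\<close>, where \<open>K\<close> acts on \<open>A\<close> by \<open>lA, rA\<close> and on \<open>B\<close> by \<open>lB, rB\<close>. For \<open>B = A\<close> these are the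
  identities of a Banach \<open>A\<close>-\<open>K\<close>-module. The same list is used for the off-diagonal module \<open>M\<close> of a
  triangular algebra, including the last two identities. Without those two, an amenable triangular
  algebra can have \<open>M \<noteq> 0\<close>: let \<open>K = A = B = M\<close> be the complex numbers, with all actions given by
  multiplication, except that the right action of \<open>K\<close> on \<open>A\<close> and the left action of \<open>K\<close> on \<open>B\<close> are
  zero.
\<close>

definition compatible_actions ::
  "'k cnormed \<Rightarrow> 'a cnormed \<Rightarrow> ('k \<Rightarrow> 'a \<Rightarrow> 'a) \<Rightarrow> ('a \<Rightarrow> 'k \<Rightarrow> 'a) \<Rightarrow>
   'b cnormed \<Rightarrow> ('k \<Rightarrow> 'b \<Rightarrow> 'b) \<Rightarrow> ('b \<Rightarrow> 'k \<Rightarrow> 'b) \<Rightarrow>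
   'x cnormed \<Rightarrow> ('a \<Rightarrow> 'x \<Rightarrow> 'x) \<Rightarrow> ('x \<Rightarrow> 'b \<Rightarrow> 'x) \<Rightarrow>
   ('k \<Rightarrow> 'x \<Rightarrow> 'x) \<Rightarrow> ('x \<Rightarrow> 'k \<Rightarrow> 'x) \<Rightarrow> bool" where
  "compatible_actions K A lA rA B lB rB E l r lk rk \<longleftrightarrow>
     (\<forall>\<alpha>\<in>carrier K. \<forall>a\<in>carrier A. \<forall>b\<in>carrier B. \<forall>x\<in>carrier E.
        lk \<alpha> (l a x) = l (lA \<alpha> a) x \<and>
        r (lk \<alpha> x) b = lk \<alpha> (r x b) \<and>
        r x (rB b \<alpha>) = rk (r x b) \<alpha> \<and>
        rk (l a x) \<alpha> = l a (rk x \<alpha>) \<and>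
        l a (lk \<alpha> x) = l (rA a \<alpha>) x \<and>
        r x (lB \<alpha> b) = r (rk x \<alpha>) b)"

definition commutative_banach_module ::
  "'k cnormed \<Rightarrow> 'a cnormed \<Rightarrow> ('k \<Rightarrow> 'a \<Rightarrow> 'a) \<Rightarrow> ('a \<Rightarrow> 'k \<Rightarrow> 'a) \<Rightarrow>
   'x cnormed \<Rightarrow> ('a \<Rightarrow> 'x \<Rightarrow> 'x) \<Rightarrow> ('x \<Rightarrow> 'a \<Rightarrow> 'x) \<Rightarrow>
   ('k \<Rightarrow> 'x \<Rightarrow> 'x) \<Rightarrow> ('x \<Rightarrow> 'k \<Rightarrow> 'x) \<Rightarrow> bool" where
  "commutative_banach_module K A lA rA E l r lk rk \<longleftrightarrow>
     banach_bimodule A A E l r \<and> banach_bimodule K K E lk rk \<and>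
     compatible_actions K A lA rA A lA rA E l r lk rk \<and> commutative_actions K E lk rk"

text \<open>Bounded complex-linear functionals, extensional so that equality is equality on the carrier.\<close>

definition dual_space :: "'x cnormed \<Rightarrow> ('x \<Rightarrow> complex) cnormed" where
  "dual_space E =
     \<lparr>carrier = {f \<in> extensional (carrier E).
         (\<forall>x\<in>carrier E. \<forall>y\<in>carrier E. f (x \<oplus>\<^bsub>E\<^esub> y) = f x + f y) \<and>
         (\<forall>c. \<forall>x\<in>carrier E. f (c \<odot>\<^bsub>E\<^esub> x) = c * f x) \<and>
         (\<exists>C. \<forall>x\<in>carrier E. cmod (f x) \<le> C * nrm E x)},
      monoid.mult = undefined, one = undefined,
      zero = (\<lambda>x\<in>carrier E. 0),
      add = (\<lambda>f g. \<lambda>x\<in>carrier E. f x + g x),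
      module.smult = (\<lambda>c f. \<lambda>x\<in>carrier E. c * f x),
      nrm = (\<lambda>f. SUP x\<in>{x \<in> carrier E. nrm E x \<le> 1}. cmod (f x))\<rparr>"

definition dual_left :: "'x cnormed \<Rightarrow> ('x \<Rightarrow> 'a \<Rightarrow> 'x) \<Rightarrow> 'a \<Rightarrow> ('x \<Rightarrow> complex) \<Rightarrow> 'x \<Rightarrow> complex" where
  "dual_left E r a f = (\<lambda>x\<in>carrier E. f (r x a))"

definition dual_right :: "'x cnormed \<Rightarrow> ('a \<Rightarrow> 'x \<Rightarrow> 'x) \<Rightarrow> ('x \<Rightarrow> complex) \<Rightarrow> 'a \<Rightarrow> 'x \<Rightarrow> complex" where
  "dual_right E l f a = (\<lambda>x\<in>carrier E. f (l a x))"

text \<open>\<open>D\<close> is only additive; complex-linearity is not required.\<close>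

definition module_derivation ::
  "'k cnormed \<Rightarrow> 'a cnormed \<Rightarrow> ('k \<Rightarrow> 'a \<Rightarrow> 'a) \<Rightarrow> ('a \<Rightarrow> 'k \<Rightarrow> 'a) \<Rightarrow>
   'y cnormed \<Rightarrow> ('a \<Rightarrow> 'y \<Rightarrow> 'y) \<Rightarrow> ('y \<Rightarrow> 'a \<Rightarrow> 'y) \<Rightarrow>
   ('k \<Rightarrow> 'y \<Rightarrow> 'y) \<Rightarrow> ('y \<Rightarrow> 'k \<Rightarrow> 'y) \<Rightarrow> ('a \<Rightarrow> 'y) \<Rightarrow> bool" where
  "module_derivation K A lA rA Y l r lk rk D \<longleftrightarrow>
     D \<in> carrier A \<rightarrow> carrier Y \<and>
     (\<forall>a\<in>carrier A. \<forall>b\<in>carrier A. D (a \<oplus>\<^bsub>A\<^esub> b) = D a \<oplus>\<^bsub>Y\<^esub> D b \<and> D (a \<ominus>\<^bsub>A\<^esub> b) = D a \<ominus>\<^bsub>Y\<^esub> D b) \<and>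
     (\<forall>\<alpha>\<in>carrier K. \<forall>a\<in>carrier A. D (lA \<alpha> a) = lk \<alpha> (D a) \<and> D (rA a \<alpha>) = rk (D a) \<alpha>) \<and>
     (\<exists>C>0. \<forall>a\<in>carrier A. nrm Y (D a) \<le> C * nrm A a) \<and>
     (\<forall>a\<in>carrier A. \<forall>b\<in>carrier A. D (a \<otimes>\<^bsub>A\<^esub> b) = r (D a) b \<oplus>\<^bsub>Y\<^esub> l a (D b))"

definition inner_derivation ::
  "'a cnormed \<Rightarrow> 'y cnormed \<Rightarrow> ('a \<Rightarrow> 'y \<Rightarrow> 'y) \<Rightarrow> ('y \<Rightarrow> 'a \<Rightarrow> 'y) \<Rightarrow> ('a \<Rightarrow> 'y) \<Rightarrow> bool" where
  "inner_derivation A Y l r D \<longleftrightarrow> (\<exists>y\<in>carrier Y. \<forall>a\<in>carrier A. D a = l a y \<ominus>\<^bsub>Y\<^esub> r y a)"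

text \<open>
  A formula cannot quantify over types, so the modules \<open>E\<close> range over all those whose carrier is a
  subset of the type \<open>'u\<close>; \<open>'u\<close> has to be large enough for this to be no restriction.
\<close>

definition module_amenable ::
  "'u itself \<Rightarrow> 'k cnormed \<Rightarrow> 'a cnormed \<Rightarrow> ('k \<Rightarrow> 'a \<Rightarrow> 'a) \<Rightarrow> ('a \<Rightarrow> 'k \<Rightarrow> 'a) \<Rightarrow> bool" where
  "module_amenable _ K A lA rA \<longleftrightarrow>
     (\<forall>(E :: 'u cnormed) l r lk rk D.
        commutative_banach_module K A lA rA E l r lk rk \<longrightarrow>
        module_derivation K A lA rA (dual_space E) (dual_left E r) (dual_right E l)
          (dual_left E rk) (dual_right E lk) D \<longrightarrow>
        inner_derivation A (dual_space E) (dual_left E r) (dual_right E l) D)"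

text \<open>
  \<open>'u\<close> is at least as large as the power of the continuum whose exponent is the sum of the
  cardinalities of \<open>'k\<close>, \<open>'a\<close>, \<open>'m\<close>, \<open>'b\<close>. It then has room for the dual of a Banach space on \<open>'m\<close> and
  for every countably generated Banach module over Banach algebras on \<open>'a\<close>, \<open>'b\<close>,
  \<open>('a, 'm, 'b) tri\<close> (below) and \<open>'k\<close>. The latter decide module amenability: functionals implementing
  the restriction of a derivation to countably generated submodules can be chosen with uniformly
  bounded norms (otherwise countably many of these submodules would generate one without an
  implementing functional), and a weak* cluster point of extensions of them implements the
  derivation on all of \<open>E\<close>.
\<close>

definition large_universe ::
  "'u itself \<Rightarrow> 'k cnormed \<Rightarrow> 'a cnormed \<Rightarrow> 'm cnormed \<Rightarrow> 'b cnormed \<Rightarrow> bool" where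
  "large_universe _ K A M B \<longleftrightarrow> (\<exists>\<iota> :: ('k + 'a + 'm + 'b \<Rightarrow> complex) \<Rightarrow> 'u. inj \<iota>)"

text \<open>\<open>Tri a m b\<close> is the upper triangular matrix with diagonal \<open>a, b\<close> and upper right entry \<open>m\<close>.\<close>

datatype ('a, 'm, 'b) tri = Tri (e11: 'a) (e12: 'm) (e22: 'b)

definition triangular ::
  "'a cnormed \<Rightarrow> 'm cnormed \<Rightarrow> 'b cnormed \<Rightarrow> ('a \<Rightarrow> 'm \<Rightarrow> 'm) \<Rightarrow> ('m \<Rightarrow> 'b \<Rightarrow> 'm) \<Rightarrow>
   ('a, 'm, 'b) tri cnormed" where
  "triangular A M B l r =
     \<lparr>carrier = {Tri a m b | a m b. a \<in> carrier A \<and> m \<in> carrier M \<and> b \<in> carrier B},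
      monoid.mult = (\<lambda>s t. Tri (e11 s \<otimes>\<^bsub>A\<^esub> e11 t) (l (e11 s) (e12 t) \<oplus>\<^bsub>M\<^esub> r (e12 s) (e22 t)) (e22 s \<otimes>\<^bsub>B\<^esub> e22 t)),
      one = undefined,
      zero = Tri \<zero>\<^bsub>A\<^esub> \<zero>\<^bsub>M\<^esub> \<zero>\<^bsub>B\<^esub>,
      add = (\<lambda>s t. Tri (e11 s \<oplus>\<^bsub>A\<^esub> e11 t) (e12 s \<oplus>\<^bsub>M\<^esub> e12 t) (e22 s \<oplus>\<^bsub>B\<^esub> e22 t)),
      module.smult = (\<lambda>c t. Tri (c \<odot>\<^bsub>A\<^esub> e11 t) (c \<odot>\<^bsub>M\<^esub> e12 t) (c \<odot>\<^bsub>B\<^esub> e22 t)),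
      nrm = (\<lambda>t. nrm A (e11 t) + nrm M (e12 t) + nrm B (e22 t))\<rparr>"

text \<open>The algebra of matrices \<open>Tri \<alpha> 0 \<alpha>\<close>, inside the upper triangular matrices over \<open>K\<close>.\<close>

definition scalar_diagonal :: "'k cnormed \<Rightarrow> ('k, 'k, 'k) tri cnormed" where
  "scalar_diagonal K =
     (triangular K K K (monoid.mult K) (monoid.mult K)) \<lparr>carrier := {Tri \<alpha> \<zero>\<^bsub>K\<^esub> \<alpha> | \<alpha>. \<alpha> \<in> carrier K}\<rparr>"

definition tri_left ::
  "('k \<Rightarrow> 'a \<Rightarrow> 'a) \<Rightarrow> ('k \<Rightarrow> 'm \<Rightarrow> 'm) \<Rightarrow> ('k \<Rightarrow> 'b \<Rightarrow> 'b) \<Rightarrow>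
   ('k, 'k, 'k) tri \<Rightarrow> ('a, 'm, 'b) tri \<Rightarrow> ('a, 'm, 'b) tri" where
  "tri_left lA lM lB s t = Tri (lA (e11 s) (e11 t)) (lM (e11 s) (e12 t)) (lB (e22 s) (e22 t))"

definition tri_right ::
  "('a \<Rightarrow> 'k \<Rightarrow> 'a) \<Rightarrow> ('m \<Rightarrow> 'k \<Rightarrow> 'm) \<Rightarrow> ('b \<Rightarrow> 'k \<Rightarrow> 'b) \<Rightarrow>
   ('a, 'm, 'b) tri \<Rightarrow> ('k, 'k, 'k) tri \<Rightarrow> ('a, 'm, 'b) tri" where
  "tri_right rA rM rB t s = Tri (rA (e11 t) (e11 s)) (rM (e12 t) (e22 s)) (rB (e22 t) (e22 s))"

end

theory Submission
  imports Defs
begin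

text \<open>
  If \<open>T\<close> is module amenable, so are its quotients \<open>A\<close> and \<open>B\<close>. The corner \<open>M\<close> is an ideal that acts
  trivially on the \<open>T\<close>-module \<open>M*\<close>, so inner derivations into \<open>M**\<close> vanish on it. But the
  off-diagonal entry \<open>T \<rightarrow> M \<subseteq> M**\<close> is a module derivation, and \<open>M \<rightarrow> M**\<close> is injective by
  Hahn--Banach; hence \<open>M = 0\<close>.

  Conversely let \<open>T = A \<oplus> B\<close> and let \<open>D : T \<rightarrow> X*\<close> be a module derivation. On \<open>A\<close> it is implemented
  by some \<open>f\<close>. The difference of \<open>D\<close> and the inner derivation of \<open>f\<close> vanishes on \<open>A\<close>, and since
  \<open>A B = 0 = B A\<close> it maps \<open>B\<close> into the annihilator of \<open>A X + X A\<close>, which is the dual of a quotient of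
  \<open>X\<close>. So on \<open>B\<close> it is implemented by some \<open>g\<close> in that annihilator, and \<open>f + g\<close> implements \<open>D\<close>.
\<close>

section \<open>Normed spaces\<close>

text \<open>Structure is moved along bounded homomorphisms instead: the projections
  \<open>e11\<close> and \<open>e22\<close> turn modules over \<open>A\<close> and \<open>B\<close>
  into modules over \<open>T\<close>, the embeddings \<open>inA\<close> and \<open>inB\<close>
  restrict modules over \<open>T\<close> to the corners. The test module is the dual of
  \<open>M\<close> rather than \<open>M\<close> itself, because amenability speaks about derivations
  into duals and \<open>M\<close> embeds into its bidual. In the converse direction a functional
  implementing the derivation on \<open>B\<close> could spoil what \<open>f\<close> achieves on
  \<open>A\<close>; choosing it on the quotient by the closure of \<open>A X + X A\<close> makes it
  invisible to \<open>A\<close>.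

  The other obstacle is size: amenability only sees modules inside the type \<open>'u\<close>. The
  dual of \<open>M\<close> has to be copied into \<open>'u\<close>, and the quotient of
  \<open>X\<close> must not leave it. Both are instances of \<open>quotient_map\<close>, the first
  with an injection and the second with representatives of cosets, so that
  \<open>module_amenable_quotient\<close> serves both directions.\<close>

lemma ring_of_type_algebra_simps [simp]:
  "carrier (ring_of_type_algebra :: 'a :: ring_1 ring) = UNIV"
  "monoid.mult (ring_of_type_algebra :: 'a :: ring_1 ring) = (*)"
  "one (ring_of_type_algebra :: 'a :: ring_1 ring) = 1"
  "zero (ring_of_type_algebra :: 'a :: ring_1 ring) = 0"
  "add (ring_of_type_algebra :: 'a :: ring_1 ring) = (+)"
  by (simp_all add: ring_of_type_algebra_def)

lemma complex_moduleI:
  fixes E (structure)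
  assumes "abelian_group E"
    and "\<And>c x. x \<in> carrier E \<Longrightarrow> c \<odot> x \<in> carrier E"
    and "\<And>c d x. x \<in> carrier E \<Longrightarrow> (c + d) \<odot> x = c \<odot> x \<oplus> d \<odot> x"
    and "\<And>c x y. \<lbrakk>x \<in> carrier E; y \<in> carrier E\<rbrakk> \<Longrightarrow> c \<odot> (x \<oplus> y) = c \<odot> x \<oplus> c \<odot> y"
    and "\<And>c d x. x \<in> carrier E \<Longrightarrow> (c * d) \<odot> x = c \<odot> (d \<odot> x)"
    and "\<And>x. x \<in> carrier E \<Longrightarrow> 1 \<odot> x = x"
  shows "module (ring_of_type_algebra :: complex ring) E"
  by (rule moduleI) (use assms in \<open>simp_all add: cring_from_type_algebra\<close>)

text \<open>Completeness is split off so that duals and images can be treated as normed spaces, with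
  all of the calculus below, while their completeness is still being proved. The algebra on which a
  derivation lives enters only through this structure.\<close>

locale cnormed_space =
  module "ring_of_type_algebra :: complex ring" E for E :: "'x cnormed" (structure) +
  assumes nrm_nonneg: "x \<in> carrier E \<Longrightarrow> 0 \<le> nrm E x"
    and nrm_eq_0: "x \<in> carrier E \<Longrightarrow> nrm E x = 0 \<longleftrightarrow> x = \<zero>"
    and nrm_smult: "x \<in> carrier E \<Longrightarrow> nrm E (c \<odot> x) = cmod c * nrm E x"
    and nrm_add: "\<lbrakk>x \<in> carrier E; y \<in> carrier E\<rbrakk> \<Longrightarrow> nrm E (x \<oplus> y) \<le> nrm E x + nrm E y"
begin

lemma smult_mem [simp]: "x \<in> carrier E \<Longrightarrow> c \<odot> x \<in> carrier E"
  by simp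

lemma smult_add_left: "x \<in> carrier E \<Longrightarrow> (c + d) \<odot> x = c \<odot> x \<oplus> d \<odot> x"
  using smult_l_distr[of c d x] by simp

lemma smult_add_right:
  "\<lbrakk>x \<in> carrier E; y \<in> carrier E\<rbrakk> \<Longrightarrow> c \<odot> (x \<oplus> y) = c \<odot> x \<oplus> c \<odot> y"
  using smult_r_distr[of c x y] by simp

lemma smult_smult: "x \<in> carrier E \<Longrightarrow> c \<odot> (d \<odot> x) = (c * d) \<odot> x"
  using smult_assoc1[of c d x] by simp

lemma smult_1 [simp]: "x \<in> carrier E \<Longrightarrow> 1 \<odot> x = x"
  using smult_one[of x] by simp

lemma smult_0 [simp]: "x \<in> carrier E \<Longrightarrow> 0 \<odot> x = \<zero>"
  using smult_l_null[of x] by simp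

lemma smult_zero [simp]: "c \<odot> \<zero> = \<zero>"
  using smult_r_null[of c] by simp

lemma uminus_eq_smult: "x \<in> carrier E \<Longrightarrow> \<ominus> x = (- 1) \<odot> x"
  by (rule minus_equality) (use smult_add_left[of x "-1" 1] in auto)

lemma minus_eq_smult: "y \<in> carrier E \<Longrightarrow> x \<ominus> y = x \<oplus> (- 1) \<odot> y"
  by (simp add: minus_eq uminus_eq_smult)

lemma nrm_zero [simp]: "nrm E \<zero> = 0"
  by (simp add: nrm_eq_0)

lemma nrm_uminus: "x \<in> carrier E \<Longrightarrow> nrm E (\<ominus> x) = nrm E x"
  by (simp add: uminus_eq_smult nrm_smult)

lemma minus_add_minus:
  "\<lbrakk>x \<in> carrier E; y \<in> carrier E; z \<in> carrier E\<rbrakk> \<Longrightarrow> (x \<ominus> y) \<oplus> (y \<ominus> z) = x \<ominus> z"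
  by (simp add: minus_eq a_assoc) (metis a_assoc a_inv_closed l_neg l_zero)

lemma uminus_minus: "\<lbrakk>x \<in> carrier E; y \<in> carrier E\<rbrakk> \<Longrightarrow> \<ominus> (x \<ominus> y) = y \<ominus> x"
  by (simp add: minus_eq minus_add a_comm)

lemma minus_eq_zero_iff: "\<lbrakk>x \<in> carrier E; y \<in> carrier E\<rbrakk> \<Longrightarrow> x \<ominus> y = \<zero> \<longleftrightarrow> x = y"
  by (metis minus_eq r_neg a_inv_closed minus_equality minus_minus)

lemma minus_minus_minus:
  "\<lbrakk>x \<in> carrier E; y \<in> carrier E; z \<in> carrier E; w \<in> carrier E\<rbrakk>
    \<Longrightarrow> (x \<oplus> y) \<ominus> (z \<oplus> w) = (x \<ominus> z) \<oplus> (y \<ominus> w)"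
  by (simp add: minus_eq minus_add a_ac)

lemma minus_add_cancel: "\<lbrakk>x \<in> carrier E; y \<in> carrier E\<rbrakk> \<Longrightarrow> (x \<ominus> y) \<oplus> y = x"
  by (simp add: minus_eq a_assoc l_neg)

lemma nrm_minus_commute:
  "\<lbrakk>x \<in> carrier E; y \<in> carrier E\<rbrakk> \<Longrightarrow> nrm E (x \<ominus> y) = nrm E (y \<ominus> x)"
  by (metis nrm_uminus uminus_minus minus_closed)

lemma nrm_triangle:
  "\<lbrakk>x \<in> carrier E; y \<in> carrier E; z \<in> carrier E\<rbrakk>
    \<Longrightarrow> nrm E (x \<ominus> z) \<le> nrm E (x \<ominus> y) + nrm E (y \<ominus> z)"
  using nrm_add[of "x \<ominus> y" "y \<ominus> z"] by (simp add: minus_add_minus)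

lemma Metric_space: "Metric_space (carrier E) (ndist E)"
proof
  show "0 \<le> ndist E x y" for x y
    by (simp add: ndist_def nrm_nonneg)
  show "ndist E x y = ndist E y x" for x y
    by (simp add: ndist_def nrm_minus_commute)
  show "ndist E x y = 0 \<longleftrightarrow> x = y" if "x \<in> carrier E" "y \<in> carrier E" for x y
    using that by (simp add: ndist_def nrm_eq_0 minus_eq_zero_iff)
  show "ndist E x z \<le> ndist E x y + ndist E y z"
    if "x \<in> carrier E" "y \<in> carrier E" "z \<in> carrier E" for x y z
    using that by (simp add: ndist_def nrm_triangle)
qed

sublocale metric: Metric_space "carrier E" "ndist E"
  by (rule Metric_space)

lemma ndist_eq: "\<lbrakk>x \<in> carrier E; y \<in> carrier E\<rbrakk> \<Longrightarrow> ndist E x y = nrm E (x \<ominus> y)"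
  by (simp add: ndist_def)

lemma limitin_iff_nrm:
  assumes "\<And>n. x n \<in> carrier E"
  shows "limitin metric.mtopology x y sequentially \<longleftrightarrow>
    y \<in> carrier E \<and> (\<lambda>n. nrm E (x n \<ominus> y)) \<longlonglongrightarrow> 0"
  using assms by (auto simp: metric.limitin_metric_dist_null ndist_eq)

lemma geometric_tail:
  assumes x: "\<And>n. x n \<in> carrier E"
    and step: "\<And>n. nrm E (x (Suc n) \<ominus> x n) \<le> (1/2) ^ n"
  shows "nrm E (x (n + k) \<ominus> x n) \<le> 2 * (1/2) ^ n"
proof -
  \<comment> \<open>Subtracting the remainder of the geometric series strengthens the claim enough
    for the induction on \<open>k\<close>.\<close>
  have "nrm E (x (n + k) \<ominus> x n) \<le> 2 * (1/2) ^ n - 2 * (1/2) ^ (n + k)"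
  proof (induction k)
    case 0
    have "x n \<ominus> x n = \<zero>"
      using x by (simp add: minus_eq_zero_iff)
    then show ?case by simp
  next
    case (Suc k)
    have "nrm E (x (n + Suc k) \<ominus> x n)
        \<le> nrm E (x (Suc (n + k)) \<ominus> x (n + k)) + nrm E (x (n + k) \<ominus> x n)"
      using nrm_triangle[of "x (Suc (n + k))" "x (n + k)" "x n"] x by simp
    also have "\<dots> \<le> (1/2) ^ (n + k) + (2 * (1/2) ^ n - 2 * (1/2) ^ (n + k))"
      by (intro add_mono step Suc.IH)
    also have "\<dots> = 2 * (1/2) ^ n - 2 * (1/2) ^ (n + Suc k)"
      by simp
    finally show ?case .
  qed
  also have "\<dots> \<le> 2 * (1/2) ^ n" by simp
  finally show ?thesis .
qed

text \<open>Completeness needs to be tested only on sequences with geometrically decreasing steps, since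
  every Cauchy sequence has such a subsequence.\<close>

lemma cbanach_spaceI:
  assumes lim: "\<And>x. \<lbrakk>\<And>n. x n \<in> carrier E; \<And>n. nrm E (x (Suc n) \<ominus> x n) \<le> (1/2) ^ n\<rbrakk>
      \<Longrightarrow> \<exists>y\<in>carrier E. (\<lambda>n. nrm E (x n \<ominus> y)) \<longlonglongrightarrow> 0"
  shows "cbanach_space E"
proof unfold_locales
  show "metric.mcomplete"
    unfolding metric.mcomplete_def
  proof (intro allI impI)
    fix \<sigma> assume C: "metric.MCauchy \<sigma>"
    then have \<sigma>: "\<sigma> n \<in> carrier E" for n
      by (auto simp: metric.MCauchy_def)
    have "\<exists>N. \<forall>m n. N \<le> m \<longrightarrow> N \<le> n \<longrightarrow> ndist E (\<sigma> m) (\<sigma> n) < (1/2) ^ k" for k :: nat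
      using C by (auto simp: metric.MCauchy_def)
    then obtain N where N: "\<And>k m n. \<lbrakk>N k \<le> m; N k \<le> n\<rbrakk> \<Longrightarrow> ndist E (\<sigma> m) (\<sigma> n) < (1/2) ^ k"
      by metis
    \<comment> \<open>The summand \<open>k\<close> and the accumulated sum make
      \<open>\<rho>\<close> strictly increasing, and the sum dominates each
      \<open>N k\<close>.\<close>
    define \<rho> where "\<rho> k = k + (\<Sum>i\<le>k. N i)" for k
    have mono: "strict_mono \<rho>"
      by (simp add: strict_mono_Suc_iff \<rho>_def)
    have ge: "N k \<le> \<rho> k" for k
      unfolding \<rho>_def using member_le_sum[of k "{..k}" N] by simp
    have ge': "N k \<le> \<rho> (Suc k)" for k
      using ge[of k] mono by (meson le_trans less_imp_le_nat strict_mono_Suc_iff)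
    have "nrm E (\<sigma> (\<rho> (Suc k)) \<ominus> \<sigma> (\<rho> k)) \<le> (1/2) ^ k" for k
      using N[OF ge'[of k] ge[of k]] \<sigma> by (simp add: ndist_eq less_imp_le)
    then obtain y where "y \<in> carrier E" "(\<lambda>n. nrm E (\<sigma> (\<rho> n) \<ominus> y)) \<longlonglongrightarrow> 0"
      using lim[of "\<lambda>k. \<sigma> (\<rho> k)"] \<sigma> by blast
    then have "limitin metric.mtopology (\<sigma> \<circ> \<rho>) y sequentially"
      using \<sigma> by (subst limitin_iff_nrm) (auto simp: o_def)
    then show "\<exists>y. limitin metric.mtopology \<sigma> y sequentially"
      using metric.MCauchy_convergent_subsequence[OF C mono] by blast
  qed
qed (use nrm_nonneg nrm_eq_0 nrm_smult nrm_add in auto)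

end

text \<open>The inequality for \<open>c\<close>, applied to \<open>1 / c\<close> and the vector
  \<open>c x\<close>, yields the reverse one. For a norm given by a supremum or an infimum only one
  direction is immediate.\<close>

lemma cnormed_spaceI:
  fixes E (structure)
  assumes "module (ring_of_type_algebra :: complex ring) E"
    and nonneg: "\<And>x. x \<in> carrier E \<Longrightarrow> 0 \<le> nrm E x"
    and eq_0: "\<And>x. x \<in> carrier E \<Longrightarrow> nrm E x = 0 \<longleftrightarrow> x = \<zero>"
    and smult: "\<And>c x. x \<in> carrier E \<Longrightarrow> nrm E (c \<odot> x) \<le> cmod c * nrm E x"
    and add: "\<And>x y. \<lbrakk>x \<in> carrier E; y \<in> carrier E\<rbrakk> \<Longrightarrow> nrm E (x \<oplus> y) \<le> nrm E x + nrm E y"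
  shows "cnormed_space E"
proof -
  interpret module "ring_of_type_algebra :: complex ring" E by fact
  show ?thesis
  proof
    fix c x assume x: "x \<in> carrier E"
    then have cx: "c \<odot> x \<in> carrier E" by simp
    show "nrm E (c \<odot> x) = cmod c * nrm E x"
    proof (cases "c = 0")
      case True
      then show ?thesis using smult[OF x, of 0] nonneg[OF cx] by simp
    next
      case False
      then have "x = (1 / c) \<odot> (c \<odot> x)"
        using smult_assoc1[of "1 / c" c x] smult_one[OF x] x by simp
      then have "nrm E x \<le> cmod (1 / c) * nrm E (c \<odot> x)"
        using smult[OF cx, of "1 / c"] by simp
      then have "cmod c * nrm E x \<le> nrm E (c \<odot> x)"
        using False by (simp add: norm_divide field_simps)
      then show ?thesis using smult[OF x, of c] by simp
    qed
  qed (use nonneg eq_0 add in auto)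
qed

sublocale cbanach_space \<subseteq> cnormed_space
  by unfold_locales (use nrm_nonneg nrm_eq_0 nrm_smult nrm_add in auto)

lemma (in cbanach_space) geometric_limit:
  assumes x: "\<And>n. x n \<in> carrier E"
    and step: "\<And>n. nrm E (x (Suc n) \<ominus> x n) \<le> (1/2) ^ n"
  shows "\<exists>y\<in>carrier E. (\<lambda>n. nrm E (x n \<ominus> y)) \<longlonglongrightarrow> 0"
proof -
  have "metric.MCauchy x"
    unfolding metric.MCauchy_def
  proof (intro conjI allI impI)
    show "range x \<subseteq> carrier E" using x by auto
    fix e :: real assume "e > 0"
    \<comment> \<open>The tail after \<open>N\<close> is at most \<open>2 * (1/2) ^ N\<close>, hence
      below \<open>e / 2\<close>, and two such distances are added.\<close>
    then obtain N where N: "(1/2 :: real) ^ N < e / 4"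
      using real_arch_pow_inv[of "e / 4" "1/2"] by auto
    have "ndist E (x m) (x N) < e / 2" if "N \<le> m" for m
      using geometric_tail[OF x step, of N "m - N"] that x N by (simp add: ndist_eq)
    then have "ndist E (x m) (x n) < e" if "N \<le> m" "N \<le> n" for m n
      using metric.triangle[of "x m" "x N" "x n"] x that
      by (smt (verit, ccfv_SIG) metric.commute field_sum_of_halves)
    then show "\<exists>N. \<forall>n n'. N \<le> n \<longrightarrow> N \<le> n' \<longrightarrow> ndist E (x n) (x n') < e"
      by blast
  qed
  then obtain y where "limitin metric.mtopology x y sequentially"
    using complete unfolding metric.mcomplete_def by blast
  then show ?thesis
    using x by (auto simp: limitin_iff_nrm)
qed

section \<open>Dual spaces\<close>

lemma dual_space_simps [simp]:
  "zero (dual_space E) = (\<lambda>x\<in>carrier E. 0)"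
  "add (dual_space E) f g = (\<lambda>x\<in>carrier E. f x + g x)"
  "module.smult (dual_space E) c f = (\<lambda>x\<in>carrier E. c * f x)"
  by (simp_all add: dual_space_def)

lemma dual_space_carrier:
  "f \<in> carrier (dual_space E) \<longleftrightarrow> f \<in> extensional (carrier E) \<and>
     (\<forall>x\<in>carrier E. \<forall>y\<in>carrier E. f (x \<oplus>\<^bsub>E\<^esub> y) = f x + f y) \<and>
     (\<forall>c. \<forall>x\<in>carrier E. f (c \<odot>\<^bsub>E\<^esub> x) = c * f x) \<and>
     (\<exists>C. \<forall>x\<in>carrier E. cmod (f x) \<le> C * nrm E x)"
  by (simp add: dual_space_def)

lemma dual_add:
  "\<lbrakk>f \<in> carrier (dual_space E); x \<in> carrier E; y \<in> carrier E\<rbrakk> \<Longrightarrow> f (x \<oplus>\<^bsub>E\<^esub> y) = f x + f y"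
  by (simp add: dual_space_carrier)

lemma dual_smult:
  "\<lbrakk>f \<in> carrier (dual_space E); x \<in> carrier E\<rbrakk> \<Longrightarrow> f (c \<odot>\<^bsub>E\<^esub> x) = c * f x"
  by (simp add: dual_space_carrier)

lemma dual_ext:
  assumes "f \<in> carrier (dual_space E)" "g \<in> carrier (dual_space E)"
    and "\<And>x. x \<in> carrier E \<Longrightarrow> f x = g x"
  shows "f = g"
  using assms by (intro extensionalityI[of f "carrier E"]) (auto simp: dual_space_carrier)

context cnormed_space
begin

abbreviation "E' \<equiv> dual_space E"

lemma dual_restrictI:
  assumes "\<And>x y. \<lbrakk>x \<in> carrier E; y \<in> carrier E\<rbrakk> \<Longrightarrow> f (x \<oplus> y) = f x + f y"
    and "\<And>c x. x \<in> carrier E \<Longrightarrow> f (c \<odot> x) = c * f x"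
    and "\<And>x. x \<in> carrier E \<Longrightarrow> cmod (f x) \<le> C * nrm E x"
  shows "restrict f (carrier E) \<in> carrier E'"
  unfolding dual_space_carrier using assms
  by (intro conjI exI[of _ C] ballI allI) (simp_all add: restrict_apply')

lemma dual_zero: "f \<in> carrier E' \<Longrightarrow> f \<zero> = 0"
  using dual_smult[of f E \<zero> 0] by simp

lemma dual_nrm_def: "nrm E' f = (SUP x\<in>{x \<in> carrier E. nrm E x \<le> 1}. cmod (f x))"
  by (simp add: dual_space_def)

lemma dual_nrm_le:
  assumes "\<And>x. x \<in> carrier E \<Longrightarrow> cmod (f x) \<le> C * nrm E x" and "0 \<le> C"
  shows "nrm E' f \<le> C"
  unfolding dual_nrm_def
proof (rule cSUP_least)
  show "{x \<in> carrier E. nrm E x \<le> 1} \<noteq> {}"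
    using nrm_zero by fastforce
  fix x assume x: "x \<in> {x \<in> carrier E. nrm E x \<le> 1}"
  then have "cmod (f x) \<le> C * nrm E x"
    using assms(1) by blast
  also have "\<dots> \<le> C * 1"
    using x assms(2) by (intro mult_left_mono) auto
  finally show "cmod (f x) \<le> C" by simp
qed

lemma dual_upper:
  assumes f: "f \<in> carrier E'" and x: "x \<in> carrier E" "nrm E x \<le> 1"
  shows "cmod (f x) \<le> nrm E' f"
proof -
  obtain C where C: "\<forall>x\<in>carrier E. cmod (f x) \<le> C * nrm E x"
    using f unfolding dual_space_carrier by blast
  have "bdd_above ((\<lambda>x. cmod (f x)) ` {x \<in> carrier E. nrm E x \<le> 1})"
  proof (rule bdd_aboveI2)
    fix z assume z: "z \<in> {x \<in> carrier E. nrm E x \<le> 1}"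
    then have "cmod (f z) \<le> C * nrm E z" using C by simp
    \<comment> \<open>On a trivial space \<open>C\<close> may be negative, hence the absolute
      value.\<close>
    also have "\<dots> \<le> \<bar>C\<bar> * 1"
      using z nrm_nonneg[of z] by (intro mult_mono) auto
    finally show "cmod (f z) \<le> \<bar>C\<bar>" by simp
  qed
  then show ?thesis
    unfolding dual_nrm_def using x by (intro cSUP_upper) auto
qed

lemma dual_bound:
  assumes f: "f \<in> carrier E'" and x: "x \<in> carrier E"
  shows "cmod (f x) \<le> nrm E' f * nrm E x"
proof (cases "x = \<zero>")
  case True
  then show ?thesis using dual_zero[OF f] by simp
next
  case False
  then have pos: "nrm E x > 0"
    using x nrm_eq_0[of x] nrm_nonneg[of x] by simp
  define y where "y = complex_of_real (inverse (nrm E x)) \<odot> x"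
  have y: "y \<in> carrier E" "nrm E y = 1"
    using x pos by (simp_all add: y_def nrm_smult norm_inverse del: of_real_inverse)
  have "cmod (f y) \<le> nrm E' f"
    using y by (intro dual_upper f) auto
  moreover have "cmod (f y) = inverse (nrm E x) * cmod (f x)"
    using pos x by (simp add: y_def dual_smult[OF f] norm_mult norm_inverse)
  ultimately show ?thesis
    using pos by (simp add: field_simps)
qed

lemma dual_nrm_nonneg: "f \<in> carrier E' \<Longrightarrow> 0 \<le> nrm E' f"
  using dual_upper[of f \<zero>] by (simp add: dual_zero)

lemma dual_abelian_group: "abelian_group E'"
proof (rule abelian_groupI)
  fix f g assume fg: "f \<in> carrier E'" "g \<in> carrier E'"
  have bound: "cmod (f x + g x) \<le> (nrm E' f + nrm E' g) * nrm E x" if "x \<in> carrier E" for x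
    using dual_bound[OF fg(1) that] dual_bound[OF fg(2) that] norm_triangle_ineq[of "f x" "g x"]
    by (simp add: distrib_right)
  show "f \<oplus>\<^bsub>E'\<^esub> g \<in> carrier E'"
    unfolding dual_space_simps
    by (rule dual_restrictI[OF _ _ bound]) (use fg in \<open>simp_all add: dual_add dual_smult distrib_left\<close>)
next
  show "\<zero>\<^bsub>E'\<^esub> \<in> carrier E'"
    unfolding dual_space_simps by (rule dual_restrictI[where C = 0]) simp_all
next
  fix f assume f: "f \<in> carrier E'"
  have "(\<lambda>x\<in>carrier E. - f x) \<in> carrier E'"
    by (rule dual_restrictI[where C = "nrm E' f"]) (use dual_bound[OF f] f in \<open>simp_all add: dual_add dual_smult\<close>)
  then show "\<exists>g\<in>carrier E'. g \<oplus>\<^bsub>E'\<^esub> f = \<zero>\<^bsub>E'\<^esub>"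
    by (rule bexI[rotated]) auto
qed (auto simp: add.commute add.left_commute dual_space_carrier intro!: extensionalityI)

lemma dual_module: "module (ring_of_type_algebra :: complex ring) E'"
proof (rule complex_moduleI[OF dual_abelian_group])
  fix c f assume f: "f \<in> carrier E'"
  have bound: "cmod (c * f x) \<le> (cmod c * nrm E' f) * nrm E x" if "x \<in> carrier E" for x
    using dual_bound[OF f that] by (simp add: norm_mult mult.assoc mult_left_mono)
  show "c \<odot>\<^bsub>E'\<^esub> f \<in> carrier E'"
    unfolding dual_space_simps
    by (rule dual_restrictI[OF _ _ bound]) (use f in \<open>simp_all add: dual_add dual_smult distrib_left\<close>)
qed (auto simp: algebra_simps dual_space_carrier intro!: extensionalityI)

lemma dual_cnormed_space: "cnormed_space E'"
proof -
  interpret D: module "ring_of_type_algebra :: complex ring" E'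
    by (rule dual_module)
  show ?thesis
  proof (rule cnormed_spaceI[OF dual_module])
    fix f assume f: "f \<in> carrier E'"
    show "0 \<le> nrm E' f"
      by (rule dual_nrm_nonneg[OF f])
    show "nrm E' f = 0 \<longleftrightarrow> f = \<zero>\<^bsub>E'\<^esub>"
    proof
      assume "nrm E' f = 0"
      then have "f x = 0" if "x \<in> carrier E" for x
        using dual_bound[OF f that] by simp
      then show "f = \<zero>\<^bsub>E'\<^esub>"
        by (intro dual_ext[OF f D.zero_closed]) simp
    next
      assume "f = \<zero>\<^bsub>E'\<^esub>"
      then have "nrm E' f \<le> 0"
        by (intro dual_nrm_le) auto
      then show "nrm E' f = 0"
        using dual_nrm_nonneg[OF f] by simp
    qed
    show "nrm E' (c \<odot>\<^bsub>E'\<^esub> f) \<le> cmod c * nrm E' f" for c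
      using dual_bound[OF f] dual_nrm_nonneg[OF f]
      by (intro dual_nrm_le) (auto simp: norm_mult mult.assoc mult_left_mono)
    fix g assume g: "g \<in> carrier E'"
    show "nrm E' (f \<oplus>\<^bsub>E'\<^esub> g) \<le> nrm E' f + nrm E' g"
    proof (rule dual_nrm_le)
      fix x assume x: "x \<in> carrier E"
      then show "cmod ((f \<oplus>\<^bsub>E'\<^esub> g) x) \<le> (nrm E' f + nrm E' g) * nrm E x"
        using dual_bound[OF f x] dual_bound[OF g x] norm_triangle_ineq[of "f x" "g x"]
        by (simp add: distrib_right)
    qed (use dual_nrm_nonneg f g in auto)
  qed
qed

lemma dual_minus_apply:
  assumes "f \<in> carrier E'" "g \<in> carrier E'" "x \<in> carrier E"
  shows "(f \<ominus>\<^bsub>E'\<^esub> g) x = f x - g x"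
proof -
  interpret D: cnormed_space E' by (rule dual_cnormed_space)
  show ?thesis
    using assms by (simp add: D.minus_eq_smult)
qed

text \<open>Completeness comes from the complex numbers: the functionals converge pointwise, and the
  geometric tail estimate, which is uniform on the unit ball, survives the passage to the pointwise
  limit.\<close>

lemma dual_cbanach_space: "cbanach_space E'"
proof -
  interpret D: cnormed_space E' by (rule dual_cnormed_space)
  show ?thesis
  proof (rule D.cbanach_spaceI)
    fix f :: "nat \<Rightarrow> 'x \<Rightarrow> complex"
    assume f: "f n \<in> carrier E'" and step: "nrm E' (f (Suc n) \<ominus>\<^bsub>E'\<^esub> f n) \<le> (1/2) ^ n" for n
    have tail: "cmod (f (n + k) x - f n x) \<le> 2 * (1/2) ^ n * nrm E x" if x: "x \<in> carrier E" for n k x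
    proof -
      have "cmod (f (n + k) x - f n x) \<le> nrm E' (f (n + k) \<ominus>\<^bsub>E'\<^esub> f n) * nrm E x"
        using dual_bound[of "f (n + k) \<ominus>\<^bsub>E'\<^esub> f n" x] f x by (simp add: dual_minus_apply)
      also have "\<dots> \<le> 2 * (1/2) ^ n * nrm E x"
        using x by (intro mult_right_mono D.geometric_tail f step nrm_nonneg)
      finally show ?thesis .
    qed
    have null: "(\<lambda>n. 2 * (1/2) ^ n * c) \<longlonglongrightarrow> 0" for c :: real
      using tendsto_mult_right_zero[OF LIMSEQ_realpow_zero[of "1/2 :: real"], of "2 * c"]
      by (simp add: mult_ac)
    have "convergent (\<lambda>n. f n x)" if x: "x \<in> carrier E" for x
    proof -
      have "Cauchy (\<lambda>n. f n x)"
      proof (rule metric_CauchyI)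
        fix e :: real assume "e > 0"
        then obtain N where N: "2 * (1/2) ^ N * nrm E x < e / 2"
          using order_tendstoD(2)[OF null[of "nrm E x"], of "e / 2"]
          by (auto simp: eventually_sequentially)
        have "dist (f m x) (f N x) < e / 2" if "N \<le> m" for m
          using tail[OF x, of N "m - N"] that N by (simp add: dist_norm)
        then show "\<exists>M. \<forall>m\<ge>M. \<forall>n\<ge>M. dist (f m x) (f n x) < e"
          by (metis dist_triangle_half_l)
      qed
      then show ?thesis by (rule Cauchy_convergent)
    qed
    then obtain g where g: "\<And>x. x \<in> carrier E \<Longrightarrow> (\<lambda>n. f n x) \<longlonglongrightarrow> g x"
      unfolding convergent_def by metis
    have close: "cmod (f n x - g x) \<le> 2 * (1/2) ^ n * nrm E x" if x: "x \<in> carrier E" for n x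
    proof (rule tendsto_upperbound)
      show "(\<lambda>k. cmod (f n x - f (k + n) x)) \<longlonglongrightarrow> cmod (f n x - g x)"
        by (intro tendsto_intros LIMSEQ_ignore_initial_segment g x)
      show "\<forall>\<^sub>F k in sequentially. cmod (f n x - f (k + n) x) \<le> 2 * (1/2) ^ n * nrm E x"
        using tail[OF x, of n] by (simp add: norm_minus_commute add.commute)
    qed simp
    define h where "h = restrict g (carrier E)"
    have h: "h \<in> carrier E'"
      unfolding h_def
    proof (rule dual_restrictI)
      fix x y assume x: "x \<in> carrier E" and y: "y \<in> carrier E"
      have "(\<lambda>n. f n (x \<oplus> y)) \<longlonglongrightarrow> g x + g y"
        using tendsto_add[OF g[OF x] g[OF y]] x y f by (simp add: dual_add)
      then show "g (x \<oplus> y) = g x + g y"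
        using g[of "x \<oplus> y"] x y by (intro LIMSEQ_unique) auto
    next
      fix c x assume x: "x \<in> carrier E"
      have "(\<lambda>n. f n (c \<odot> x)) \<longlonglongrightarrow> c * g x"
        using tendsto_mult_left[OF g[OF x], of c] x f by (simp add: dual_smult)
      then show "g (c \<odot> x) = c * g x"
        using g[of "c \<odot> x"] x by (intro LIMSEQ_unique) auto
    next
      fix x assume x: "x \<in> carrier E"
      have "cmod (g x) \<le> cmod (f 0 x) + cmod (f 0 x - g x)"
        by (metis norm_triangle_sub norm_minus_commute)
      \<comment> \<open>The summand \<open>2\<close> is the distance bound
        \<open>2 * (1/2) ^ n\<close> between \<open>f n\<close> and its limit at
        \<open>n = 0\<close>.\<close>
      then show "cmod (g x) \<le> (nrm E' (f 0) + 2) * nrm E x"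
        using close[OF x, of 0] dual_bound[OF f[of 0] x] by (simp add: distrib_right)
    qed
    have "nrm E' (f n \<ominus>\<^bsub>E'\<^esub> h) \<le> 2 * (1/2) ^ n" for n
      by (rule dual_nrm_le) (use close[of _ n] f h in \<open>simp_all add: dual_minus_apply, simp add: h_def\<close>)
    moreover have "0 \<le> nrm E' (f n \<ominus>\<^bsub>E'\<^esub> h)" for n
      using f h by (intro dual_nrm_nonneg) simp
    ultimately have "(\<lambda>n. nrm E' (f n \<ominus>\<^bsub>E'\<^esub> h)) \<longlonglongrightarrow> 0"
      by (intro tendsto_sandwich[OF _ _ tendsto_const null[of 1]]) auto
    then show "\<exists>y\<in>carrier E'. (\<lambda>n. nrm E' (f n \<ominus>\<^bsub>E'\<^esub> y)) \<longlonglongrightarrow> 0"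
      using h by blast
  qed
qed

end

section \<open>Functionals separate points\<close>

text \<open>Hahn--Banach without extending functionals step by step: a minimal sublinear functional \<open>q\<close> is
  additive, because \<open>x \<mapsto> inf\<^sub>t q (x + t y) - t q y\<close> is again sublinear and below \<open>q\<close>.\<close>

context cnormed_space
begin

text \<open>With the value 0 outside the carrier a functional is determined by its values on
  \<open>E\<close>, so minimality among functions on the whole type is minimality on
  \<open>E\<close>. The bound by the norm also bounds each functional below by the negative norm,
  which keeps infima over families of them finite. One inequality suffices for homogeneity, since
  scaling back by \<open>1 / t\<close> gives the other.\<close>

definition sublinear :: "('x \<Rightarrow> real) \<Rightarrow> bool" where
  "sublinear q \<longleftrightarrow>
     (\<forall>x. x \<notin> carrier E \<longrightarrow> q x = 0) \<and>
     (\<forall>x\<in>carrier E. \<forall>y\<in>carrier E. q (x \<oplus> y) \<le> q x + q y) \<and>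
     (\<forall>t\<ge>0. \<forall>x\<in>carrier E. q (complex_of_real t \<odot> x) \<le> t * q x) \<and>
     (\<forall>x\<in>carrier E. q x \<le> nrm E x)"

lemma sublinear_add:
  "\<lbrakk>sublinear q; x \<in> carrier E; y \<in> carrier E\<rbrakk> \<Longrightarrow> q (x \<oplus> y) \<le> q x + q y"
  by (simp add: sublinear_def)

lemma sublinear_le_nrm: "\<lbrakk>sublinear q; x \<in> carrier E\<rbrakk> \<Longrightarrow> q x \<le> nrm E x"
  by (simp add: sublinear_def)

lemma sublinear_zero: "sublinear q \<Longrightarrow> q \<zero> = 0"
proof -
  assume q: "sublinear q"
  then have "q (complex_of_real 0 \<odot> \<zero>) \<le> 0 * q \<zero>"
    unfolding sublinear_def by blast
  then show ?thesis
    using sublinear_add[OF q, of \<zero> \<zero>] by simp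
qed

lemma sublinear_homogeneous:
  assumes q: "sublinear q" and t: "0 \<le> t" and x: "x \<in> carrier E"
  shows "q (complex_of_real t \<odot> x) = t * q x"
proof (cases "t = 0")
  case True
  then show ?thesis using sublinear_zero[OF q] x by simp
next
  case False
  have *: "\<And>t x. \<lbrakk>0 \<le> t; x \<in> carrier E\<rbrakk> \<Longrightarrow> q (complex_of_real t \<odot> x) \<le> t * q x"
    using q by (auto simp: sublinear_def)
  have "q x = q (complex_of_real (inverse t) \<odot> (complex_of_real t \<odot> x))"
    using False x by (simp add: smult_smult)
  also have "\<dots> \<le> inverse t * q (complex_of_real t \<odot> x)"
    using t x by (intro *) auto
  finally have "t * q x \<le> q (complex_of_real t \<odot> x)"
    using False t by (simp add: field_simps)
  then show ?thesis using *[OF t x] by simp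
qed

lemma sublinear_ge_uminus: "\<lbrakk>sublinear q; x \<in> carrier E\<rbrakk> \<Longrightarrow> - q (\<ominus> x) \<le> q x"
  using sublinear_add[of q x "\<ominus> x"] by (simp add: r_neg sublinear_zero)

lemma sublinear_ge_nrm: "\<lbrakk>sublinear q; x \<in> carrier E\<rbrakk> \<Longrightarrow> - nrm E x \<le> q x"
  using sublinear_ge_uminus[of q x] sublinear_le_nrm[of q "\<ominus> x"] by (simp add: nrm_uminus)

lemma sublinear_nrm: "sublinear (\<lambda>x. if x \<in> carrier E then nrm E x else 0)"
  unfolding sublinear_def using nrm_add by (auto simp: nrm_smult)

text \<open>The parameter \<open>t = 0\<close> places the shift below \<open>q\<close>; the
  parameter \<open>t = 1\<close> bounds it by \<open>q (x + y) - q y\<close>. If \<open>q\<close> is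
  minimal, the shift equals \<open>q\<close>, and the second bound becomes
  \<open>q x + q y \<le> q (x + y)\<close>, the half of additivity that sublinearity lacks.\<close>

definition sublinear_shift :: "'x \<Rightarrow> ('x \<Rightarrow> real) \<Rightarrow> 'x \<Rightarrow> real" where
  "sublinear_shift y q x =
     (if x \<in> carrier E then INF t\<in>{0..}. q (x \<oplus> complex_of_real t \<odot> y) - t * q y else 0)"

context
  fixes q y assumes q: "sublinear q" and y: "y \<in> carrier E"
begin

lemma sublinear_shift_le:
  assumes x: "x \<in> carrier E" and t: "0 \<le> t"
  shows "sublinear_shift y q x \<le> q (x \<oplus> complex_of_real t \<odot> y) - t * q y"
proof -
  \<comment> \<open>A lower bound is \<open>- q (- x)\<close>, by subadditivity for
    \<open>t y = (x + t y) + (- x)\<close>.\<close>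
  have "bdd_below ((\<lambda>t. q (x \<oplus> complex_of_real t \<odot> y) - t * q y) ` {0..})"
  proof (rule bdd_belowI2)
    fix t :: real assume t: "t \<in> {0..}"
    have "complex_of_real t \<odot> y = (x \<oplus> complex_of_real t \<odot> y) \<oplus> \<ominus> x"
      using x y by (simp add: a_ac r_neg) (metis a_ac(1) a_comm a_inv_closed l_zero r_neg smult_mem)
    then have "t * q y \<le> q (x \<oplus> complex_of_real t \<odot> y) + q (\<ominus> x)"
      using sublinear_add[OF q, of "x \<oplus> complex_of_real t \<odot> y" "\<ominus> x"] x y t
        sublinear_homogeneous[OF q, of t y] by simp
    then show "- q (\<ominus> x) \<le> q (x \<oplus> complex_of_real t \<odot> y) - t * q y"
      by simp
  qed
  then show ?thesis
    unfolding sublinear_shift_def using x t by (auto intro: cINF_lower)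
qed

lemma sublinear_shift_greatest:
  assumes "x \<in> carrier E" and "\<And>t. 0 \<le> t \<Longrightarrow> c \<le> q (x \<oplus> complex_of_real t \<odot> y) - t * q y"
  shows "c \<le> sublinear_shift y q x"
  unfolding sublinear_shift_def using assms by (auto intro!: cINF_greatest)

lemma sublinear_shift_le_self: "sublinear_shift y q x \<le> q x"
proof (cases "x \<in> carrier E")
  case True
  then show ?thesis using sublinear_shift_le[of x 0] y by simp
next
  case False
  then show ?thesis using q by (simp add: sublinear_shift_def sublinear_def)
qed

lemma sublinear_shift: "sublinear (sublinear_shift y q)"
proof -
  let ?p = "sublinear_shift y q"
  have add: "?p (x \<oplus> z) \<le> ?p x + ?p z" if x: "x \<in> carrier E" and z: "z \<in> carrier E" for x z
  proof -
    \<comment> \<open>Parameters \<open>s\<close> for \<open>x\<close> and \<open>t\<close> for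
      \<open>z\<close> add up to \<open>s + t\<close> for \<open>x + z\<close>. The two infima on
      the right are then formed one after the other.\<close>
    have *: "?p (x \<oplus> z) \<le> (q (x \<oplus> complex_of_real s \<odot> y) - s * q y)
        + (q (z \<oplus> complex_of_real t \<odot> y) - t * q y)" if s: "0 \<le> s" and t: "0 \<le> t" for s t
    proof -
      have "(x \<oplus> z) \<oplus> complex_of_real (s + t) \<odot> y
          = (x \<oplus> complex_of_real s \<odot> y) \<oplus> (z \<oplus> complex_of_real t \<odot> y)"
        using x y z by (simp add: smult_add_left a_ac)
      then have "q ((x \<oplus> z) \<oplus> complex_of_real (s + t) \<odot> y)
          \<le> q (x \<oplus> complex_of_real s \<odot> y) + q (z \<oplus> complex_of_real t \<odot> y)"
        using x y z by (simp only:) (intro sublinear_add[OF q]; simp)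
      moreover have "?p (x \<oplus> z) \<le> q ((x \<oplus> z) \<oplus> complex_of_real (s + t) \<odot> y) - (s + t) * q y"
        using x z s t by (intro sublinear_shift_le) auto
      ultimately show ?thesis
        by (simp add: distrib_right)
    qed
    have "?p (x \<oplus> z) - (q (x \<oplus> complex_of_real s \<odot> y) - s * q y) \<le> ?p z" if "0 \<le> s" for s
      by (rule sublinear_shift_greatest[OF z]) (use *[OF that] in \<open>simp add: algebra_simps\<close>)
    then have **: "?p (x \<oplus> z) \<le> ?p z + (q (x \<oplus> complex_of_real s \<odot> y) - s * q y)" if "0 \<le> s" for s
      using that by (simp only: diff_le_eq)
    have "?p (x \<oplus> z) - ?p z \<le> ?p x"
      by (rule sublinear_shift_greatest[OF x]) (use ** in \<open>simp only: diff_le_eq add.commute\<close>)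
    then show ?thesis by simp
  qed
  have hom: "?p (complex_of_real c \<odot> x) \<le> c * ?p x" if c: "0 \<le> c" and x: "x \<in> carrier E" for c x
  proof (cases "c = 0")
    case True
    then show ?thesis
      using sublinear_shift_le[of \<zero> 0] x y sublinear_zero[OF q] by simp
  next
    case False
    then have c': "0 < c" using c by simp
    have "?p (complex_of_real c \<odot> x) / c \<le> q (x \<oplus> complex_of_real t \<odot> y) - t * q y"
      if t: "0 \<le> t" for t
    proof -
      \<comment> \<open>The parameter \<open>t\<close> for \<open>x\<close> corresponds to
        \<open>c * t\<close> for \<open>c x\<close>.\<close>
      have "complex_of_real c \<odot> x \<oplus> complex_of_real (c * t) \<odot> y
          = complex_of_real c \<odot> (x \<oplus> complex_of_real t \<odot> y)"
        using x y by (simp add: smult_add_right smult_smult)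
      then have "?p (complex_of_real c \<odot> x)
          \<le> c * q (x \<oplus> complex_of_real t \<odot> y) - c * t * q y"
        using sublinear_shift_le[of "complex_of_real c \<odot> x" "c * t"] x y c t
          sublinear_homogeneous[OF q c, of "x \<oplus> complex_of_real t \<odot> y"] by simp
      then show ?thesis
        unfolding pos_divide_le_eq[OF c'] by (simp add: algebra_simps)
    qed
    then have "?p (complex_of_real c \<odot> x) / c \<le> ?p x"
      by (rule sublinear_shift_greatest[OF x])
    then show ?thesis
      unfolding pos_divide_le_eq[OF c'] by (simp only: mult.commute)
  qed
  show ?thesis
    unfolding sublinear_def
  proof (intro conjI allI ballI impI add hom)
    show "?p x = 0" if "x \<notin> carrier E" for x
      using that by (simp add: sublinear_shift_def)
    show "?p x \<le> nrm E x" if "x \<in> carrier E" for x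
      using sublinear_shift_le_self[of x] sublinear_le_nrm[OF q that] by simp
  qed
qed

end

text \<open>The chain condition is what saves subadditivity: for \<open>p\<close> and
  \<open>q\<close> in \<open>C\<close> the smaller one, \<open>s\<close>, gives
  \<open>s (x + y) \<le> s x + s y \<le> p x + q y\<close>, so that the two infima can be taken
  independently.\<close>

lemma sublinear_INF:
  assumes ne: "C \<noteq> {}" and sub: "\<And>q. q \<in> C \<Longrightarrow> sublinear q"
    and chain: "\<And>p q. \<lbrakk>p \<in> C; q \<in> C\<rbrakk> \<Longrightarrow> p \<le> q \<or> q \<le> p"
  shows "sublinear (\<lambda>x. INF q\<in>C. q x)" and "\<And>q. q \<in> C \<Longrightarrow> (\<lambda>x. INF q\<in>C. q x) \<le> q"
proof -
  let ?u = "\<lambda>x. INF q\<in>C. q x"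
  have out: "?u x = 0" if "x \<notin> carrier E" for x
  proof -
    have "?u x = (INF q\<in>C. 0)"
      using sub that by (intro INF_cong) (auto simp: sublinear_def)
    then show ?thesis using ne by simp
  qed
  have le: "?u x \<le> q x" if "q \<in> C" for q x
  proof (rule cINF_lower[OF _ that], rule bdd_belowI2)
    show "- \<bar>nrm E x\<bar> \<le> p x" if "p \<in> C" for p
    proof (cases "x \<in> carrier E")
      case True
      then show ?thesis using sublinear_ge_nrm[OF sub[OF that]] nrm_nonneg[of x] by simp
    next
      case False
      then have "p x = 0" using sub[OF that] by (simp add: sublinear_def)
      then show ?thesis by simp
    qed
  qed
  then show "?u \<le> q" if "q \<in> C" for q
    using that by (simp add: le_fun_def)
  show "sublinear ?u"
    unfolding sublinear_def
  proof (intro conjI allI ballI impI out)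
    fix x y assume x: "x \<in> carrier E" and y: "y \<in> carrier E"
    have *: "?u (x \<oplus> y) \<le> p x + q y" if p: "p \<in> C" and q: "q \<in> C" for p q
    proof -
      obtain s where s: "s \<in> C" "s \<le> p" "s \<le> q"
        using chain[OF p q] p q by (metis order_refl)
      have "?u (x \<oplus> y) \<le> s (x \<oplus> y)" by (rule le[OF s(1)])
      also have "\<dots> \<le> s x + s y" by (rule sublinear_add[OF sub[OF s(1)] x y])
      also have "\<dots> \<le> p x + q y" using s by (intro add_mono) (simp_all add: le_fun_def)
      finally show ?thesis .
    qed
    have "?u (x \<oplus> y) - p x \<le> ?u y" if "p \<in> C" for p
      using *[OF that] by (intro cINF_greatest ne) (simp add: algebra_simps)
    then have **: "?u (x \<oplus> y) \<le> ?u y + p x" if "p \<in> C" for p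
      using that by (simp only: diff_le_eq)
    have "?u (x \<oplus> y) - ?u y \<le> ?u x"
      by (rule cINF_greatest[OF ne]) (use ** in \<open>simp only: diff_le_eq add.commute\<close>)
    then show "?u (x \<oplus> y) \<le> ?u x + ?u y" by simp
  next
    fix t :: real and x assume t: "0 \<le> t" and x: "x \<in> carrier E"
    have *: "?u (complex_of_real t \<odot> x) \<le> t * q x" if "q \<in> C" for q
      using le[OF that, of "complex_of_real t \<odot> x"] sublinear_homogeneous[OF sub[OF that] t x] by simp
    show "?u (complex_of_real t \<odot> x) \<le> t * ?u x"
    proof (cases "t = 0")
      case True
      then show ?thesis using * ne by auto
    next
      case False
      then have t': "0 < t" using t by simp
      from False have "?u (complex_of_real t \<odot> x) / t \<le> q x" if "q \<in> C" for q
        using *[OF that] t by (simp add: field_simps)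
      then have "?u (complex_of_real t \<odot> x) / t \<le> ?u x"
        by (rule cINF_greatest[OF ne])
      then show ?thesis
        unfolding pos_divide_le_eq[OF t'] by (simp only: mult.commute)
    qed
  next
    fix x assume x: "x \<in> carrier E"
    obtain q where q: "q \<in> C" using ne by blast
    show "?u x \<le> nrm E x"
      using le[OF q, of x] sublinear_le_nrm[OF sub[OF q] x] by simp
  qed
qed

text \<open>Zorn's lemma for the reversed pointwise order, in which maximal elements are minimal
  functionals. The empty chain is bounded by \<open>p\<close> itself, because an infimum over the
  empty set carries no information.\<close>

lemma minimal_sublinear:
  assumes p: "sublinear p"
  obtains q where "sublinear q" "q \<le> p" "\<And>q'. \<lbrakk>sublinear q'; q' \<le> q\<rbrakk> \<Longrightarrow> q' = q"
proof -
  let ?A = "{q. sublinear q \<and> q \<le> p}"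
  have "\<exists>m\<in>?A. \<forall>a\<in>?A. m \<ge> a \<longrightarrow> a = m"
  proof (rule predicate_Zorn)
    show "partial_order_on ?A (relation_of (\<ge>) ?A)"
      by (rule partial_order_on_relation_ofI) auto
    fix C assume C: "C \<in> Chains (relation_of (\<ge>) ?A)"
    then have sub: "C \<subseteq> ?A" and chain: "\<And>a b. \<lbrakk>a \<in> C; b \<in> C\<rbrakk> \<Longrightarrow> a \<le> b \<or> b \<le> a"
      by (auto simp: Chains_def relation_of_def)
    show "\<exists>u\<in>?A. \<forall>a\<in>C. u \<le> a"
    proof (cases "C = {}")
      case True
      then show ?thesis using p by auto
    next
      case False
      then obtain q where q: "q \<in> C" by blast
      have "sublinear (\<lambda>x. INF q\<in>C. q x)" and le: "\<And>q. q \<in> C \<Longrightarrow> (\<lambda>x. INF q\<in>C. q x) \<le> q"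
        using sublinear_INF[OF False] sub chain by blast+
      moreover have "(\<lambda>x. INF q\<in>C. q x) \<le> p"
        using le[OF q] q sub by (auto intro: order_trans)
      ultimately show ?thesis by blast
    qed
  qed
  then obtain q where q: "sublinear q" "q \<le> p"
    and min: "\<And>a. \<lbrakk>sublinear a; a \<le> p; a \<le> q\<rbrakk> \<Longrightarrow> a = q"
    by blast
  show thesis
    using q min by (intro that[of q]) (auto intro: order_trans)
qed

text \<open>Shifting the norm in direction \<open>m\<close> gives a sublinear \<open>p\<close> with
  \<open>p (- m) \<le> - nrm E m\<close>, the value at \<open>t = 1\<close>. A minimal
  \<open>q\<close> below \<open>p\<close> is real-linear and inherits this bound, so
  \<open>q m \<ge> nrm E m\<close>. It is the real part of a bounded complex functional, which by
  hypothesis vanishes at \<open>m\<close>.\<close>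

lemma dual_separates:
  assumes m: "m \<in> carrier E" and zero: "\<And>f. f \<in> carrier E' \<Longrightarrow> f m = 0"
  shows "m = \<zero>"
proof -
  define p where "p = sublinear_shift m (\<lambda>x. if x \<in> carrier E then nrm E x else 0)"
  have p: "sublinear p"
    unfolding p_def by (rule sublinear_shift[OF sublinear_nrm m])
  have pm: "p (\<ominus> m) \<le> - nrm E m"
    using sublinear_shift_le[OF sublinear_nrm m, of "\<ominus> m" 1] m by (simp add: p_def l_neg)
  obtain q where q: "sublinear q" and qp: "q \<le> p"
    and min: "\<And>q'. \<lbrakk>sublinear q'; q' \<le> q\<rbrakk> \<Longrightarrow> q' = q"
    using minimal_sublinear[OF p] by blast
  have add: "q (x \<oplus> y) = q x + q y" if x: "x \<in> carrier E" and y: "y \<in> carrier E" for x y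
  proof -
    have "sublinear_shift y q = q"
      using sublinear_shift[OF q y] sublinear_shift_le_self[OF q y] by (intro min) (auto simp: le_fun_def)
    then have "q x \<le> q (x \<oplus> y) - q y"
      using sublinear_shift_le[OF q y x, of 1] y by simp
    then show ?thesis
      using sublinear_add[OF q x y] by simp
  qed
  have neg: "q (\<ominus> x) = - q x" if "x \<in> carrier E" for x
    using add[OF that, of "\<ominus> x"] that by (simp add: r_neg sublinear_zero[OF q])
  have scale: "q (complex_of_real t \<odot> x) = t * q x" if x: "x \<in> carrier E" for t x
  proof (cases "0 \<le> t")
    case True
    then show ?thesis by (rule sublinear_homogeneous[OF q _ x])
  next
    case False
    have "complex_of_real t \<odot> x = \<ominus> (complex_of_real (- t) \<odot> x)"
      using x by (simp add: uminus_eq_smult smult_smult)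
    then show ?thesis
      using neg[of "complex_of_real (- t) \<odot> x"] sublinear_homogeneous[OF q _ x, of "- t"] False x
      by simp
  qed
  have bound: "\<bar>q x\<bar> \<le> nrm E x" if "x \<in> carrier E" for x
    using sublinear_le_nrm[OF q that] sublinear_ge_nrm[OF q that] by simp
  \<comment> \<open>Complex linearity forces the imaginary part at \<open>x\<close> to be minus the
    real part at \<open>\<i> x\<close>.\<close>
  define f where "f = (\<lambda>x\<in>carrier E. Complex (q x) (- q (\<i> \<odot> x)))"
  have "f \<in> carrier E'"
    unfolding f_def
  proof (rule dual_restrictI)
    fix x y assume "x \<in> carrier E" "y \<in> carrier E"
    then show "Complex (q (x \<oplus> y)) (- q (\<i> \<odot> (x \<oplus> y)))
        = Complex (q x) (- q (\<i> \<odot> x)) + Complex (q y) (- q (\<i> \<odot> y))"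
      by (simp add: add smult_add_right complex_eq_iff)
  next
    fix c x assume x: "x \<in> carrier E"
    \<comment> \<open>Only real scalars can be pulled out of \<open>q\<close>, so \<open>c x\<close>
      and \<open>\<i> c x\<close> are split into real multiples of \<open>x\<close> and
      \<open>\<i> x\<close>.\<close>
    have cx: "c \<odot> x = complex_of_real (Re c) \<odot> x \<oplus> complex_of_real (Im c) \<odot> (\<i> \<odot> x)"
      using x by (simp add: smult_smult complex_eq_iff flip: smult_add_left)
        (metis complex_eq mult.commute)
    have icx: "\<i> \<odot> (c \<odot> x) = complex_of_real (Re c) \<odot> (\<i> \<odot> x) \<oplus> complex_of_real (- Im c) \<odot> x"
      using x by (simp add: smult_smult flip: smult_add_left)
        (rule arg_cong[of _ _ "\<lambda>d. d \<odot> x"], simp add: complex_eq_iff)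
    show "Complex (q (c \<odot> x)) (- q (\<i> \<odot> (c \<odot> x))) = c * Complex (q x) (- q (\<i> \<odot> x))"
      unfolding icx unfolding cx using x by (simp add: add scale complex_eq_iff del: of_real_minus)
  next
    fix x assume x: "x \<in> carrier E"
    have "cmod (Complex (q x) (- q (\<i> \<odot> x))) \<le> \<bar>q x\<bar> + \<bar>q (\<i> \<odot> x)\<bar>"
      using cmod_le[of "Complex (q x) (- q (\<i> \<odot> x))"] by simp
    then show "cmod (Complex (q x) (- q (\<i> \<odot> x))) \<le> 2 * nrm E x"
      using bound[OF x] bound[of "\<i> \<odot> x"] x by (simp add: nrm_smult)
  qed
  then have "q m = 0"
    using zero[of f] m by (simp add: f_def complex_eq_iff)
  moreover have "q (\<ominus> m) \<le> - nrm E m"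
    using qp pm by (auto simp: le_fun_def intro: order_trans)
  ultimately have "nrm E m = 0"
    using neg[OF m] nrm_nonneg[OF m] by simp
  then show ?thesis
    using m by (simp add: nrm_eq_0)
qed

end

section \<open>Dual modules and pullbacks\<close>

text \<open>Right modules are left modules over the opposite algebra, so that each construction on modules
  has to be carried out on one side only.\<close>

definition opposite_algebra :: "'a cnormed \<Rightarrow> 'a cnormed" where
  "opposite_algebra A = A\<lparr>monoid.mult := \<lambda>a b. b \<otimes>\<^bsub>A\<^esub> a\<rparr>"

lemma opposite_algebra_simps [simp]:
  "carrier (opposite_algebra A) = carrier A"
  "add (opposite_algebra A) = add A"
  "module.smult (opposite_algebra A) = module.smult A"
  "nrm (opposite_algebra A) = nrm A"
  "a \<otimes>\<^bsub>opposite_algebra A\<^esub> b = b \<otimes>\<^bsub>A\<^esub> a"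
  "opposite_algebra (opposite_algebra A) = A"
  by (simp_all add: opposite_algebra_def)

lemma banach_right_module_iff_left:
  "banach_right_module B E r \<longleftrightarrow> banach_left_module (opposite_algebra B) E (\<lambda>b x. r x b)"
proof
  assume "banach_right_module B E r"
  then interpret banach_right_module B E r .
  show "banach_left_module (opposite_algebra B) E (\<lambda>b x. r x b)"
  proof
    obtain C where "\<forall>b\<in>carrier B. \<forall>x\<in>carrier E. nrm E (r x b) \<le> C * nrm E x * nrm B b"
      using r_bounded by blast
    then show "\<exists>C. \<forall>a\<in>carrier (opposite_algebra B). \<forall>x\<in>carrier E.
        nrm E (r x a) \<le> C * nrm (opposite_algebra B) a * nrm E x"
      by (intro exI[of _ C]) (simp add: mult_ac)
  qed (use r_closed r_add_right r_add_left r_smult_right r_smult_left r_assoc in simp_all)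
next
  assume "banach_left_module (opposite_algebra B) E (\<lambda>b x. r x b)"
  then interpret banach_left_module "opposite_algebra B" E "\<lambda>b x. r x b" .
  show "banach_right_module B E r"
  proof
    obtain C where "\<forall>b\<in>carrier B. \<forall>x\<in>carrier E. nrm E (r x b) \<le> C * nrm B b * nrm E x"
      using l_bounded by auto
    then show "\<exists>C. \<forall>b\<in>carrier B. \<forall>x\<in>carrier E. nrm E (r x b) \<le> C * nrm E x * nrm B b"
      by (intro exI[of _ C]) (simp add: mult_ac)
  qed (use l_closed l_add_right l_add_left l_smult_right l_smult_left l_assoc in simp_all)
qed

lemma banach_left_module_iff_right:
  "banach_left_module A E l \<longleftrightarrow> banach_right_module (opposite_algebra A) E (\<lambda>x a. l a x)"
  by (simp add: banach_right_module_iff_left)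

lemma dual_left_apply: "x \<in> carrier E \<Longrightarrow> dual_left E r a f x = f (r x a)"
  by (simp add: dual_left_def)

lemma dual_right_apply: "x \<in> carrier E \<Longrightarrow> dual_right E l f a x = f (l a x)"
  by (simp add: dual_right_def)

lemma dual_right_eq_left: "(\<lambda>a f. dual_right E l f a) = dual_left E (\<lambda>x a. l a x)"
  by (simp add: dual_right_def dual_left_def fun_eq_iff)

lemma (in banach_right_module) dual_left_mem:
  assumes f: "f \<in> carrier E'" and b: "b \<in> carrier B"
  shows "dual_left E r b f \<in> carrier E'"
proof -
  obtain C where C: "\<forall>b\<in>carrier B. \<forall>x\<in>carrier E. nrm E (r x b) \<le> C * nrm E x * nrm B b"
    using r_bounded by blast
  have bound: "cmod (f (r x b)) \<le> (nrm E' f * C * nrm B b) * nrm E x" if x: "x \<in> carrier E" for x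
  proof -
    have "cmod (f (r x b)) \<le> nrm E' f * nrm E (r x b)"
      by (rule dual_bound[OF f r_closed[OF b x]])
    also have "\<dots> \<le> nrm E' f * (C * nrm E x * nrm B b)"
      using C b x by (intro mult_left_mono dual_nrm_nonneg f) blast
    finally show ?thesis by (simp add: mult_ac)
  qed
  show ?thesis
    unfolding dual_left_def
    by (rule dual_restrictI[OF _ _ bound])
      (simp_all add: b f r_closed r_add_left r_smult_left dual_add dual_smult)
qed

lemma (in banach_right_module) dual_banach_left_module:
  "banach_left_module B E' (dual_left E r)"
proof (intro banach_left_module.intro dual_cbanach_space banach_left_module_axioms.intro)
  fix b f assume b: "b \<in> carrier B" and f: "f \<in> carrier E'"
  show "dual_left E r b f \<in> carrier E'"
    by (rule dual_left_mem[OF f b])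
  show "dual_left E r (c \<odot>\<^bsub>B\<^esub> b) f = c \<odot>\<^bsub>E'\<^esub> dual_left E r b f" for c
    using b f unfolding dual_left_def dual_space_simps
    by (intro restrict_ext) (simp add: r_smult_right dual_smult r_closed)
  show "dual_left E r b (c \<odot>\<^bsub>E'\<^esub> f) = c \<odot>\<^bsub>E'\<^esub> dual_left E r b f" for c
    using b f unfolding dual_left_def dual_space_simps
    by (intro restrict_ext) (simp add: r_closed)
  show "dual_left E r b (f \<oplus>\<^bsub>E'\<^esub> g) = dual_left E r b f \<oplus>\<^bsub>E'\<^esub> dual_left E r b g"
    if "g \<in> carrier E'" for g
    using b f unfolding dual_left_def dual_space_simps
    by (intro restrict_ext) (simp add: r_closed)
  fix a assume a: "a \<in> carrier B"
  show "dual_left E r (a \<oplus>\<^bsub>B\<^esub> b) f = dual_left E r a f \<oplus>\<^bsub>E'\<^esub> dual_left E r b f"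
    using a b f unfolding dual_left_def dual_space_simps
    by (intro restrict_ext) (simp add: r_add_right dual_add r_closed)
  show "dual_left E r (a \<otimes>\<^bsub>B\<^esub> b) f = dual_left E r a (dual_left E r b f)"
    using a b f unfolding dual_left_def
    by (intro restrict_ext) (simp add: r_assoc r_closed)
next
  obtain C where C: "\<forall>b\<in>carrier B. \<forall>x\<in>carrier E. nrm E (r x b) \<le> C * nrm E x * nrm B b"
    using r_bounded by blast
  have "nrm E' (dual_left E r b f) \<le> (C * nrm B b) * nrm E' f"
    if b: "b \<in> carrier B" and f: "f \<in> carrier E'" for b f
  proof (cases "0 \<le> C * nrm B b")
    case True
    show ?thesis
    proof (rule dual_nrm_le)
      fix x assume x: "x \<in> carrier E"
      have "cmod (f (r x b)) \<le> nrm E' f * nrm E (r x b)"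
        by (rule dual_bound[OF f r_closed[OF b x]])
      also have "\<dots> \<le> nrm E' f * (C * nrm E x * nrm B b)"
        using C b x by (intro mult_left_mono dual_nrm_nonneg f) blast
      finally show "cmod (dual_left E r b f x) \<le> C * nrm B b * nrm E' f * nrm E x"
        using x by (simp add: dual_left_apply mult_ac)
    qed (simp add: True dual_nrm_nonneg f)
  next
    \<comment> \<open>the norm of \<open>B\<close> is not known to be nonnegative, but then \<open>E\<close> is trivial\<close>
    case False
    have "x = \<zero>\<^bsub>E\<^esub>" if x: "x \<in> carrier E" for x
    proof (rule ccontr)
      assume "x \<noteq> \<zero>\<^bsub>E\<^esub>"
      then have "nrm E x > 0"
        using nrm_eq_0[OF x] nrm_nonneg[OF x] by simp
      then have "C * nrm B b * nrm E x < 0"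
        using False by (simp add: mult_neg_pos)
      moreover have "0 \<le> C * nrm B b * nrm E x"
        using C[rule_format, OF b x] nrm_nonneg[OF r_closed[OF b x]] by (simp add: mult_ac)
      ultimately show False by simp
    qed
    then have "nrm E' g \<le> 0" if "g \<in> carrier E'" for g
      using dual_zero[OF that] by (intro dual_nrm_le) auto
    then have "nrm E' f = 0" "nrm E' (dual_left E r b f) = 0"
      using dual_nrm_nonneg f dual_left_mem[OF f b] by (meson order_antisym)+
    then show ?thesis by simp
  qed
  then show "\<exists>C. \<forall>b\<in>carrier B. \<forall>f\<in>carrier E'. nrm E' (dual_left E r b f) \<le> C * nrm B b * nrm E' f"
    by blast
qed

lemma (in banach_left_module) dual_banach_right_module:
  "banach_right_module A E' (dual_right E l)"
  unfolding banach_right_module_iff_left dual_right_eq_left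
  by (rule banach_right_module.dual_banach_left_module)
    (use banach_left_module_axioms in \<open>simp flip: banach_left_module_iff_right\<close>)

lemma (in banach_bimodule) dual_banach_bimodule:
  "banach_bimodule B A E' (dual_left E r) (dual_right E l)"
proof (intro banach_bimodule.intro dual_banach_left_module dual_banach_right_module
    banach_bimodule_axioms.intro)
  fix b a f assume "b \<in> carrier B" "a \<in> carrier A" "f \<in> carrier E'"
  then show "dual_right E l (dual_left E r b f) a = dual_left E r b (dual_right E l f a)"
    unfolding dual_left_def dual_right_def
    by (intro restrict_ext) (simp add: r_closed l_closed lr_assoc)
qed

text \<open>Transposition permutes the six identities: the first is exchanged with the sixth, the
  second with the fourth, and the third with the fifth. Thus the last two identities for
  \<open>M\<close> are the source of the first and the third for its dual.\<close>

lemma compatible_actions_dual: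
  assumes "compatible_actions K A lA rA B lB rB E l r lk rk"
    and "banach_bimodule A B E l r" and "banach_bimodule K K E lk rk"
  shows "compatible_actions K B lB rB A lA rA (dual_space E)
    (dual_left E r) (dual_right E l) (dual_left E rk) (dual_right E lk)"
proof -
  interpret AB: banach_bimodule A B E l r by fact
  interpret K: banach_bimodule K K E lk rk by fact
  note compat = assms(1)[unfolded compatible_actions_def, rule_format]
  show ?thesis
    unfolding compatible_actions_def dual_left_def dual_right_def
    by (intro ballI conjI restrict_ext)
      (simp_all add: AB.l_closed AB.r_closed K.l_closed K.r_closed compat)
qed

lemma commutative_actions_dual:
  assumes "commutative_actions K E lk rk"
  shows "commutative_actions K (dual_space E) (dual_left E rk) (dual_right E lk)"
  using assms unfolding commutative_actions_def dual_left_def dual_right_def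
  by (intro ballI restrict_ext) simp

lemma commutative_banach_module_dual:
  assumes "commutative_banach_module K A lA rA E l r lk rk"
  shows "commutative_banach_module K A lA rA (dual_space E)
    (dual_left E r) (dual_right E l) (dual_left E rk) (dual_right E lk)"
  using assms unfolding commutative_banach_module_def
  by (simp add: banach_bimodule.dual_banach_bimodule compatible_actions_dual
      commutative_actions_dual)

text \<open>The absolute value makes up for the fact that the norm of \<open>B\<close> need not be nonnegative.\<close>

definition bounded_hom :: "'a cnormed \<Rightarrow> 'b cnormed \<Rightarrow> ('a \<Rightarrow> 'b) \<Rightarrow> bool" where
  "bounded_hom A B \<phi> \<longleftrightarrow>
     \<phi> \<in> carrier A \<rightarrow> carrier B \<and>
     (\<forall>a\<in>carrier A. \<forall>b\<in>carrier A. \<phi> (a \<oplus>\<^bsub>A\<^esub> b) = \<phi> a \<oplus>\<^bsub>B\<^esub> \<phi> b \<and> \<phi> (a \<otimes>\<^bsub>A\<^esub> b) = \<phi> a \<otimes>\<^bsub>B\<^esub> \<phi> b) \<and>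
     (\<forall>c. \<forall>a\<in>carrier A. \<phi> (c \<odot>\<^bsub>A\<^esub> a) = c \<odot>\<^bsub>B\<^esub> \<phi> a) \<and>
     (\<exists>C. \<forall>a\<in>carrier A. \<bar>nrm B (\<phi> a)\<bar> \<le> C * nrm A a)"

lemma bounded_hom_opposite:
  "bounded_hom A B \<phi> \<Longrightarrow> bounded_hom (opposite_algebra A) (opposite_algebra B) \<phi>"
  unfolding bounded_hom_def by simp

lemma banach_left_module_pullback:
  assumes "banach_left_module B E l" and \<phi>: "bounded_hom A B \<phi>"
  shows "banach_left_module A E (\<lambda>a. l (\<phi> a))"
proof -
  interpret banach_left_module B E l by fact
  have mem: "\<phi> a \<in> carrier B" if "a \<in> carrier A" for a
    using \<phi> that by (auto simp: bounded_hom_def)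
  show ?thesis
  proof
    obtain C C' where C: "\<forall>a\<in>carrier B. \<forall>x\<in>carrier E. nrm E (l a x) \<le> C * nrm B a * nrm E x"
      and C': "\<forall>a\<in>carrier A. \<bar>nrm B (\<phi> a)\<bar> \<le> C' * nrm A a"
      using l_bounded \<phi> unfolding bounded_hom_def by blast
    have "nrm E (l (\<phi> a) x) \<le> (\<bar>C\<bar> * C') * nrm A a * nrm E x"
      if a: "a \<in> carrier A" and x: "x \<in> carrier E" for a x
    proof -
      have "nrm E (l (\<phi> a) x) \<le> C * nrm B (\<phi> a) * nrm E x"
        using C mem[OF a] x by blast
      also have "\<dots> \<le> (\<bar>C\<bar> * \<bar>nrm B (\<phi> a)\<bar>) * nrm E x"
        by (intro mult_right_mono nrm_nonneg x) (simp flip: abs_mult)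
      also have "\<dots> \<le> (\<bar>C\<bar> * (C' * nrm A a)) * nrm E x"
        using C' a by (intro mult_right_mono mult_left_mono nrm_nonneg x) auto
      finally show ?thesis by (simp add: mult.assoc)
    qed
    then show "\<exists>C. \<forall>a\<in>carrier A. \<forall>x\<in>carrier E. nrm E (l (\<phi> a) x) \<le> C * nrm A a * nrm E x"
      by blast
  qed (use \<phi> mem in \<open>simp_all add: bounded_hom_def l_closed l_add_left l_add_right
      l_smult_left l_smult_right l_assoc\<close>)
qed

lemma banach_right_module_pullback:
  assumes "banach_right_module B E r" and "bounded_hom A B \<phi>"
  shows "banach_right_module A E (\<lambda>x a. r x (\<phi> a))"
  using assms banach_left_module_pullback[OF _ bounded_hom_opposite]
  unfolding banach_right_module_iff_left by blast

lemma banach_bimodule_pullback: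
  assumes "banach_bimodule A B E l r" and \<phi>: "bounded_hom A' A \<phi>" and \<psi>: "bounded_hom B' B \<psi>"
  shows "banach_bimodule A' B' E (\<lambda>a. l (\<phi> a)) (\<lambda>x b. r x (\<psi> b))"
proof -
  interpret banach_bimodule A B E l r by fact
  show ?thesis
    by (intro banach_bimodule.intro banach_bimodule_axioms.intro
        banach_left_module_pullback[OF _ \<phi>] banach_right_module_pullback[OF _ \<psi>]
        banach_left_module_axioms banach_right_module_axioms lr_assoc)
      (use \<phi> \<psi> in \<open>auto simp: bounded_hom_def\<close>)
qed

text \<open>Two scalar algebras occur because \<open>T\<close> is a module over the diagonal
  matrices and \<open>A\<close>, \<open>B\<close> are modules over \<open>K\<close>; the map
  \<open>\<kappa>\<close> translates between them.\<close>

definition equivariant ::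
  "'k cnormed \<Rightarrow> ('k \<Rightarrow> 'l) \<Rightarrow> 'a cnormed \<Rightarrow> ('k \<Rightarrow> 'a \<Rightarrow> 'a) \<Rightarrow> ('a \<Rightarrow> 'k \<Rightarrow> 'a) \<Rightarrow>
   ('l \<Rightarrow> 'b \<Rightarrow> 'b) \<Rightarrow> ('b \<Rightarrow> 'l \<Rightarrow> 'b) \<Rightarrow> ('a \<Rightarrow> 'b) \<Rightarrow> bool" where
  "equivariant K \<kappa> A lA rA lB rB \<phi> \<longleftrightarrow>
     (\<forall>\<alpha>\<in>carrier K. \<forall>a\<in>carrier A. \<phi> (lA \<alpha> a) = lB (\<kappa> \<alpha>) (\<phi> a) \<and> \<phi> (rA a \<alpha>) = rB (\<phi> a) (\<kappa> \<alpha>))"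

text \<open>The two sides are pulled back along different homomorphisms because the left and right
  actions of \<open>T\<close> on the dual of \<open>M\<close> factor through different
  corners.\<close>

lemma compatible_actions_pullback:
  assumes "compatible_actions L A lA rA B lB rB E l r lk rk"
    and "\<phi> \<in> carrier A' \<rightarrow> carrier A" "\<psi> \<in> carrier B' \<rightarrow> carrier B" "\<kappa> \<in> carrier K \<rightarrow> carrier L"
    and "equivariant K \<kappa> A' lA' rA' lA rA \<phi>" "equivariant K \<kappa> B' lB' rB' lB rB \<psi>"
  shows "compatible_actions K A' lA' rA' B' lB' rB' E (\<lambda>a. l (\<phi> a)) (\<lambda>x b. r x (\<psi> b))
    (\<lambda>\<alpha>. lk (\<kappa> \<alpha>)) (\<lambda>x \<alpha>. rk x (\<kappa> \<alpha>))"
  unfolding compatible_actions_def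
proof (intro ballI)
  fix \<alpha> a b x assume mem: "\<alpha> \<in> carrier K" "a \<in> carrier A'" "b \<in> carrier B'" "x \<in> carrier E"
  then have "\<kappa> \<alpha> \<in> carrier L" "\<phi> a \<in> carrier A" "\<psi> b \<in> carrier B"
    using assms(2-4) by auto
  note compat = assms(1)[unfolded compatible_actions_def, rule_format, OF this mem(4)]
  have eq: "\<phi> (lA' \<alpha> a) = lA (\<kappa> \<alpha>) (\<phi> a)" "\<phi> (rA' a \<alpha>) = rA (\<phi> a) (\<kappa> \<alpha>)"
    "\<psi> (lB' \<alpha> b) = lB (\<kappa> \<alpha>) (\<psi> b)" "\<psi> (rB' b \<alpha>) = rB (\<psi> b) (\<kappa> \<alpha>)"
    using assms(5,6) mem by (simp_all add: equivariant_def)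
  show "lk (\<kappa> \<alpha>) (l (\<phi> a) x) = l (\<phi> (lA' \<alpha> a)) x \<and>
      r (lk (\<kappa> \<alpha>) x) (\<psi> b) = lk (\<kappa> \<alpha>) (r x (\<psi> b)) \<and>
      r x (\<psi> (rB' b \<alpha>)) = rk (r x (\<psi> b)) (\<kappa> \<alpha>) \<and>
      rk (l (\<phi> a) x) (\<kappa> \<alpha>) = l (\<phi> a) (rk x (\<kappa> \<alpha>)) \<and>
      l (\<phi> a) (lk (\<kappa> \<alpha>) x) = l (\<phi> (rA' a \<alpha>)) x \<and>
      r x (\<psi> (lB' \<alpha> b)) = r (rk x (\<kappa> \<alpha>)) (\<psi> b)"
    by (simp only: eq compat simp_thms)
qed

lemma commutative_banach_module_pullback:
  assumes "commutative_banach_module L B lB rB E l r lk rk"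
    and "bounded_hom A B \<phi>" and "bounded_hom K L \<kappa>" and "equivariant K \<kappa> A lA rA lB rB \<phi>"
  shows "commutative_banach_module K A lA rA E (\<lambda>a. l (\<phi> a)) (\<lambda>x a. r x (\<phi> a))
    (\<lambda>\<alpha>. lk (\<kappa> \<alpha>)) (\<lambda>x \<alpha>. rk x (\<kappa> \<alpha>))"
proof -
  have "\<phi> \<in> carrier A \<rightarrow> carrier B" "\<kappa> \<in> carrier K \<rightarrow> carrier L"
    using assms(2,3) by (auto simp: bounded_hom_def)
  moreover have "banach_bimodule B B E l r" "banach_bimodule L L E lk rk"
      "compatible_actions L B lB rB B lB rB E l r lk rk" "commutative_actions L E lk rk"
    using assms(1) by (auto simp: commutative_banach_module_def)
  ultimately show ?thesis
    using assms(2-4) banach_bimodule_pullback[of B B E l r A \<phi> A \<phi>]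
      banach_bimodule_pullback[of L L E lk rk K \<kappa> K \<kappa>]
      compatible_actions_pullback[of L B lB rB B lB rB E l r lk rk \<phi> A \<phi> A \<kappa> K lA rA lA rA]
    by (auto simp: commutative_banach_module_def commutative_actions_def)
qed

section \<open>Quotient spaces\<close>

text \<open>The quotient of \<open>E\<close> by the fibres of \<open>p\<close>, realised on the image of \<open>p\<close>. For injective \<open>p\<close> it is an
  isometric copy of \<open>E\<close>; choosing for \<open>p\<close> a system of representatives keeps a quotient inside the type
  of \<open>E\<close>.\<close>

definition image_space :: "('x \<Rightarrow> 'y) \<Rightarrow> 'x cnormed \<Rightarrow> 'y cnormed" where
  "image_space p E =
     \<lparr>carrier = p ` carrier E, monoid.mult = undefined, one = undefined, zero = p \<zero>\<^bsub>E\<^esub>,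
      add = (\<lambda>u v. p (inv_into (carrier E) p u \<oplus>\<^bsub>E\<^esub> inv_into (carrier E) p v)),
      module.smult = (\<lambda>c u. p (c \<odot>\<^bsub>E\<^esub> inv_into (carrier E) p u)),
      nrm = (\<lambda>u. INF x\<in>{x \<in> carrier E. p x = u}. nrm E x)\<rparr>"

definition image_left :: "('x \<Rightarrow> 'y) \<Rightarrow> 'x cnormed \<Rightarrow> ('a \<Rightarrow> 'x \<Rightarrow> 'x) \<Rightarrow> 'a \<Rightarrow> 'y \<Rightarrow> 'y" where
  "image_left p E l a u = p (l a (inv_into (carrier E) p u))"

definition image_right :: "('x \<Rightarrow> 'y) \<Rightarrow> 'x cnormed \<Rightarrow> ('x \<Rightarrow> 'a \<Rightarrow> 'x) \<Rightarrow> 'y \<Rightarrow> 'a \<Rightarrow> 'y" where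
  "image_right p E r u a = p (r (inv_into (carrier E) p u) a)"

text \<open>The condition for \<open>h\<close> to descend to the image of \<open>p\<close>.\<close>

definition fibrewise :: "('x \<Rightarrow> 'y) \<Rightarrow> 'x cnormed \<Rightarrow> ('x \<Rightarrow> 'z) \<Rightarrow> bool" where
  "fibrewise p E h \<longleftrightarrow> (\<forall>x\<in>carrier E. \<forall>y\<in>carrier E. p x = p y \<longrightarrow> h x = h y)"

lemma fibrewise_inv_into:
  assumes "fibrewise p E h" and "x \<in> carrier E"
  shows "h (inv_into (carrier E) p (p x)) = h x"
proof -
  have "p x \<in> p ` carrier E" using assms(2) by blast
  then show ?thesis
    using assms inv_into_into[of "p x" p "carrier E"] f_inv_into_f[of "p x" p "carrier E"]
    unfolding fibrewise_def by blast
qed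

text \<open>The type of the image has no structure of its own, so linearity of \<open>p\<close> is
  expressed through its fibres: by the first two assumptions they are the cosets of a subspace. The
  third says that this subspace is closed, since a coset with vectors of arbitrarily small norm must
  be the subspace itself; this makes the quotient seminorm a norm.\<close>

locale quotient_map = cbanach_space E for E :: "'x cnormed" (structure) + fixes p :: "'x \<Rightarrow> 'y"
  assumes p_add: "\<And>y. y \<in> carrier E \<Longrightarrow> fibrewise p E (\<lambda>x. p (x \<oplus> y))"
    and p_smult: "\<And>c. fibrewise p E (\<lambda>x. p (c \<odot> x))"
    and p_closed: "\<And>x. \<lbrakk>x \<in> carrier E; \<And>e. 0 < e \<Longrightarrow> \<exists>y\<in>carrier E. p y = p x \<and> nrm E y < e\<rbrakk>
          \<Longrightarrow> p x = p \<zero>"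
begin

abbreviation "F \<equiv> image_space p E"

lemma image_carrier [simp]: "carrier F = p ` carrier E"
  by (simp add: image_space_def)

lemma image_zero [simp]: "\<zero>\<^bsub>F\<^esub> = p \<zero>"
  by (simp add: image_space_def)

lemma p_add_cong:
  assumes "x \<in> carrier E" "x' \<in> carrier E" "y \<in> carrier E" "y' \<in> carrier E" "p x = p x'" "p y = p y'"
  shows "p (x \<oplus> y) = p (x' \<oplus> y')"
  using assms p_add[unfolded fibrewise_def] by (metis a_comm)

lemma image_add [simp]:
  assumes "x \<in> carrier E" "y \<in> carrier E"
  shows "p x \<oplus>\<^bsub>F\<^esub> p y = p (x \<oplus> y)"
  using assms by (simp add: image_space_def) (intro p_add_cong; simp add: inv_into_into f_inv_into_f)

lemma image_smult [simp]: "x \<in> carrier E \<Longrightarrow> c \<odot>\<^bsub>F\<^esub> p x = p (c \<odot> x)"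
  by (simp add: image_space_def fibrewise_inv_into[OF p_smult])

lemma image_nrm_def: "nrm F u = (INF x\<in>{x \<in> carrier E. p x = u}. nrm E x)"
  by (simp add: image_space_def)

lemma image_nrm_le:
  assumes "x \<in> carrier E" shows "nrm F (p x) \<le> nrm E x"
proof -
  have "bdd_below (nrm E ` {y \<in> carrier E. p y = p x})"
    by (rule bdd_belowI2[of _ 0]) (simp add: nrm_nonneg)
  then show ?thesis
    unfolding image_nrm_def using assms by (intro cINF_lower) auto
qed

lemma image_nrm_lift:
  assumes u: "u \<in> carrier F" and e: "nrm F u < e"
  obtains x where "x \<in> carrier E" "p x = u" "nrm E x < e"
proof -
  have "{x \<in> carrier E. p x = u} \<noteq> {}" using u by auto
  moreover have "bdd_below (nrm E ` {x \<in> carrier E. p x = u})"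
    by (rule bdd_belowI2[of _ 0]) (simp add: nrm_nonneg)
  ultimately show thesis
    using e that unfolding image_nrm_def by (auto simp: cINF_less_iff)
qed

lemma image_nrm_nonneg: "u \<in> carrier F \<Longrightarrow> 0 \<le> nrm F u"
  unfolding image_nrm_def by (intro cINF_greatest) (auto simp: nrm_nonneg)

text \<open>Bounds pass to the infimum over a fibre. The constant \<open>k\<close> may have any sign
  because module bounds come without one: a positive \<open>k\<close> is divided out, and otherwise
  multiplication by \<open>k\<close> reverses \<open>nrm F u \<le> nrm E x\<close>, so that a single
  point of the fibre suffices.\<close>

lemma image_nrm_bound:
  assumes u: "u \<in> carrier F" and N: "0 \<le> N"
    and le: "\<And>x. \<lbrakk>x \<in> carrier E; p x = u\<rbrakk> \<Longrightarrow> N \<le> k * nrm E x"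
  shows "N \<le> k * nrm F u"
proof (cases "0 < k")
  case True
  have "N / k \<le> nrm F u"
    unfolding image_nrm_def
  proof (rule cINF_greatest)
    show "{x \<in> carrier E. p x = u} \<noteq> {}" using u by auto
    show "N / k \<le> nrm E x" if "x \<in> {x \<in> carrier E. p x = u}" for x
      using le[of x] that unfolding pos_divide_le_eq[OF True] by (simp add: mult.commute)
  qed
  then show ?thesis
    unfolding pos_divide_le_eq[OF True] by (simp add: mult.commute)
next
  case False
  obtain x where x: "x \<in> carrier E" "p x = u" using u by auto
  have le_x: "k * nrm E x \<le> k * nrm F u"
    using False image_nrm_le[OF x(1)] x(2) by (intro mult_left_mono_neg) auto
  show ?thesis
    using le[OF x] le_x by simp
qed

lemma image_cnormed_space: "cnormed_space F"
proof (rule cnormed_spaceI)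
  show "module (ring_of_type_algebra :: complex ring) F"
  proof (rule complex_moduleI)
    show "abelian_group F"
    proof (rule abelian_groupI)
      fix u assume "u \<in> carrier F"
      then obtain x where x: "x \<in> carrier E" "u = p x" by auto
      then show "\<exists>v\<in>carrier F. v \<oplus>\<^bsub>F\<^esub> u = \<zero>\<^bsub>F\<^esub>"
        by (intro bexI[of _ "p (\<ominus> x)"]) (simp_all add: l_neg)
    qed (auto simp: a_ac)
  qed (auto simp: smult_add_left smult_add_right smult_smult)
next
  fix u assume u: "u \<in> carrier F"
  then obtain x where x: "x \<in> carrier E" "u = p x" by auto
  show "0 \<le> nrm F u" by (rule image_nrm_nonneg[OF u])
  show "nrm F u = 0 \<longleftrightarrow> u = \<zero>\<^bsub>F\<^esub>"
  proof
    assume "nrm F u = 0"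
    then have "\<exists>y\<in>carrier E. p y = p x \<and> nrm E y < e" if "0 < e" for e
      using image_nrm_lift[OF u, of e] that x by (metis (no_types))
    then show "u = \<zero>\<^bsub>F\<^esub>"
      using p_closed[OF x(1)] x(2) by simp
  next
    assume "u = \<zero>\<^bsub>F\<^esub>"
    then show "nrm F u = 0"
      using image_nrm_le[of \<zero>] image_nrm_nonneg[OF u] by simp
  qed
  show "nrm F (c \<odot>\<^bsub>F\<^esub> u) \<le> cmod c * nrm F u" for c
  proof (rule image_nrm_bound[OF u])
    show "0 \<le> nrm F (c \<odot>\<^bsub>F\<^esub> u)"
      using x by (intro image_nrm_nonneg) simp
    show "nrm F (c \<odot>\<^bsub>F\<^esub> u) \<le> cmod c * nrm E x" if "x \<in> carrier E" "p x = u" for x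
      using image_nrm_le[of "c \<odot> x"] that by (auto simp: nrm_smult)
  qed
  fix v assume v: "v \<in> carrier F"
  show "nrm F (u \<oplus>\<^bsub>F\<^esub> v) \<le> nrm F u + nrm F v"
  proof (rule field_le_epsilon)
    fix e :: real assume e: "0 < e"
    obtain x where x: "x \<in> carrier E" "p x = u" "nrm E x < nrm F u + e / 2"
      using image_nrm_lift[OF u, of "nrm F u + e / 2"] e by auto
    obtain y where y: "y \<in> carrier E" "p y = v" "nrm E y < nrm F v + e / 2"
      using image_nrm_lift[OF v, of "nrm F v + e / 2"] e by auto
    have "nrm F (u \<oplus>\<^bsub>F\<^esub> v) \<le> nrm E (x \<oplus> y)"
      using image_nrm_le[of "x \<oplus> y"] x y by auto
    also have "\<dots> \<le> nrm E x + nrm E y"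
      using nrm_add x y by blast
    finally show "nrm F (u \<oplus>\<^bsub>F\<^esub> v) \<le> nrm F u + nrm F v + e"
      using x(3) y(3) by simp
  qed
qed

sublocale image: cnormed_space F
  by (rule image_cnormed_space)

lemma image_minus: "\<lbrakk>x \<in> carrier E; y \<in> carrier E\<rbrakk> \<Longrightarrow> p x \<ominus>\<^bsub>F\<^esub> p y = p (x \<ominus> y)"
  by (simp add: image.minus_eq_smult minus_eq_smult)

text \<open>The increments of a geometric sequence are lifted to vectors of small norm in
  \<open>E\<close>. Their partial sums converge there, and the image of the limit is the limit of
  the sequence.\<close>

lemma image_cbanach_space: "cbanach_space F"
proof (rule image.cbanach_spaceI)
  fix u :: "nat \<Rightarrow> 'y"
  assume u: "u n \<in> carrier F" and step: "nrm F (u (Suc n) \<ominus>\<^bsub>F\<^esub> u n) \<le> (1/2) ^ n" for n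
  \<comment> \<open>Lifting needs a strict bound; starting one index later provides it, since
    \<open>(1/2) ^ Suc n < (1/2) ^ n\<close>.\<close>
  have "\<exists>y\<in>carrier E. p y = u (Suc (Suc n)) \<ominus>\<^bsub>F\<^esub> u (Suc n) \<and> nrm E y < (1/2) ^ n" for n
  proof (rule image_nrm_lift)
    show "u (Suc (Suc n)) \<ominus>\<^bsub>F\<^esub> u (Suc n) \<in> carrier F"
      using u by (intro image.minus_closed)
    have "nrm F (u (Suc (Suc n)) \<ominus>\<^bsub>F\<^esub> u (Suc n)) \<le> (1/2) ^ Suc n" by (rule step)
    also have "\<dots> < (1/2) ^ n" by simp
    finally show "nrm F (u (Suc (Suc n)) \<ominus>\<^bsub>F\<^esub> u (Suc n)) < (1/2) ^ n" .
  qed blast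
  then obtain y where y: "\<And>n. y n \<in> carrier E"
    "\<And>n. p (y n) = u (Suc (Suc n)) \<ominus>\<^bsub>F\<^esub> u (Suc n)" "\<And>n. nrm E (y n) < (1/2) ^ n"
    by metis
  obtain x0 where x0: "x0 \<in> carrier E" "p x0 = u 1"
    using u[of 1] by auto
  define x where "x = rec_nat x0 (\<lambda>n z. z \<oplus> y n)"
  have x_Suc: "x (Suc n) = x n \<oplus> y n" for n by (simp add: x_def)
  have x_mem: "x n \<in> carrier E" for n
    by (induction n) (simp_all add: x_Suc y, simp add: x_def x0)
  have p_x: "p (x n) = u (Suc n)" for n
  proof (induction n)
    case 0
    then show ?case by (simp add: x_def x0)
  next
    case (Suc n)
    have "p (x (Suc n)) = u (Suc n) \<oplus>\<^bsub>F\<^esub> (u (Suc (Suc n)) \<ominus>\<^bsub>F\<^esub> u (Suc n))"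
      using image_add[OF x_mem[of n] y(1)[of n]] Suc y(2)[of n] by (simp add: x_Suc)
    also have "\<dots> = u (Suc (Suc n))"
      using image.minus_add_cancel[OF u u] image.a_comm[OF u image.minus_closed[OF u u]] by simp
    finally show ?case .
  qed
  have "nrm E (x (Suc n) \<ominus> x n) \<le> (1/2) ^ n" for n
  proof -
    have "x (Suc n) \<ominus> x n = y n"
      using x_mem[of n] y(1)[of n]
      by (simp add: x_Suc minus_eq) (metis a_assoc a_comm a_inv_closed r_neg r_zero)
    then show ?thesis using y(3)[of n] by simp
  qed
  then obtain z where z: "z \<in> carrier E" "(\<lambda>n. nrm E (x n \<ominus> z)) \<longlonglongrightarrow> 0"
    using geometric_limit[of x] x_mem by blast
  have "nrm F (u (Suc n) \<ominus>\<^bsub>F\<^esub> p z) \<le> nrm E (x n \<ominus> z)" for n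
    using image_nrm_le[of "x n \<ominus> z"] x_mem z(1) by (simp add: image_minus flip: p_x)
  moreover have "0 \<le> nrm F (u (Suc n) \<ominus>\<^bsub>F\<^esub> p z)" for n
    using u z(1) by (intro image_nrm_nonneg image.minus_closed) auto
  ultimately have "(\<lambda>n. nrm F (u (Suc n) \<ominus>\<^bsub>F\<^esub> p z)) \<longlonglongrightarrow> 0"
    by (intro tendsto_sandwich[OF _ _ tendsto_const z(2)]) auto
  then have "(\<lambda>n. nrm F (u n \<ominus>\<^bsub>F\<^esub> p z)) \<longlonglongrightarrow> 0"
    by (rule LIMSEQ_imp_Suc)
  then show "\<exists>v\<in>carrier F. (\<lambda>n. nrm F (u n \<ominus>\<^bsub>F\<^esub> v)) \<longlonglongrightarrow> 0"
    using z(1) by auto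
qed

lemma image_left_apply:
  "\<lbrakk>fibrewise p E (\<lambda>x. p (l a x)); x \<in> carrier E\<rbrakk> \<Longrightarrow> image_left p E l a (p x) = p (l a x)"
  using fibrewise_inv_into[of p E "\<lambda>x. p (l a x)" x] by (simp add: image_left_def)

lemma image_right_apply:
  "\<lbrakk>fibrewise p E (\<lambda>x. p (r x a)); x \<in> carrier E\<rbrakk> \<Longrightarrow> image_right p E r (p x) a = p (r x a)"
  using fibrewise_inv_into[of p E "\<lambda>x. p (r x a)" x] by (simp add: image_right_def)

lemma image_banach_left_module:
  assumes "banach_left_module A E l" and resp: "\<And>a. a \<in> carrier A \<Longrightarrow> fibrewise p E (\<lambda>x. p (l a x))"
  shows "banach_left_module A F (image_left p E l)"
proof -
  interpret A: banach_left_module A E l by fact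
  note apply_l = image_left_apply[of l, OF resp]
  show ?thesis
  proof (intro banach_left_module.intro image_cbanach_space banach_left_module_axioms.intro)
    fix a u assume a: "a \<in> carrier A" and "u \<in> carrier F"
    then obtain x where x: "x \<in> carrier E" "u = p x" by auto
    show "image_left p E l a u \<in> carrier F"
      using a x by (simp add: apply_l A.l_closed)
    \<comment> \<open>The locale does not make the carrier of \<open>A\<close> closed under its
      operations, so \<open>apply_l\<close> cannot be used at \<open>c a\<close>. The computation
      takes place at the representative of \<open>u\<close>; the same is done below for sums and
      products in \<open>A\<close>.\<close>
    show "image_left p E l (c \<odot>\<^bsub>A\<^esub> a) u = c \<odot>\<^bsub>F\<^esub> image_left p E l a u" for c
      using a x A.l_smult_left[OF a x(1)] inv_into_into[of u p "carrier E"]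
      by (simp add: image_left_def A.l_smult_left A.l_closed)
    show "image_left p E l a (c \<odot>\<^bsub>F\<^esub> u) = c \<odot>\<^bsub>F\<^esub> image_left p E l a u" for c
      using a x by (simp add: apply_l A.l_closed A.l_smult_right)
    show "image_left p E l a (u \<oplus>\<^bsub>F\<^esub> v) = image_left p E l a u \<oplus>\<^bsub>F\<^esub> image_left p E l a v"
      if "v \<in> carrier F" for v
      using a x that by (auto simp: apply_l A.l_closed A.l_add_right)
    fix b assume b: "b \<in> carrier A"
    show "image_left p E l (a \<oplus>\<^bsub>A\<^esub> b) u = image_left p E l a u \<oplus>\<^bsub>F\<^esub> image_left p E l b u"
      using a b x inv_into_into[of u p "carrier E"]
      by (simp add: image_left_def A.l_add_left A.l_closed)
    show "image_left p E l (a \<otimes>\<^bsub>A\<^esub> b) u = image_left p E l a (image_left p E l b u)"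
    proof -
      have "inv_into (carrier E) p u \<in> carrier E"
        using x by (simp add: inv_into_into)
      then show ?thesis
        using a b by (simp add: image_left_def[of p E l "a \<otimes>\<^bsub>A\<^esub> b"] image_left_def[of p E l b]
            A.l_assoc A.l_closed apply_l)
    qed
  next
    obtain C where C: "\<forall>a\<in>carrier A. \<forall>x\<in>carrier E. nrm E (l a x) \<le> C * nrm A a * nrm E x"
      using A.l_bounded by blast
    have "nrm F (image_left p E l a u) \<le> C * nrm A a * nrm F u"
      if a: "a \<in> carrier A" and u: "u \<in> carrier F" for a u
    proof (rule image_nrm_bound[OF u])
      show "0 \<le> nrm F (image_left p E l a u)"
        using a u by (intro image_nrm_nonneg) (auto simp: apply_l A.l_closed)
      fix x assume x: "x \<in> carrier E" "p x = u"
      have "nrm F (image_left p E l a u) \<le> nrm E (l a x)"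
        using image_nrm_le[OF A.l_closed[OF a x(1)]] a x by (simp add: apply_l flip: x(2))
      then show "nrm F (image_left p E l a u) \<le> C * nrm A a * nrm E x"
        using C a x(1) by (meson order_trans)
    qed
    then show "\<exists>C. \<forall>a\<in>carrier A. \<forall>u\<in>carrier F. nrm F (image_left p E l a u) \<le> C * nrm A a * nrm F u"
      by blast
  qed
qed

lemma image_banach_right_module:
  assumes "banach_right_module B E r" and "\<And>b. b \<in> carrier B \<Longrightarrow> fibrewise p E (\<lambda>x. p (r x b))"
  shows "banach_right_module B F (image_right p E r)"
proof -
  have "(\<lambda>b u. image_right p E r u b) = image_left p E (\<lambda>b x. r x b)"
    by (simp add: image_right_def image_left_def fun_eq_iff)
  then show ?thesis
    using assms image_banach_left_module[of "opposite_algebra B" "\<lambda>b x. r x b"]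
    unfolding banach_right_module_iff_left by simp
qed

lemma image_banach_bimodule:
  assumes "banach_bimodule A B E l r"
    and l: "\<And>a. a \<in> carrier A \<Longrightarrow> fibrewise p E (\<lambda>x. p (l a x))"
    and r: "\<And>b. b \<in> carrier B \<Longrightarrow> fibrewise p E (\<lambda>x. p (r x b))"
  shows "banach_bimodule A B F (image_left p E l) (image_right p E r)"
proof -
  interpret AB: banach_bimodule A B E l r by fact
  show ?thesis
  proof (intro banach_bimodule.intro banach_bimodule_axioms.intro
      image_banach_left_module image_banach_right_module l r
      AB.banach_left_module_axioms AB.banach_right_module_axioms)
    fix a b u assume "a \<in> carrier A" "b \<in> carrier B" "u \<in> carrier F"
    then show "image_right p E r (image_left p E l a u) b = image_left p E l a (image_right p E r u b)"
      by (auto simp: image_left_apply l image_right_apply r AB.l_closed AB.r_closed AB.lr_assoc)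
  qed
qed

lemma image_commutative_banach_module:
  assumes comm: "commutative_banach_module K A lA rA E l r lk rk"
    and K_closed: "\<And>\<alpha> a. \<lbrakk>\<alpha> \<in> carrier K; a \<in> carrier A\<rbrakk> \<Longrightarrow> lA \<alpha> a \<in> carrier A \<and> rA a \<alpha> \<in> carrier A"
    and l: "\<And>a. a \<in> carrier A \<Longrightarrow> fibrewise p E (\<lambda>x. p (l a x))"
    and r: "\<And>a. a \<in> carrier A \<Longrightarrow> fibrewise p E (\<lambda>x. p (r x a))"
    and lk: "\<And>\<alpha>. \<alpha> \<in> carrier K \<Longrightarrow> fibrewise p E (\<lambda>x. p (lk \<alpha> x))"
    and rk: "\<And>\<alpha>. \<alpha> \<in> carrier K \<Longrightarrow> fibrewise p E (\<lambda>x. p (rk x \<alpha>))"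
  shows "commutative_banach_module K A lA rA F (image_left p E l) (image_right p E r)
    (image_left p E lk) (image_right p E rk)"
proof -
  interpret A: banach_bimodule A A E l r
    using comm by (simp add: commutative_banach_module_def)
  interpret K: banach_bimodule K K E lk rk
    using comm by (simp add: commutative_banach_module_def)
  note compat = comm[unfolded commutative_banach_module_def compatible_actions_def,
      THEN conjunct2, THEN conjunct2, THEN conjunct1, rule_format]
  note simps = image_left_apply image_right_apply l r lk rk
    A.l_closed A.r_closed K.l_closed K.r_closed K_closed
  have "compatible_actions K A lA rA A lA rA F (image_left p E l) (image_right p E r)
    (image_left p E lk) (image_right p E rk)"
    unfolding compatible_actions_def
  proof (intro ballI)
    fix \<alpha> a b u assume *: "\<alpha> \<in> carrier K" "a \<in> carrier A" "b \<in> carrier A" "u \<in> carrier F"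
    then obtain x where x: "x \<in> carrier E" "u = p x" by auto
    show "image_left p E lk \<alpha> (image_left p E l a u) = image_left p E l (lA \<alpha> a) u \<and>
       image_right p E r (image_left p E lk \<alpha> u) b = image_left p E lk \<alpha> (image_right p E r u b) \<and>
       image_right p E r u (rA b \<alpha>) = image_right p E rk (image_right p E r u b) \<alpha> \<and>
       image_right p E rk (image_left p E l a u) \<alpha> = image_left p E l a (image_right p E rk u \<alpha>) \<and>
       image_left p E l a (image_left p E lk \<alpha> u) = image_left p E l (rA a \<alpha>) u \<and>
       image_right p E r u (lA \<alpha> b) = image_right p E r (image_right p E rk u \<alpha>) b"
      using * x compat[OF *(1-3) x(1)] by (simp add: simps)
  qed
  moreover have "commutative_actions K F (image_left p E lk) (image_right p E rk)"
    using comm unfolding commutative_banach_module_def commutative_actions_def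
    by (auto simp: simps)
  ultimately show ?thesis
    unfolding commutative_banach_module_def
    by (simp add: image_banach_bimodule A.banach_bimodule_axioms K.banach_bimodule_axioms l r lk rk)
qed

end

section \<open>Module derivations\<close>

text \<open>Compatibility with differences follows from additivity, and any bound \<open>C\<close>
  can be enlarged to the positive \<open>\<bar>C\<bar> + 1\<close>.\<close>

lemma module_derivationI:
  assumes "cnormed_space A" "cnormed_space Y"
    and mem: "\<And>a. a \<in> carrier A \<Longrightarrow> D a \<in> carrier Y"
    and add: "\<And>a b. \<lbrakk>a \<in> carrier A; b \<in> carrier A\<rbrakk> \<Longrightarrow> D (a \<oplus>\<^bsub>A\<^esub> b) = D a \<oplus>\<^bsub>Y\<^esub> D b"
    and lk: "\<And>\<alpha> a. \<lbrakk>\<alpha> \<in> carrier K; a \<in> carrier A\<rbrakk> \<Longrightarrow> D (lA \<alpha> a) = lk \<alpha> (D a)"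
    and rk: "\<And>\<alpha> a. \<lbrakk>\<alpha> \<in> carrier K; a \<in> carrier A\<rbrakk> \<Longrightarrow> D (rA a \<alpha>) = rk (D a) \<alpha>"
    and bound: "\<And>a. a \<in> carrier A \<Longrightarrow> nrm Y (D a) \<le> C * nrm A a"
    and mult: "\<And>a b. \<lbrakk>a \<in> carrier A; b \<in> carrier A\<rbrakk>
          \<Longrightarrow> D (a \<otimes>\<^bsub>A\<^esub> b) = r (D a) b \<oplus>\<^bsub>Y\<^esub> l a (D b)"
  shows "module_derivation K A lA rA Y l r lk rk D"
proof -
  interpret A: cnormed_space A by fact
  interpret Y: cnormed_space Y by fact
  have minus: "D (a \<ominus>\<^bsub>A\<^esub> b) = D a \<ominus>\<^bsub>Y\<^esub> D b" if a: "a \<in> carrier A" and b: "b \<in> carrier A" for a b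
  proof -
    have "D a = D (a \<ominus>\<^bsub>A\<^esub> b) \<oplus>\<^bsub>Y\<^esub> D b"
      using add[of "a \<ominus>\<^bsub>A\<^esub> b" b] a b by (simp add: A.minus_add_cancel)
    then show ?thesis
      using mem[of "a \<ominus>\<^bsub>A\<^esub> b"] mem[OF b] a b
      by (simp add: Y.minus_eq Y.a_assoc Y.r_neg)
  qed
  have "nrm Y (D a) \<le> (\<bar>C\<bar> + 1) * nrm A a" if a: "a \<in> carrier A" for a
  proof -
    have "C * nrm A a \<le> (\<bar>C\<bar> + 1) * nrm A a"
      by (intro mult_right_mono A.nrm_nonneg a) simp
    then show ?thesis using bound[OF a] by simp
  qed
  then have "\<exists>C>0. \<forall>a\<in>carrier A. nrm Y (D a) \<le> C * nrm A a"
    by (intro exI[of _ "\<bar>C\<bar> + 1"]) simp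
  then show ?thesis
    unfolding module_derivation_def using mem add minus lk rk mult by simp
qed

lemma module_derivation_mem:
  "\<lbrakk>module_derivation K A lA rA Y l r lk rk D; a \<in> carrier A\<rbrakk> \<Longrightarrow> D a \<in> carrier Y"
  unfolding module_derivation_def by blast

lemma module_derivation_add:
  "\<lbrakk>module_derivation K A lA rA Y l r lk rk D; a \<in> carrier A; b \<in> carrier A\<rbrakk>
    \<Longrightarrow> D (a \<oplus>\<^bsub>A\<^esub> b) = D a \<oplus>\<^bsub>Y\<^esub> D b"
  unfolding module_derivation_def by blast

lemma module_derivation_lk:
  "\<lbrakk>module_derivation K A lA rA Y l r lk rk D; \<alpha> \<in> carrier K; a \<in> carrier A\<rbrakk>
    \<Longrightarrow> D (lA \<alpha> a) = lk \<alpha> (D a)"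
  unfolding module_derivation_def by blast

lemma module_derivation_rk:
  "\<lbrakk>module_derivation K A lA rA Y l r lk rk D; \<alpha> \<in> carrier K; a \<in> carrier A\<rbrakk>
    \<Longrightarrow> D (rA a \<alpha>) = rk (D a) \<alpha>"
  unfolding module_derivation_def by blast

lemma module_derivation_mult:
  "\<lbrakk>module_derivation K A lA rA Y l r lk rk D; a \<in> carrier A; b \<in> carrier A\<rbrakk>
    \<Longrightarrow> D (a \<otimes>\<^bsub>A\<^esub> b) = r (D a) b \<oplus>\<^bsub>Y\<^esub> l a (D b)"
  unfolding module_derivation_def by blast

lemma module_derivation_bound:
  "module_derivation K A lA rA Y l r lk rk D
    \<Longrightarrow> \<exists>C>0. \<forall>a\<in>carrier A. nrm Y (D a) \<le> C * nrm A a"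
  unfolding module_derivation_def by blast

lemma module_derivation_pullback:
  assumes D: "module_derivation L B lB rB Y l r lk rk D"
    and \<phi>: "bounded_hom A B \<phi>" and \<kappa>: "\<kappa> \<in> carrier K \<rightarrow> carrier L"
    and eq: "equivariant K \<kappa> A lA rA lB rB \<phi>"
    and "cnormed_space A" "cnormed_space Y"
  shows "module_derivation K A lA rA Y (\<lambda>a. l (\<phi> a)) (\<lambda>y a. r y (\<phi> a))
    (\<lambda>\<alpha>. lk (\<kappa> \<alpha>)) (\<lambda>y \<alpha>. rk y (\<kappa> \<alpha>)) (\<lambda>a. D (\<phi> a))"
proof -
  have mem: "\<And>a. a \<in> carrier A \<Longrightarrow> \<phi> a \<in> carrier B" "\<And>\<alpha>. \<alpha> \<in> carrier K \<Longrightarrow> \<kappa> \<alpha> \<in> carrier L"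
    using \<phi> \<kappa> by (auto simp: bounded_hom_def)
  obtain C where C: "C > 0" "\<forall>b\<in>carrier B. nrm Y (D b) \<le> C * nrm B b"
    using module_derivation_bound[OF D] by blast
  obtain C' where C': "\<forall>a\<in>carrier A. \<bar>nrm B (\<phi> a)\<bar> \<le> C' * nrm A a"
    using \<phi> by (auto simp: bounded_hom_def)
  have bound: "nrm Y (D (\<phi> a)) \<le> (C * C') * nrm A a" if a: "a \<in> carrier A" for a
  proof -
    have "nrm Y (D (\<phi> a)) \<le> C * nrm B (\<phi> a)" using C mem a by blast
    also have "\<dots> \<le> C * (C' * nrm A a)"
      using C' a C(1) abs_ge_self[of "nrm B (\<phi> a)"] by (intro mult_left_mono) force+
    finally show ?thesis by simp
  qed
  show ?thesis
    by (rule module_derivationI[OF assms(5,6) _ _ _ _ bound]) (use \<phi> eq mem in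
      \<open>simp_all add: bounded_hom_def equivariant_def module_derivation_mem[OF D]
        module_derivation_add[OF D] module_derivation_mult[OF D]
        module_derivation_lk[OF D] module_derivation_rk[OF D]\<close>)
qed

section \<open>Differences of derivations and inner derivations\<close>

lemma (in banach_left_module) l_minus:
  "\<lbrakk>a \<in> carrier A; x \<in> carrier E; y \<in> carrier E\<rbrakk> \<Longrightarrow> l a (x \<ominus>\<^bsub>E\<^esub> y) = l a x \<ominus>\<^bsub>E\<^esub> l a y"
  by (simp add: minus_eq_smult l_add_right l_smult_right l_closed)

lemma (in banach_right_module) r_minus:
  "\<lbrakk>b \<in> carrier B; x \<in> carrier E; y \<in> carrier E\<rbrakk> \<Longrightarrow> r (x \<ominus>\<^bsub>E\<^esub> y) b = r x b \<ominus>\<^bsub>E\<^esub> r y b"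
  by (simp add: minus_eq_smult r_add_left r_smult_left r_closed)

lemma module_derivation_diff:
  assumes "commutative_banach_module K A lA rA Y l r lk rk" and "cnormed_space A"
    and D: "module_derivation K A lA rA Y l r lk rk D"
    and D': "module_derivation K A lA rA Y l r lk rk D'"
  shows "module_derivation K A lA rA Y l r lk rk (\<lambda>a. D a \<ominus>\<^bsub>Y\<^esub> D' a)"
proof -
  interpret A: banach_bimodule A A Y l r
    using assms(1) by (simp add: commutative_banach_module_def)
  interpret K: banach_bimodule K K Y lk rk
    using assms(1) by (simp add: commutative_banach_module_def)
  note mem = module_derivation_mem[OF D] module_derivation_mem[OF D']
  obtain C where C: "\<forall>a\<in>carrier A. nrm Y (D a) \<le> C * nrm A a"
    using module_derivation_bound[OF D] by blast
  obtain C' where C': "\<forall>a\<in>carrier A. nrm Y (D' a) \<le> C' * nrm A a"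
    using module_derivation_bound[OF D'] by blast
  have bound: "nrm Y (D a \<ominus>\<^bsub>Y\<^esub> D' a) \<le> (C + C') * nrm A a" if a: "a \<in> carrier A" for a
  proof -
    have "nrm Y (D a \<ominus>\<^bsub>Y\<^esub> D' a) \<le> nrm Y (D a) + nrm Y (D' a)"
      using A.nrm_add[of "D a" "\<ominus>\<^bsub>Y\<^esub> D' a"] mem a by (simp add: A.minus_eq A.nrm_uminus)
    also have "\<dots> \<le> (C + C') * nrm A a"
      using C C' a by (simp add: distrib_right add_mono)
    finally show ?thesis .
  qed
  show ?thesis
  proof (rule module_derivationI[OF _ _ _ _ _ _ bound])
    show "cnormed_space A" by fact
    show "cnormed_space Y" by (rule A.cnormed_space_axioms)
  qed (simp_all add: mem module_derivation_add[OF D] module_derivation_add[OF D']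
      module_derivation_mult[OF D] module_derivation_mult[OF D']
      module_derivation_lk[OF D] module_derivation_lk[OF D']
      module_derivation_rk[OF D] module_derivation_rk[OF D']
      A.minus_minus_minus A.l_minus A.r_minus K.l_minus K.r_minus A.l_closed A.r_closed)
qed

lemma inner_module_derivation:
  assumes comm: "commutative_banach_module K A lA rA Y l r lk rk" and "cnormed_space A"
    and K_closed: "\<And>\<alpha> a. \<lbrakk>\<alpha> \<in> carrier K; a \<in> carrier A\<rbrakk> \<Longrightarrow> lA \<alpha> a \<in> carrier A \<and> rA a \<alpha> \<in> carrier A"
    and y: "y \<in> carrier Y"
  shows "module_derivation K A lA rA Y l r lk rk (\<lambda>a. l a y \<ominus>\<^bsub>Y\<^esub> r y a)"
proof -
  interpret A: banach_bimodule A A Y l r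
    using comm by (simp add: commutative_banach_module_def)
  interpret K: banach_bimodule K K Y lk rk
    using comm by (simp add: commutative_banach_module_def)
  have commute: "rk x \<alpha> = lk \<alpha> x" if "\<alpha> \<in> carrier K" "x \<in> carrier Y" for \<alpha> x
    using comm that by (simp add: commutative_banach_module_def commutative_actions_def)
  have compat: "lk \<alpha> (l a x) = l (lA \<alpha> a) x \<and> r (lk \<alpha> x) b = lk \<alpha> (r x b) \<and>
      r x (rA b \<alpha>) = rk (r x b) \<alpha> \<and> rk (l a x) \<alpha> = l a (rk x \<alpha>) \<and>
      l a (lk \<alpha> x) = l (rA a \<alpha>) x \<and> r x (lA \<alpha> b) = r (rk x \<alpha>) b"
    if "\<alpha> \<in> carrier K" "a \<in> carrier A" "b \<in> carrier A" "x \<in> carrier Y" for \<alpha> a b x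
    using comm that unfolding commutative_banach_module_def compatible_actions_def by blast
  obtain C where C: "\<forall>a\<in>carrier A. \<forall>x\<in>carrier Y. nrm Y (l a x) \<le> C * nrm A a * nrm Y x"
    using A.l_bounded by blast
  obtain C' where C': "\<forall>a\<in>carrier A. \<forall>x\<in>carrier Y. nrm Y (r x a) \<le> C' * nrm Y x * nrm A a"
    using A.r_bounded by blast
  have bound: "nrm Y (l a y \<ominus>\<^bsub>Y\<^esub> r y a) \<le> (C * nrm Y y + C' * nrm Y y) * nrm A a"
    if a: "a \<in> carrier A" for a
  proof -
    have "nrm Y (l a y \<ominus>\<^bsub>Y\<^esub> r y a) \<le> nrm Y (l a y) + nrm Y (r y a)"
      using A.nrm_add[of "l a y" "\<ominus>\<^bsub>Y\<^esub> r y a"] A.l_closed[OF a y] A.r_closed[OF a y]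
      by (simp add: A.minus_eq A.nrm_uminus)
    also have "\<dots> \<le> C * nrm A a * nrm Y y + C' * nrm Y y * nrm A a"
      using C C' a y by (intro add_mono) auto
    finally show ?thesis by (simp add: algebra_simps)
  qed
  show ?thesis
  proof (rule module_derivationI[OF _ _ _ _ _ _ bound])
    show "cnormed_space A" by fact
    show "cnormed_space Y" by (rule A.cnormed_space_axioms)
    fix a assume a: "a \<in> carrier A"
    show "l a y \<ominus>\<^bsub>Y\<^esub> r y a \<in> carrier Y"
      using a y by (simp add: A.l_closed A.r_closed)
    {
      fix \<alpha> assume \<alpha>: "\<alpha> \<in> carrier K"
      \<comment> \<open>Commutativity turns an inner derivation into a module map: \<open>r y (lA
        \<alpha> a) = r (rk y \<alpha>) a = r (lk \<alpha> y) a = lk \<alpha> (r y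
        a)\<close>.\<close>
      have "l (lA \<alpha> a) y = lk \<alpha> (l a y)" "r y (lA \<alpha> a) = lk \<alpha> (r y a)"
        using compat[OF \<alpha> a a y] commute[OF \<alpha> y] by metis+
      then show "l (lA \<alpha> a) y \<ominus>\<^bsub>Y\<^esub> r y (lA \<alpha> a) = lk \<alpha> (l a y \<ominus>\<^bsub>Y\<^esub> r y a)"
        using \<alpha> a y by (simp add: K.l_minus A.l_closed A.r_closed)
      have "l (rA a \<alpha>) y = rk (l a y) \<alpha>" "r y (rA a \<alpha>) = rk (r y a) \<alpha>"
        using compat[OF \<alpha> a a y] commute[OF \<alpha> y] by metis+
      then show "l (rA a \<alpha>) y \<ominus>\<^bsub>Y\<^esub> r y (rA a \<alpha>) = rk (l a y \<ominus>\<^bsub>Y\<^esub> r y a) \<alpha>"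
        using \<alpha> a y by (simp add: K.r_minus A.l_closed A.r_closed)
    }
    fix b assume b: "b \<in> carrier A"
    show "l (a \<oplus>\<^bsub>A\<^esub> b) y \<ominus>\<^bsub>Y\<^esub> r y (a \<oplus>\<^bsub>A\<^esub> b) = (l a y \<ominus>\<^bsub>Y\<^esub> r y a) \<oplus>\<^bsub>Y\<^esub> (l b y \<ominus>\<^bsub>Y\<^esub> r y b)"
      using a b y by (simp add: A.l_add_left A.r_add_right A.minus_minus_minus A.l_closed A.r_closed)
    \<comment> \<open>The mixed term \<open>l a (r y b)\<close> occurs with both signs and
      cancels.\<close>
    have "r (l a y \<ominus>\<^bsub>Y\<^esub> r y a) b \<oplus>\<^bsub>Y\<^esub> l a (l b y \<ominus>\<^bsub>Y\<^esub> r y b)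
        = (l a (r y b) \<ominus>\<^bsub>Y\<^esub> r y (a \<otimes>\<^bsub>A\<^esub> b)) \<oplus>\<^bsub>Y\<^esub> (l (a \<otimes>\<^bsub>A\<^esub> b) y \<ominus>\<^bsub>Y\<^esub> l a (r y b))"
      using a b y by (simp add: A.l_minus A.r_minus A.l_closed A.r_closed A.lr_assoc A.l_assoc A.r_assoc)
    also have "\<dots> = (l (a \<otimes>\<^bsub>A\<^esub> b) y \<ominus>\<^bsub>Y\<^esub> l a (r y b)) \<oplus>\<^bsub>Y\<^esub> (l a (r y b) \<ominus>\<^bsub>Y\<^esub> r y (a \<otimes>\<^bsub>A\<^esub> b))"
      using a b y by (intro A.a_comm) (simp_all add: A.l_closed A.r_closed A.l_assoc A.r_assoc)
    also have "\<dots> = l (a \<otimes>\<^bsub>A\<^esub> b) y \<ominus>\<^bsub>Y\<^esub> r y (a \<otimes>\<^bsub>A\<^esub> b)"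
      using a b y by (intro A.minus_add_minus) (simp_all add: A.l_closed A.r_closed A.l_assoc A.r_assoc)
    finally show "l (a \<otimes>\<^bsub>A\<^esub> b) y \<ominus>\<^bsub>Y\<^esub> r y (a \<otimes>\<^bsub>A\<^esub> b)
        = r (l a y \<ominus>\<^bsub>Y\<^esub> r y a) b \<oplus>\<^bsub>Y\<^esub> l a (l b y \<ominus>\<^bsub>Y\<^esub> r y b)" by simp
  qed
qed

text \<open>Evaluation at points replaces the dual module operations by scalar identities; the sides
  change because \<open>a\<close> acts on \<open>f\<close> from the left by
  \<open>f (r x a)\<close>.\<close>

lemma inner_derivation_dual_iff:
  assumes "banach_bimodule A A E l r" and D: "\<And>a. a \<in> carrier A \<Longrightarrow> D a \<in> carrier (dual_space E)"
  shows "inner_derivation A (dual_space E) (dual_left E r) (dual_right E l) D \<longleftrightarrow>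
    (\<exists>f\<in>carrier (dual_space E). \<forall>a\<in>carrier A. \<forall>x\<in>carrier E. D a x = f (r x a) - f (l a x))"
proof -
  interpret banach_bimodule A A E l r by fact
  interpret dual: banach_bimodule A A E' "dual_left E r" "dual_right E l"
    by (rule dual_banach_bimodule)
  have "D a = dual_left E r a f \<ominus>\<^bsub>E'\<^esub> dual_right E l f a \<longleftrightarrow>
      (\<forall>x\<in>carrier E. D a x = f (r x a) - f (l a x))"
    if a: "a \<in> carrier A" and f: "f \<in> carrier E'" for a f
  proof -
    have "D a = dual_left E r a f \<ominus>\<^bsub>E'\<^esub> dual_right E l f a \<longleftrightarrow>
      (\<forall>x\<in>carrier E. D a x = (dual_left E r a f \<ominus>\<^bsub>E'\<^esub> dual_right E l f a) x)"
      using dual_ext[OF D[OF a]] dual.l_closed[OF a f] dual.r_closed[OF a f] by auto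
    also have "\<dots> \<longleftrightarrow> (\<forall>x\<in>carrier E. D a x = f (r x a) - f (l a x))"
      using dual.l_closed[OF a f] dual.r_closed[OF a f]
      by (simp add: dual_minus_apply dual_left_apply dual_right_apply)
    finally show ?thesis .
  qed
  then show ?thesis
    unfolding inner_derivation_def by blast
qed

lemma module_amenableD:
  fixes E :: "'u cnormed"
  assumes "module_amenable TYPE('u) K A lA rA"
    and comm: "commutative_banach_module K A lA rA E l r lk rk"
    and D: "module_derivation K A lA rA (dual_space E) (dual_left E r) (dual_right E l)
      (dual_left E rk) (dual_right E lk) D"
  obtains f where "f \<in> carrier (dual_space E)"
    "\<And>a x. \<lbrakk>a \<in> carrier A; x \<in> carrier E\<rbrakk> \<Longrightarrow> D a x = f (r x a) - f (l a x)"
proof -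
  have "inner_derivation A (dual_space E) (dual_left E r) (dual_right E l) D"
    using assms unfolding module_amenable_def by blast
  moreover have "banach_bimodule A A E l r"
    using comm by (simp add: commutative_banach_module_def)
  ultimately show thesis
    using that inner_derivation_dual_iff[of A E l r D] module_derivation_mem[OF D] by blast
qed

lemma module_amenableI:
  assumes "\<And>(E :: 'u cnormed) l r lk rk D. \<lbrakk>commutative_banach_module K A lA rA E l r lk rk;
      module_derivation K A lA rA (dual_space E) (dual_left E r) (dual_right E l)
        (dual_left E rk) (dual_right E lk) D\<rbrakk>
    \<Longrightarrow> \<exists>f\<in>carrier (dual_space E). \<forall>a\<in>carrier A. \<forall>x\<in>carrier E. D a x = f (r x a) - f (l a x)"
  shows "module_amenable TYPE('u) K A lA rA"
  unfolding module_amenable_def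
proof (intro allI impI)
  fix E :: "'u cnormed" and l r lk rk D
  assume comm: "commutative_banach_module K A lA rA E l r lk rk"
    and D: "module_derivation K A lA rA (dual_space E) (dual_left E r) (dual_right E l)
      (dual_left E rk) (dual_right E lk) D"
  have "banach_bimodule A A E l r"
    using comm by (simp add: commutative_banach_module_def)
  then show "inner_derivation A (dual_space E) (dual_left E r) (dual_right E l) D"
    using assms[OF comm D] module_derivation_mem[OF D] by (simp add: inner_derivation_dual_iff)
qed

text \<open>The derivation descends to the image of \<open>p\<close>; \<open>E\<close> itself may live on a type for which
  amenability is not assumed.\<close>

lemma (in quotient_map) module_amenable_quotient:
  fixes l :: "'a \<Rightarrow> 'x \<Rightarrow> 'x"
  assumes amenable: "module_amenable TYPE('y) K A lA rA"
    and comm: "commutative_banach_module K A lA rA E l r lk rk"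
    and A: "cnormed_space A"
    and A_mult: "\<And>a b. \<lbrakk>a \<in> carrier A; b \<in> carrier A\<rbrakk> \<Longrightarrow> a \<otimes>\<^bsub>A\<^esub> b \<in> carrier A"
    and K_closed: "\<And>\<alpha> a. \<lbrakk>\<alpha> \<in> carrier K; a \<in> carrier A\<rbrakk> \<Longrightarrow> lA \<alpha> a \<in> carrier A \<and> rA a \<alpha> \<in> carrier A"
    and l: "\<And>a. a \<in> carrier A \<Longrightarrow> fibrewise p E (\<lambda>x. p (l a x))"
    and r: "\<And>a. a \<in> carrier A \<Longrightarrow> fibrewise p E (\<lambda>x. p (r x a))"
    and lk: "\<And>\<alpha>. \<alpha> \<in> carrier K \<Longrightarrow> fibrewise p E (\<lambda>x. p (lk \<alpha> x))"
    and rk: "\<And>\<alpha>. \<alpha> \<in> carrier K \<Longrightarrow> fibrewise p E (\<lambda>x. p (rk x \<alpha>))"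
    and D: "module_derivation K A lA rA E' (dual_left E r) (dual_right E l)
      (dual_left E rk) (dual_right E lk) D"
    and D_fibrewise: "\<And>a. a \<in> carrier A \<Longrightarrow> fibrewise p E (D a)"
  shows "\<exists>f\<in>carrier E'. fibrewise p E f \<and>
    (\<forall>a\<in>carrier A. \<forall>x\<in>carrier E. D a x = f (r x a) - f (l a x))"
proof -
  interpret A: banach_bimodule A A E l r
    using comm by (simp add: commutative_banach_module_def)
  interpret K: banach_bimodule K K E lk rk
    using comm by (simp add: commutative_banach_module_def)
  note closed = A.l_closed A.r_closed K.l_closed K.r_closed
  note image_apply = image_left_apply[OF l] image_left_apply[OF lk] image_right_apply[OF r] image_right_apply[OF rk]
  have commF: "commutative_banach_module K A lA rA F (image_left p E l) (image_right p E r)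
      (image_left p E lk) (image_right p E rk)"
    using comm K_closed l r lk rk by (rule image_commutative_banach_module)
  define D' where "D' a = (\<lambda>u\<in>carrier F. D a (inv_into (carrier E) p u))" for a
  have D'_apply: "D' a (p x) = D a x" if "a \<in> carrier A" "x \<in> carrier E" for a x
    using fibrewise_inv_into[OF D_fibrewise] that by (simp add: D'_def)
  have D'_bound: "cmod (D' a u) \<le> nrm E' (D a) * nrm F u" if a: "a \<in> carrier A" and u: "u \<in> carrier F" for a u
  proof (rule image_nrm_bound[OF u])
    show "cmod (D' a u) \<le> nrm E' (D a) * nrm E x" if "x \<in> carrier E" "p x = u" for x
      using dual_bound[OF module_derivation_mem[OF D a] that(1)] a that D'_apply by auto
  qed simp
  have D'_mem: "D' a \<in> carrier (dual_space F)" if a: "a \<in> carrier A" for a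
  proof -
    have "restrict (D' a) (carrier F) \<in> carrier (dual_space F)"
    proof (rule image.dual_restrictI)
      show "cmod (D' a u) \<le> nrm E' (D a) * nrm F u" if "u \<in> carrier F" for u
        by (rule D'_bound[OF a that])
    qed (use a module_derivation_mem[OF D a] in \<open>auto simp: D'_apply dual_add dual_smult\<close>)
    then show ?thesis by (simp add: D'_def)
  qed
  obtain C where C: "\<forall>a\<in>carrier A. nrm E' (D a) \<le> C * nrm A a"
    using module_derivation_bound[OF D] by blast
  interpret FA: banach_bimodule A A "dual_space F" "dual_left F (image_right p E r)"
    "dual_right F (image_left p E l)"
    using commutative_banach_module_dual[OF commF] by (simp add: commutative_banach_module_def)
  interpret FK: banach_bimodule K K "dual_space F" "dual_left F (image_right p E rk)"
    "dual_right F (image_left p E lk)"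
    using commutative_banach_module_dual[OF commF] by (simp add: commutative_banach_module_def)
  have deriv: "module_derivation K A lA rA (dual_space F)
      (dual_left F (image_right p E r)) (dual_right F (image_left p E l))
      (dual_left F (image_right p E rk)) (dual_right F (image_left p E lk)) D'"
  proof (rule module_derivationI)
    show "cnormed_space A" by fact
    show "cnormed_space (dual_space F)" by (rule image.dual_cnormed_space)
    fix a assume a: "a \<in> carrier A"
    show "D' a \<in> carrier (dual_space F)" by (rule D'_mem[OF a])
    have "nrm (dual_space F) (D' a) \<le> nrm E' (D a)"
      using D'_bound[OF a] dual_nrm_nonneg[OF module_derivation_mem[OF D a]] by (rule image.dual_nrm_le)
    then show "nrm (dual_space F) (D' a) \<le> C * nrm A a"
      using C a by (meson order_trans)
    {
      fix \<alpha> assume \<alpha>: "\<alpha> \<in> carrier K"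
      show "D' (lA \<alpha> a) = dual_left F (image_right p E rk) \<alpha> (D' a)"
        by (rule dual_ext[of _ F]) (use \<alpha> a in \<open>auto simp: D'_mem K_closed FK.l_closed dual_left_apply
            dual_right_apply D'_apply image_apply closed module_derivation_lk[OF D]\<close>)
      show "D' (rA a \<alpha>) = dual_right F (image_left p E lk) (D' a) \<alpha>"
        by (rule dual_ext[of _ F]) (use \<alpha> a in \<open>auto simp: D'_mem K_closed FK.r_closed dual_left_apply
            dual_right_apply D'_apply image_apply closed module_derivation_rk[OF D]\<close>)
    }
    fix b assume b: "b \<in> carrier A"
    show "D' (a \<oplus>\<^bsub>A\<^esub> b) = D' a \<oplus>\<^bsub>dual_space F\<^esub> D' b"
      unfolding D'_def dual_space_simps
      by (rule restrict_ext) (use a b in \<open>simp add: module_derivation_add[OF D] inv_into_into\<close>)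
    have ab: "a \<otimes>\<^bsub>A\<^esub> b \<in> carrier A" using A_mult a b by blast
    show "D' (a \<otimes>\<^bsub>A\<^esub> b) = dual_right F (image_left p E l) (D' a) b \<oplus>\<^bsub>dual_space F\<^esub>
        dual_left F (image_right p E r) a (D' b)"
    proof (rule dual_ext[of _ F])
      show "D' (a \<otimes>\<^bsub>A\<^esub> b) \<in> carrier (dual_space F)" by (rule D'_mem[OF ab])
      show "dual_right F (image_left p E l) (D' a) b \<oplus>\<^bsub>dual_space F\<^esub>
          dual_left F (image_right p E r) a (D' b) \<in> carrier (dual_space F)"
        using a b D'_mem by (intro FA.add.m_closed FA.l_closed FA.r_closed)
    qed (use a b ab in \<open>auto simp: dual_left_apply dual_right_apply D'_apply image_apply closed
        module_derivation_mult[OF D]\<close>)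
  qed
  obtain g where g: "g \<in> carrier (dual_space F)"
    "\<And>a u. \<lbrakk>a \<in> carrier A; u \<in> carrier F\<rbrakk>
      \<Longrightarrow> D' a u = g (image_right p E r u a) - g (image_left p E l a u)"
    using module_amenableD[OF amenable commF deriv] by blast
  \<comment> \<open>Being composed with \<open>p\<close>, the functional is constant on fibres. For
    the quotient used in the converse direction this makes it annihilate
    \<open>A X + X A\<close>.\<close>
  define f where "f = (\<lambda>x\<in>carrier E. g (p x))"
  have "f \<in> carrier E'"
    unfolding f_def
  proof (rule dual_restrictI)
    fix x assume x: "x \<in> carrier E"
    have "cmod (g (p x)) \<le> nrm (dual_space F) g * nrm F (p x)"
      using x by (intro image.dual_bound g) simp
    also have "\<dots> \<le> nrm (dual_space F) g * nrm E x"
      by (intro mult_left_mono image_nrm_le image.dual_nrm_nonneg g x)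
    finally show "cmod (g (p x)) \<le> nrm (dual_space F) g * nrm E x" .
  next
    fix x y assume "x \<in> carrier E" "y \<in> carrier E"
    then show "g (p (x \<oplus> y)) = g (p x) + g (p y)"
      using dual_add[OF g(1), of "p x" "p y"] by simp
  next
    fix c x assume "x \<in> carrier E"
    then show "g (p (c \<odot> x)) = c * g (p x)"
      using dual_smult[OF g(1), of "p x" c] by simp
  qed
  moreover have "fibrewise p E f"
    by (simp add: fibrewise_def f_def)
  moreover have "D a x = f (r x a) - f (l a x)" if "a \<in> carrier A" "x \<in> carrier E" for a x
    using g(2)[of a "p x"] that by (simp add: D'_apply image_apply closed f_def)
  ultimately show ?thesis by blast
qed

section \<open>Zero elements, and two sources of quotient maps\<close>

lemma (in banach_left_module) l_zero_right: "a \<in> carrier A \<Longrightarrow> l a \<zero>\<^bsub>E\<^esub> = \<zero>\<^bsub>E\<^esub>"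
  using l_smult_right[of a "\<zero>\<^bsub>E\<^esub>" 0] by (simp add: l_closed)

lemma (in banach_left_module) l_zero_left:
  assumes "cnormed_space A" "x \<in> carrier E" shows "l \<zero>\<^bsub>A\<^esub> x = \<zero>\<^bsub>E\<^esub>"
proof -
  interpret A: cnormed_space A by fact
  show ?thesis
    using l_smult_left[of "\<zero>\<^bsub>A\<^esub>" x 0] assms(2) by (simp add: l_closed)
qed

lemma (in banach_right_module) r_zero_left: "b \<in> carrier B \<Longrightarrow> r \<zero>\<^bsub>E\<^esub> b = \<zero>\<^bsub>E\<^esub>"
  using r_smult_left[of b "\<zero>\<^bsub>E\<^esub>" 0] by (simp add: r_closed)

lemma (in banach_right_module) r_zero_right:
  assumes "cnormed_space B" "x \<in> carrier E" shows "r x \<zero>\<^bsub>B\<^esub> = \<zero>\<^bsub>E\<^esub>"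
proof -
  interpret B: cnormed_space B by fact
  show ?thesis
    using r_smult_right[of "\<zero>\<^bsub>B\<^esub>" x 0] assms(2) by (simp add: r_closed)
qed

lemma (in banach_algebra) mult_zero:
  "a \<in> carrier A \<Longrightarrow> a \<otimes> \<zero> = \<zero>" "a \<in> carrier A \<Longrightarrow> \<zero> \<otimes> a = \<zero>"
  using mult_smult_right[of a \<zero> 0] mult_smult_left[of \<zero> a 0] by (simp_all add: mult_closed)

lemma fibrewise_inj: "inj_on p (carrier E) \<Longrightarrow> fibrewise p E h"
  by (auto simp: fibrewise_def dest: inj_onD)

text \<open>Relabelling along an injection is a quotient with one-point fibres; it carries the dual
  of \<open>M\<close> into the universe \<open>'u\<close>.\<close>

lemma (in cbanach_space) quotient_map_inj:
  assumes inj: "inj_on p (carrier E)"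
  shows "quotient_map E p"
proof
  fix x assume x: "x \<in> carrier E" and *: "\<And>e. 0 < e \<Longrightarrow> \<exists>y\<in>carrier E. p y = p x \<and> nrm E y < e"
  have "nrm E x \<le> 0"
  proof (rule field_le_epsilon)
    fix e :: real assume "0 < e"
    then obtain y where y: "y \<in> carrier E" "p y = p x" "nrm E y < e" using * by blast
    then have "y = x" using inj_onD[OF inj] x by blast
    then show "nrm E x \<le> 0 + e" using y by simp
  qed
  then show "p x = p \<zero>"
    using nrm_nonneg[OF x] nrm_eq_0[OF x] by simp
qed (rule fibrewise_inj[OF inj])+

text \<open>The fibres are the cosets of the common kernel of \<open>S\<close>, which is closed
  because the members of \<open>S\<close> are bounded.\<close>

lemma (in cbanach_space) quotient_map_functionals:
  assumes S: "S \<subseteq> carrier E'"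
  obtains p :: "'x \<Rightarrow> 'x" where "quotient_map E p"
    "\<And>x y. \<lbrakk>x \<in> carrier E; y \<in> carrier E\<rbrakk> \<Longrightarrow> p x = p y \<longleftrightarrow> (\<forall>h\<in>S. h x = h y)"
proof -
  define p where "p x = (SOME y. y \<in> carrier E \<and> (\<forall>h\<in>S. h y = h x))" for x
  have p: "p x \<in> carrier E \<and> (\<forall>h\<in>S. h (p x) = h x)" if "x \<in> carrier E" for x
    unfolding p_def by (rule someI[of _ x]) (use that in simp)
  have iff: "p x = p y \<longleftrightarrow> (\<forall>h\<in>S. h x = h y)" if x: "x \<in> carrier E" and y: "y \<in> carrier E" for x y
  proof
    assume "p x = p y"
    then show "\<forall>h\<in>S. h x = h y" using p[OF x] p[OF y] by metis
  next
    assume "\<forall>h\<in>S. h x = h y"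
    \<comment> \<open>The predicates from which the two representatives are chosen coincide.\<close>
    then show "p x = p y" unfolding p_def by (intro arg_cong[of _ _ Eps] ext conj_cong ball_cong refl) auto
  qed
  have "quotient_map E p"
  proof
    show "fibrewise p E (\<lambda>x. p (x \<oplus> y))" if "y \<in> carrier E" for y
      unfolding fibrewise_def using that S by (auto simp: iff dual_add subset_iff)
    show "fibrewise p E (\<lambda>x. p (c \<odot> x))" for c
      unfolding fibrewise_def using S by (auto simp: iff dual_smult subset_iff)
    fix x assume x: "x \<in> carrier E" and *: "\<And>e. 0 < e \<Longrightarrow> \<exists>y\<in>carrier E. p y = p x \<and> nrm E y < e"
    have "h x = 0" if h: "h \<in> S" for h
    proof -
      have hE: "h \<in> carrier E'" using h S by blast
      have "cmod (h x) \<le> 0"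
      proof (rule field_le_epsilon)
        fix e :: real assume e: "0 < e"
        \<comment> \<open>The summand 1 keeps the denominator positive when \<open>h\<close> is
          zero.\<close>
        have pos: "0 < nrm E' h + 1" using dual_nrm_nonneg[OF hE] by simp
        obtain y where y: "y \<in> carrier E" "p y = p x" "nrm E y < e / (nrm E' h + 1)"
          using * e pos by (metis divide_pos_pos)
        have "cmod (h x) = cmod (h y)" using iff[OF y(1) x] y(2) h by metis
        also have "\<dots> \<le> nrm E' h * nrm E y" by (rule dual_bound[OF hE y(1)])
        also have "\<dots> \<le> (nrm E' h + 1) * (e / (nrm E' h + 1))"
          using y dual_nrm_nonneg[OF hE] nrm_nonneg by (intro mult_mono) auto
        also have "\<dots> = 0 + e" using pos by simp
        finally show "cmod (h x) \<le> 0 + e" .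
      qed
      then show ?thesis by simp
    qed
    then show "p x = p \<zero>" using x S by (auto simp: iff dual_zero subset_iff)
  qed
  then show thesis using iff by (rule that)
qed

section \<open>Triangular algebras\<close>

lemma triangular_simps [simp]:
  "Tri a m b \<in> carrier (triangular A M B l r) \<longleftrightarrow> a \<in> carrier A \<and> m \<in> carrier M \<and> b \<in> carrier B"
  "s \<otimes>\<^bsub>triangular A M B l r\<^esub> t =
     Tri (e11 s \<otimes>\<^bsub>A\<^esub> e11 t) (l (e11 s) (e12 t) \<oplus>\<^bsub>M\<^esub> r (e12 s) (e22 t)) (e22 s \<otimes>\<^bsub>B\<^esub> e22 t)"
  "zero (triangular A M B l r) = Tri \<zero>\<^bsub>A\<^esub> \<zero>\<^bsub>M\<^esub> \<zero>\<^bsub>B\<^esub>"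
  "s \<oplus>\<^bsub>triangular A M B l r\<^esub> t =
     Tri (e11 s \<oplus>\<^bsub>A\<^esub> e11 t) (e12 s \<oplus>\<^bsub>M\<^esub> e12 t) (e22 s \<oplus>\<^bsub>B\<^esub> e22 t)"
  "c \<odot>\<^bsub>triangular A M B l r\<^esub> t = Tri (c \<odot>\<^bsub>A\<^esub> e11 t) (c \<odot>\<^bsub>M\<^esub> e12 t) (c \<odot>\<^bsub>B\<^esub> e22 t)"
  "nrm (triangular A M B l r) t = nrm A (e11 t) + nrm M (e12 t) + nrm B (e22 t)"
  by (simp_all add: triangular_def)

lemma triangular_carrier:
  "t \<in> carrier (triangular A M B l r) \<longleftrightarrow>
     e11 t \<in> carrier A \<and> e12 t \<in> carrier M \<and> e22 t \<in> carrier B"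
  by (cases t) simp

lemma scalar_diagonal_carrier:
  "s \<in> carrier (scalar_diagonal K) \<longleftrightarrow> (\<exists>\<alpha>\<in>carrier K. s = Tri \<alpha> \<zero>\<^bsub>K\<^esub> \<alpha>)"
  by (auto simp: scalar_diagonal_def)

lemma scalar_diagonal_simps [simp]:
  "s \<otimes>\<^bsub>scalar_diagonal K\<^esub> t = s \<otimes>\<^bsub>triangular K K K (monoid.mult K) (monoid.mult K)\<^esub> t"
  "s \<oplus>\<^bsub>scalar_diagonal K\<^esub> t = s \<oplus>\<^bsub>triangular K K K (monoid.mult K) (monoid.mult K)\<^esub> t"
  "c \<odot>\<^bsub>scalar_diagonal K\<^esub> t = c \<odot>\<^bsub>triangular K K K (monoid.mult K) (monoid.mult K)\<^esub> t"
  "nrm (scalar_diagonal K) = nrm (triangular K K K (monoid.mult K) (monoid.mult K))"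
  by (simp_all add: scalar_diagonal_def)

lemma triangular_cnormed_space:
  assumes "cnormed_space A" "cnormed_space M" "cnormed_space B"
  shows "cnormed_space (triangular A M B l r)"
proof -
  interpret A: cnormed_space A by fact
  interpret M: cnormed_space M by fact
  interpret B: cnormed_space B by fact
  show ?thesis
  proof (rule cnormed_spaceI)
    show "module (ring_of_type_algebra :: complex ring) (triangular A M B l r)"
    proof (rule complex_moduleI)
      show "abelian_group (triangular A M B l r)"
      proof (rule abelian_groupI)
        fix t assume "t \<in> carrier (triangular A M B l r)"
        then show "\<exists>s\<in>carrier (triangular A M B l r).
            s \<oplus>\<^bsub>triangular A M B l r\<^esub> t = \<zero>\<^bsub>triangular A M B l r\<^esub>"
          by (intro bexI[of _ "Tri (\<ominus>\<^bsub>A\<^esub> e11 t) (\<ominus>\<^bsub>M\<^esub> e12 t) (\<ominus>\<^bsub>B\<^esub> e22 t)"])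
            (simp_all add: triangular_carrier A.l_neg M.l_neg B.l_neg)
      qed (auto simp: triangular_carrier A.a_ac M.a_ac B.a_ac)
    qed (auto simp: triangular_carrier A.smult_add_left M.smult_add_left B.smult_add_left
        A.smult_add_right M.smult_add_right B.smult_add_right A.smult_smult M.smult_smult B.smult_smult)
  next
    fix t assume "t \<in> carrier (triangular A M B l r)"
    then have t: "e11 t \<in> carrier A" "e12 t \<in> carrier M" "e22 t \<in> carrier B"
      by (simp_all add: triangular_carrier)
    note nonneg = A.nrm_nonneg[OF t(1)] M.nrm_nonneg[OF t(2)] B.nrm_nonneg[OF t(3)]
    show "0 \<le> nrm (triangular A M B l r) t" using nonneg by simp
    show "nrm (triangular A M B l r) t = 0 \<longleftrightarrow> t = \<zero>\<^bsub>triangular A M B l r\<^esub>"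
      using nonneg t A.nrm_eq_0[OF t(1)] M.nrm_eq_0[OF t(2)] B.nrm_eq_0[OF t(3)]
      by (cases t) (auto simp: add_nonneg_eq_0_iff)
    show "nrm (triangular A M B l r) (c \<odot>\<^bsub>triangular A M B l r\<^esub> t)
        \<le> cmod c * nrm (triangular A M B l r) t" for c
      using t by (simp add: A.nrm_smult M.nrm_smult B.nrm_smult distrib_left)
    fix s assume "s \<in> carrier (triangular A M B l r)"
    then have s: "e11 s \<in> carrier A" "e12 s \<in> carrier M" "e22 s \<in> carrier B"
      by (simp_all add: triangular_carrier)
    show "nrm (triangular A M B l r) (t \<oplus>\<^bsub>triangular A M B l r\<^esub> s)
        \<le> nrm (triangular A M B l r) t + nrm (triangular A M B l r) s"
      using A.nrm_add[OF t(1) s(1)] M.nrm_add[OF t(2) s(2)] B.nrm_add[OF t(3) s(3)] by simp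
  qed
qed

section \<open>The triangular algebra, its corners and their homomorphisms\<close>

locale triangular_data =
  K: banach_algebra K + A: banach_algebra_module K A lA rA + B: banach_algebra_module K B lB rB +
  M: banach_bimodule A B M l r + KM: banach_bimodule K K M lM rM
  for K :: "'k cnormed" and A :: "'a cnormed" and M :: "'m cnormed" and B :: "'b cnormed"
    and lA rA lB rB l r lM rM +
  assumes compat: "compatible_actions K A lA rA B lB rB M l r lM rM"
    and comm: "commutative_actions K M lM rM"
begin

abbreviation "T \<equiv> triangular A M B l r"
abbreviation "\<Delta> \<equiv> scalar_diagonal K"
abbreviation "lT \<equiv> tri_left lA lM lB"
abbreviation "rT \<equiv> tri_right rA rM rB"
abbreviation "diag \<alpha> \<equiv> Tri \<alpha> \<zero>\<^bsub>K\<^esub> \<alpha>"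
abbreviation "inA a \<equiv> Tri a \<zero>\<^bsub>M\<^esub> \<zero>\<^bsub>B\<^esub>"
abbreviation "inB b \<equiv> Tri \<zero>\<^bsub>A\<^esub> \<zero>\<^bsub>M\<^esub> b"

sublocale T: cnormed_space T
  by (intro triangular_cnormed_space A.cnormed_space_axioms M.cnormed_space_axioms
      B.cnormed_space_axioms)

lemma T_closed:
  "\<lbrakk>s \<in> carrier \<Delta>; t \<in> carrier T\<rbrakk> \<Longrightarrow> lT s t \<in> carrier T \<and> rT t s \<in> carrier T"
  by (auto simp: scalar_diagonal_carrier triangular_carrier tri_left_def tri_right_def
      A.l_closed B.l_closed KM.l_closed A.r_closed B.r_closed KM.r_closed)

lemma T_mult_closed: "\<lbrakk>s \<in> carrier T; t \<in> carrier T\<rbrakk> \<Longrightarrow> s \<otimes>\<^bsub>T\<^esub> t \<in> carrier T"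
  by (simp add: triangular_carrier A.mult_closed B.mult_closed M.l_closed M.r_closed)

lemma bounded_hom_e11: "bounded_hom T A e11"
  using A.nrm_nonneg M.nrm_nonneg B.nrm_nonneg unfolding bounded_hom_def
  by (auto simp: triangular_carrier intro!: exI[of _ 1])

lemma bounded_hom_e22: "bounded_hom T B e22"
  using A.nrm_nonneg M.nrm_nonneg B.nrm_nonneg unfolding bounded_hom_def
  by (auto simp: triangular_carrier intro!: exI[of _ 1])

lemma bounded_hom_inA: "bounded_hom A T inA"
  unfolding bounded_hom_def
  by (auto simp: A.nrm_nonneg M.l_zero_right M.r_zero_left B.mult_zero intro!: exI[of _ 1])

lemma bounded_hom_inB: "bounded_hom B T inB"
  unfolding bounded_hom_def
  by (auto simp: B.nrm_nonneg M.l_zero_right M.r_zero_left A.mult_zero intro!: exI[of _ 1])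

lemma bounded_hom_\<Delta>: "bounded_hom \<Delta> K e11" "bounded_hom \<Delta> K e22"
  using K.nrm_nonneg unfolding bounded_hom_def
  by (auto simp: scalar_diagonal_carrier intro!: exI[of _ 1])

text \<open>The constant is 2 because the norm of a diagonal matrix counts its entry twice.\<close>

lemma bounded_hom_diag: "bounded_hom K \<Delta> diag"
  unfolding bounded_hom_def
  by (auto simp: scalar_diagonal_carrier K.nrm_nonneg K.mult_zero intro!: exI[of _ 2])

lemma equivariant_e11: "equivariant \<Delta> e11 T lT rT lA rA e11"
  by (simp add: equivariant_def tri_left_def tri_right_def)

lemma equivariant_e22: "equivariant \<Delta> e22 T lT rT lB rB e22"
  by (simp add: equivariant_def tri_left_def tri_right_def)

text \<open>A pulled back module has one scalar map for both sides. On the dual of \<open>M\<close>,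
  where one side factors through \<open>e11\<close> and the other through \<open>e22\<close>, this
  map is \<open>e11\<close>, and it agrees with \<open>e22\<close> on diagonal matrices.\<close>

lemma equivariant_e22': "equivariant \<Delta> e11 T lT rT lB rB e22"
  by (auto simp: equivariant_def tri_left_def tri_right_def scalar_diagonal_carrier)

lemma equivariant_inA: "equivariant K diag A lA rA lT rT inA"
  by (simp add: equivariant_def tri_left_def tri_right_def KM.l_zero_right KM.r_zero_left
      B.l_zero_right B.r_zero_left)

lemma equivariant_inB: "equivariant K diag B lB rB lT rT inB"
  by (simp add: equivariant_def tri_left_def tri_right_def KM.l_zero_right KM.r_zero_left
      A.l_zero_right A.r_zero_left)

section \<open>Consequences of the amenability of \<open>T\<close>\<close>

text \<open>A derivation on \<open>C\<close> becomes one on \<open>T\<close> by composition with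
  \<open>\<phi>\<close>. The functional implementing the latter implements the former, because
  \<open>\<phi>\<close> is onto.\<close>

lemma module_amenable_image:
  assumes amenable: "module_amenable TYPE('u) \<Delta> T lT rT"
    and \<phi>: "bounded_hom T C \<phi>" and \<kappa>: "bounded_hom \<Delta> K \<kappa>"
    and eq: "equivariant \<Delta> \<kappa> T lT rT lC rC \<phi>"
    and onto: "\<And>c. c \<in> carrier C \<Longrightarrow> \<exists>t\<in>carrier T. \<phi> t = c"
  shows "module_amenable TYPE('u) K C lC rC"
proof (rule module_amenableI)
  fix E :: "'u cnormed" and l r lk rk D
  assume comm: "commutative_banach_module K C lC rC E l r lk rk"
    and D: "module_derivation K C lC rC (dual_space E) (dual_left E r) (dual_right E l)
        (dual_left E rk) (dual_right E lk) D"
  interpret banach_bimodule C C E l r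
    using comm by (simp add: commutative_banach_module_def)
  have \<kappa>': "\<kappa> \<in> carrier \<Delta> \<rightarrow> carrier K"
    using \<kappa> by (simp add: bounded_hom_def)
  have comm': "commutative_banach_module \<Delta> T lT rT E (\<lambda>t. l (\<phi> t)) (\<lambda>x t. r x (\<phi> t))
      (\<lambda>s. lk (\<kappa> s)) (\<lambda>x s. rk x (\<kappa> s))"
    by (rule commutative_banach_module_pullback[OF comm \<phi> \<kappa> eq])
  have "module_derivation \<Delta> T lT rT E' (dual_left E (\<lambda>x t. r x (\<phi> t)))
      (dual_right E (\<lambda>t. l (\<phi> t))) (dual_left E (\<lambda>x s. rk x (\<kappa> s)))
      (dual_right E (\<lambda>s. lk (\<kappa> s))) (\<lambda>t. D (\<phi> t))"
    using module_derivation_pullback[OF D \<phi> \<kappa>' eq T.cnormed_space_axioms dual_cnormed_space]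
    by (simp add: dual_left_def[abs_def] dual_right_def[abs_def])
  from module_amenableD[OF amenable comm' this]
  obtain f where "f \<in> carrier E'"
    "\<And>t x. \<lbrakk>t \<in> carrier T; x \<in> carrier E\<rbrakk> \<Longrightarrow> D (\<phi> t) x = f (r x (\<phi> t)) - f (l (\<phi> t) x)"
    by blast
  then show "\<exists>f\<in>carrier E'. \<forall>a\<in>carrier C. \<forall>x\<in>carrier E. D a x = f (r x a) - f (l a x)"
    using onto by (metis (no_types, lifting))
qed

lemma module_amenable_corners:
  assumes "module_amenable TYPE('u) \<Delta> T lT rT"
  shows "module_amenable TYPE('u) K A lA rA" and "module_amenable TYPE('u) K B lB rB"
proof -
  show "module_amenable TYPE('u) K A lA rA"
  proof (rule module_amenable_image[OF assms bounded_hom_e11 bounded_hom_\<Delta>(1) equivariant_e11])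
    show "\<exists>t\<in>carrier T. e11 t = a" if "a \<in> carrier A" for a
      by (rule bexI[of _ "inA a"]) (use that in simp_all)
  qed
  show "module_amenable TYPE('u) K B lB rB"
  proof (rule module_amenable_image[OF assms bounded_hom_e22 bounded_hom_\<Delta>(2) equivariant_e22])
    show "\<exists>t\<in>carrier T. e22 t = b" if "b \<in> carrier B" for b
      by (rule bexI[of _ "inB b"]) (use that in simp_all)
  qed
qed

text \<open>Dualising exchanges the sides: \<open>B\<close> acts on \<open>M\<close> from the right
  and so on the dual from the left, through \<open>e22\<close>, while \<open>A\<close> acts on the
  dual from the right, through \<open>e11\<close>. Commutativity of \<open>M\<close> over
  \<open>K\<close> becomes commutativity of the dual over \<open>\<Delta>\<close>.\<close>

lemma off_diagonal_commutative_module: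
  "commutative_banach_module \<Delta> T lT rT (dual_space M)
    (\<lambda>t. dual_left M r (e22 t)) (\<lambda>f t. dual_right M l f (e11 t))
    (\<lambda>s. dual_left M rM (e11 s)) (\<lambda>f s. dual_right M lM f (e11 s))"
  unfolding commutative_banach_module_def
proof (intro conjI)
  show "banach_bimodule T T (dual_space M) (\<lambda>t. dual_left M r (e22 t)) (\<lambda>f t. dual_right M l f (e11 t))"
    by (rule banach_bimodule_pullback[OF M.dual_banach_bimodule bounded_hom_e22 bounded_hom_e11])
  show "banach_bimodule \<Delta> \<Delta> (dual_space M) (\<lambda>s. dual_left M rM (e11 s)) (\<lambda>f s. dual_right M lM f (e11 s))"
    by (rule banach_bimodule_pullback[OF KM.dual_banach_bimodule bounded_hom_\<Delta>(1) bounded_hom_\<Delta>(1)])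
  have "e11 \<in> carrier \<Delta> \<rightarrow> carrier K" "e11 \<in> carrier T \<rightarrow> carrier A" "e22 \<in> carrier T \<rightarrow> carrier B"
    by (auto simp: scalar_diagonal_carrier triangular_carrier)
  then show "compatible_actions \<Delta> T lT rT T lT rT (dual_space M)
      (\<lambda>t. dual_left M r (e22 t)) (\<lambda>f t. dual_right M l f (e11 t))
      (\<lambda>s. dual_left M rM (e11 s)) (\<lambda>f s. dual_right M lM f (e11 s))"
    using compatible_actions_dual[OF compat M.banach_bimodule_axioms KM.banach_bimodule_axioms]
    by (intro compatible_actions_pullback[OF _ _ _ _ equivariant_e22' equivariant_e11])
  show "commutative_actions \<Delta> (dual_space M) (\<lambda>s. dual_left M rM (e11 s)) (\<lambda>f s. dual_right M lM f (e11 s))"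
    using commutative_actions_dual[OF comm] unfolding commutative_actions_def
    by (auto simp: scalar_diagonal_carrier)
qed

lemma off_diagonal_trivial:
  fixes \<iota> :: "('m \<Rightarrow> complex) \<Rightarrow> 'u"
  assumes amenable: "module_amenable TYPE('u) \<Delta> T lT rT" and inj: "inj \<iota>"
  shows "carrier M = {\<zero>\<^bsub>M\<^esub>}"
proof -
  let ?E = "dual_space M"
  let ?l = "\<lambda>t. dual_left M r (e22 t)" and ?r = "\<lambda>f t. dual_right M l f (e11 t)"
  let ?lk = "\<lambda>s. dual_left M rM (e11 s)" and ?rk = "\<lambda>f s. dual_right M lM f (e11 s)"
  interpret E: cbanach_space ?E
    by (rule M.dual_cbanach_space)
  interpret ET: banach_bimodule T T ?E ?l ?r
    using off_diagonal_commutative_module by (simp add: commutative_banach_module_def)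
  interpret EK: banach_bimodule \<Delta> \<Delta> ?E ?lk ?rk
    using off_diagonal_commutative_module by (simp add: commutative_banach_module_def)
  have inj': "inj_on \<iota> (carrier ?E)"
    using inj by (rule inj_on_subset) simp
  interpret quotient_map ?E \<iota>
    by (rule E.quotient_map_inj[OF inj'])
  note fib = fibrewise_inj[OF inj']
  define D where "D t = (\<lambda>f\<in>carrier ?E. f (e12 t))" for t :: "('a, 'm, 'b) tri"
  have D_mem: "D t \<in> carrier (dual_space ?E)" if "t \<in> carrier T" for t
    unfolding D_def
  proof (rule E.dual_restrictI)
    fix f assume "f \<in> carrier ?E"
    then show "cmod (f (e12 t)) \<le> nrm M (e12 t) * nrm ?E f"
      using M.dual_bound[of f "e12 t"] that by (simp add: triangular_carrier mult.commute)
  qed (use that in \<open>simp_all add: triangular_carrier\<close>)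
  have D: "module_derivation \<Delta> T lT rT (dual_space ?E) (dual_left ?E ?r) (dual_right ?E ?l)
      (dual_left ?E ?rk) (dual_right ?E ?lk) D"
  proof (rule module_derivationI)
    show "cnormed_space T" by (rule T.cnormed_space_axioms)
    show "cnormed_space (dual_space ?E)" by (rule E.dual_cnormed_space)
    fix t assume t: "t \<in> carrier T"
    then have t': "e11 t \<in> carrier A" "e12 t \<in> carrier M" "e22 t \<in> carrier B"
      by (simp_all add: triangular_carrier)
    show "D t \<in> carrier (dual_space ?E)" by (rule D_mem[OF t])
    have "nrm (dual_space ?E) (D t) \<le> nrm M (e12 t)"
      using M.dual_bound t' M.nrm_nonneg by (intro E.dual_nrm_le) (simp_all add: D_def mult.commute)
    then show "nrm (dual_space ?E) (D t) \<le> 1 * nrm T t"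
      using A.nrm_nonneg[OF t'(1)] B.nrm_nonneg[OF t'(3)] by simp
    {
      fix s assume s: "s \<in> carrier \<Delta>"
      \<comment> \<open>In \<open>tri_right\<close> the upper right entry is multiplied by
        \<open>e22 s\<close>, whereas the scalar actions on the dual of \<open>M\<close> go through
        \<open>e11 s\<close>.\<close>
      then have s': "e11 s \<in> carrier K" "e22 s = e11 s" by (auto simp: scalar_diagonal_carrier)
      show "D (lT s t) = dual_left ?E ?rk s (D t)"
        unfolding D_def dual_left_def[of ?E]
        by (rule restrict_ext)
          (use t' s EK.r_closed[OF s] in \<open>simp add: tri_left_def dual_right_apply\<close>)
      show "D (rT t s) = dual_right ?E ?lk (D t) s"
        unfolding D_def dual_right_def[of ?E]
        by (rule restrict_ext)
          (use t' s s' EK.l_closed[OF s] in \<open>simp add: tri_right_def dual_left_apply\<close>)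
    }
    fix s assume s: "s \<in> carrier T"
    then have s': "e11 s \<in> carrier A" "e12 s \<in> carrier M" "e22 s \<in> carrier B"
      by (simp_all add: triangular_carrier)
    show "D (t \<oplus>\<^bsub>T\<^esub> s) = D t \<oplus>\<^bsub>dual_space ?E\<^esub> D s"
      unfolding D_def dual_space_simps
      by (rule restrict_ext) (use t' s' in \<open>simp add: dual_add\<close>)
    \<comment> \<open>This is the formula for the upper right entry of a matrix product:
      \<open>D t\<close> times \<open>s\<close> evaluates at \<open>r (e12 t) (e22 s)\<close>, and
      \<open>t\<close> times \<open>D s\<close> evaluates at
      \<open>l (e11 t) (e12 s)\<close>.\<close>
    show "D (t \<otimes>\<^bsub>T\<^esub> s) = dual_right ?E ?l (D t) s \<oplus>\<^bsub>dual_space ?E\<^esub> dual_left ?E ?r t (D s)"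
      unfolding D_def dual_space_simps dual_left_def[of ?E] dual_right_def[of ?E]
      by (rule restrict_ext) (use t t' s s' ET.l_closed[OF s] ET.r_closed[OF t] in
        \<open>simp add: dual_add dual_left_apply dual_right_apply M.l_closed M.r_closed\<close>)
  qed
  have "\<exists>\<Phi>\<in>carrier (dual_space ?E). fibrewise \<iota> ?E \<Phi> \<and>
      (\<forall>t\<in>carrier T. \<forall>f\<in>carrier ?E. D t f = \<Phi> (?r f t) - \<Phi> (?l t f))"
    by (rule module_amenable_quotient[OF amenable off_diagonal_commutative_module
        T.cnormed_space_axioms T_mult_closed T_closed fib fib fib fib D fib])
  then obtain \<Phi> where \<Phi>: "\<Phi> \<in> carrier (dual_space ?E)"
    "\<forall>t\<in>carrier T. \<forall>f\<in>carrier ?E. D t f = \<Phi> (?r f t) - \<Phi> (?l t f)"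
    by blast
  have "m = \<zero>\<^bsub>M\<^esub>" if m: "m \<in> carrier M" for m
  proof (rule M.dual_separates[OF m])
    fix f assume f: "f \<in> carrier ?E"
    have "?r f (Tri \<zero>\<^bsub>A\<^esub> m \<zero>\<^bsub>B\<^esub>) = \<zero>\<^bsub>?E\<^esub>" "?l (Tri \<zero>\<^bsub>A\<^esub> m \<zero>\<^bsub>B\<^esub>) f = \<zero>\<^bsub>?E\<^esub>"
      unfolding dual_left_def dual_right_def dual_space_simps
      by (rule restrict_ext; simp add: M.l_zero_left M.r_zero_right A.cnormed_space_axioms
          B.cnormed_space_axioms M.dual_zero[OF f])+
    then have "D (Tri \<zero>\<^bsub>A\<^esub> m \<zero>\<^bsub>B\<^esub>) f = 0"
      using \<Phi>(2)[rule_format, of "Tri \<zero>\<^bsub>A\<^esub> m \<zero>\<^bsub>B\<^esub>" f] m f E.dual_zero[OF \<Phi>(1)] by simp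
    then show "f m = 0" using f by (simp add: D_def)
  qed
  then show ?thesis by auto
qed

section \<open>Amenability of \<open>T\<close> when \<open>M\<close> is trivial\<close>

lemma module_amenable_product:
  assumes amenA: "module_amenable TYPE('u) K A lA rA" and amenB: "module_amenable TYPE('u) K B lB rB"
    and M_zero: "carrier M = {\<zero>\<^bsub>M\<^esub>}"
  shows "module_amenable TYPE('u) \<Delta> T lT rT"
proof (rule module_amenableI)
  fix E :: "'u cnormed" and l' r' lk rk D
  assume commE: "commutative_banach_module \<Delta> T lT rT E l' r' lk rk"
    and D: "module_derivation \<Delta> T lT rT (dual_space E) (dual_left E r') (dual_right E l')
        (dual_left E rk) (dual_right E lk) D"
  interpret ET: banach_bimodule T T E l' r'
    using commE by (simp add: commutative_banach_module_def)
  interpret EK: banach_bimodule \<Delta> \<Delta> E lk rk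
    using commE by (simp add: commutative_banach_module_def)
  interpret E': cnormed_space "dual_space E"
    by (rule ET.dual_cnormed_space)
  note commE' = commutative_banach_module_dual[OF commE]
  interpret E'T: banach_bimodule T T "dual_space E" "dual_left E r'" "dual_right E l'"
    by (rule ET.dual_banach_bimodule)
  have inA [simp]: "inA a \<in> carrier T" if "a \<in> carrier A" for a using that by simp
  have inB [simp]: "inB b \<in> carrier T" if "b \<in> carrier B" for b using that by simp
  have diag [simp]: "diag \<alpha> \<in> carrier \<Delta>" if "\<alpha> \<in> carrier K" for \<alpha>
    using that by (auto simp: scalar_diagonal_carrier)
  then have diag': "diag \<in> carrier K \<rightarrow> carrier \<Delta>" by blast
  have inA_inB: "inA a \<otimes>\<^bsub>T\<^esub> inB b = \<zero>\<^bsub>T\<^esub>" "inB b \<otimes>\<^bsub>T\<^esub> inA a = \<zero>\<^bsub>T\<^esub>"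
    if "a \<in> carrier A" "b \<in> carrier B" for a b
    using that by (simp_all add: A.mult_zero B.mult_zero M.l_zero_right M.r_zero_left)

  have commA: "commutative_banach_module K A lA rA E (\<lambda>a. l' (inA a)) (\<lambda>x a. r' x (inA a))
      (\<lambda>\<alpha>. lk (diag \<alpha>)) (\<lambda>x \<alpha>. rk x (diag \<alpha>))"
    by (rule commutative_banach_module_pullback[OF commE bounded_hom_inA bounded_hom_diag equivariant_inA])
  have commB: "commutative_banach_module K B lB rB E (\<lambda>b. l' (inB b)) (\<lambda>x b. r' x (inB b))
      (\<lambda>\<alpha>. lk (diag \<alpha>)) (\<lambda>x \<alpha>. rk x (diag \<alpha>))"
    by (rule commutative_banach_module_pullback[OF commE bounded_hom_inB bounded_hom_diag equivariant_inB])

  have "module_derivation K A lA rA (dual_space E) (dual_left E (\<lambda>x a. r' x (inA a)))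
      (dual_right E (\<lambda>a. l' (inA a))) (dual_left E (\<lambda>x \<alpha>. rk x (diag \<alpha>)))
      (dual_right E (\<lambda>\<alpha>. lk (diag \<alpha>))) (\<lambda>a. D (inA a))"
    using module_derivation_pullback[OF D bounded_hom_inA diag' equivariant_inA A.cnormed_space_axioms
        ET.dual_cnormed_space]
    by (simp add: dual_left_def[abs_def] dual_right_def[abs_def])
  from module_amenableD[OF amenA commA this]
  obtain f where f: "f \<in> carrier (dual_space E)"
    "\<And>a x. \<lbrakk>a \<in> carrier A; x \<in> carrier E\<rbrakk> \<Longrightarrow> D (inA a) x = f (r' x (inA a)) - f (l' (inA a) x)"
    by blast

  define D' where "D' t = D t \<ominus>\<^bsub>dual_space E\<^esub> (dual_left E r' t f \<ominus>\<^bsub>dual_space E\<^esub> dual_right E l' f t)" for t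
  have D': "module_derivation \<Delta> T lT rT (dual_space E) (dual_left E r') (dual_right E l')
        (dual_left E rk) (dual_right E lk) D'"
    unfolding D'_def
    by (rule module_derivation_diff[OF commE' T.cnormed_space_axioms D
          inner_module_derivation[OF commE' T.cnormed_space_axioms T_closed f(1)]])
  have D'_apply: "D' t x = D t x - (f (r' x t) - f (l' t x))" if "t \<in> carrier T" "x \<in> carrier E" for t x
    using that f(1) module_derivation_mem[OF D] E'T.l_closed E'T.r_closed
    by (simp add: D'_def ET.dual_minus_apply dual_left_apply dual_right_apply)
  have D'_inA: "D' (inA a) x = 0" if "a \<in> carrier A" "x \<in> carrier E" for a x
    using that f(2) by (simp add: D'_apply)
  have D'_zero: "D' \<zero>\<^bsub>T\<^esub> x = 0" if "x \<in> carrier E" for x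
    using D'_inA[of "\<zero>\<^bsub>A\<^esub>" x] that by simp

  \<comment> \<open>The annihilator of \<open>A X + X A\<close>, where \<open>X\<close> is the
    module \<open>E\<close>.\<close>
  define S where "S = {h \<in> carrier (dual_space E). \<forall>a\<in>carrier A. \<forall>x\<in>carrier E.
      h (l' (inA a) x) = 0 \<and> h (r' x (inA a)) = 0}"
  have D'_inB: "D' (inB b) \<in> S" if b: "b \<in> carrier B" for b
  proof -
    have "D' (inB b) (l' (inA a) x) = 0 \<and> D' (inB b) (r' x (inA a)) = 0"
      if a: "a \<in> carrier A" and x: "x \<in> carrier E" for a x
    proof
      \<comment> \<open>The product rule for \<open>b a = 0\<close>, evaluated at \<open>x\<close>.
        The summand with \<open>D' (inA a)\<close> vanishes, which leaves the value of
        \<open>D' (inB b)\<close> at \<open>a x\<close>; the product \<open>a b = 0\<close> treats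
        \<open>x a\<close> in the same way.\<close>
      have "D' \<zero>\<^bsub>T\<^esub> x = D' (inB b) (l' (inA a) x) + D' (inA a) (r' x (inB b))"
        using module_derivation_mult[OF D' inB[OF b] inA[OF a]] a b x
        by (simp add: inA_inB dual_left_apply dual_right_apply del: triangular_simps(2,3))
      then show "D' (inB b) (l' (inA a) x) = 0"
        using a b x by (simp add: D'_inA D'_zero ET.r_closed del: triangular_simps(3))
      have "D' \<zero>\<^bsub>T\<^esub> x = D' (inA a) (l' (inB b) x) + D' (inB b) (r' x (inA a))"
        using module_derivation_mult[OF D' inA[OF a] inB[OF b]] a b x
        by (simp add: inA_inB dual_left_apply dual_right_apply del: triangular_simps(2,3))
      then show "D' (inB b) (r' x (inA a)) = 0"
        using a b x by (simp add: D'_inA D'_zero ET.l_closed del: triangular_simps(3))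
    qed
    then show ?thesis
      using module_derivation_mem[OF D' inB[OF b]] by (simp add: S_def)
  qed
  have S: "S \<subseteq> carrier (dual_space E)" by (auto simp: S_def)
  obtain p :: "'u \<Rightarrow> 'u" where p: "quotient_map E p"
    and p_iff: "\<And>x y. \<lbrakk>x \<in> carrier E; y \<in> carrier E\<rbrakk> \<Longrightarrow> p x = p y \<longleftrightarrow> (\<forall>h\<in>S. h x = h y)"
    using ET.quotient_map_functionals[OF S] by blast
  \<comment> \<open>A map on \<open>X\<close> descends to the quotient if its transpose preserves
    \<open>S\<close>.\<close>
  have fib: "fibrewise p E (\<lambda>x. p (k x))"
    if k: "\<And>x. x \<in> carrier E \<Longrightarrow> k x \<in> carrier E" and S_k: "\<And>h. h \<in> S \<Longrightarrow> (\<lambda>x\<in>carrier E. h (k x)) \<in> S"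
    for k
    unfolding fibrewise_def
  proof (intro ballI impI)
    fix x y assume xy: "x \<in> carrier E" "y \<in> carrier E" "p x = p y"
    have "h (k x) = h (k y)" if "h \<in> S" for h
      using S_k[OF that] xy(3) unfolding p_iff[OF xy(1,2)] using xy by (metis restrict_apply')
    then show "p (k x) = p (k y)" using p_iff k xy by blast
  qed
  have compat: "lk s (l' t x) = l' (lT s t) x \<and> r' (lk s x) t = lk s (r' x t)"
    and commute: "rk x s = lk s x"
    if "s \<in> carrier \<Delta>" "t \<in> carrier T" "x \<in> carrier E" for s t x
    using commE that
    unfolding commutative_banach_module_def compatible_actions_def commutative_actions_def by auto
  \<comment> \<open>Left multiplication by \<open>b\<close> preserves \<open>A X + X A\<close>: here
    \<open>b (a x) = (b a) x = 0\<close>, and \<open>b (x a) = (b x) a\<close> lies in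
    \<open>X A\<close>. Right multiplication is symmetric.\<close>
  have S_l: "(\<lambda>x\<in>carrier E. h (l' (inB b) x)) \<in> S" if h: "h \<in> S" and b: "b \<in> carrier B" for h b
  proof -
    have hE: "h \<in> carrier (dual_space E)" using h S by blast
    have "h (l' (inB b) (l' (inA a) x)) = 0 \<and> h (l' (inB b) (r' x (inA a))) = 0"
      if a: "a \<in> carrier A" and x: "x \<in> carrier E" for a x
    proof
      have "l' (inB b) (l' (inA a) x) = \<zero>\<^bsub>E\<^esub>"
        using ET.l_assoc[OF inB[OF b] inA[OF a] x] ET.l_zero_left[OF T.cnormed_space_axioms x]
        by (simp only: inA_inB[OF a b])
      then show "h (l' (inB b) (l' (inA a) x)) = 0"
        using ET.dual_zero[OF hE] by simp
      have "l' (inB b) (r' x (inA a)) = r' (l' (inB b) x) (inA a)"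
        using ET.lr_assoc[OF inB[OF b] inA[OF a] x] by simp
      then show "h (l' (inB b) (r' x (inA a))) = 0"
        using h a ET.l_closed[OF inB[OF b] x] by (simp add: S_def)
    qed
    then show ?thesis
      using E'T.r_closed[OF inB[OF b] hE] b
      by (simp add: S_def dual_right_def ET.l_closed ET.r_closed)
  qed
  have S_r: "(\<lambda>x\<in>carrier E. h (r' x (inB b))) \<in> S" if h: "h \<in> S" and b: "b \<in> carrier B" for h b
  proof -
    have hE: "h \<in> carrier (dual_space E)" using h S by blast
    have "h (r' (l' (inA a) x) (inB b)) = 0 \<and> h (r' (r' x (inA a)) (inB b)) = 0"
      if a: "a \<in> carrier A" and x: "x \<in> carrier E" for a x
    proof
      have "r' (r' x (inA a)) (inB b) = \<zero>\<^bsub>E\<^esub>"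
        using ET.r_assoc[OF inA[OF a] inB[OF b] x] ET.r_zero_right[OF T.cnormed_space_axioms x]
        by (simp only: inA_inB[OF a b])
      then show "h (r' (r' x (inA a)) (inB b)) = 0"
        using ET.dual_zero[OF hE] by simp
      have "r' (l' (inA a) x) (inB b) = l' (inA a) (r' x (inB b))"
        using ET.lr_assoc[OF inA[OF a] inB[OF b] x] by simp
      then show "h (r' (l' (inA a) x) (inB b)) = 0"
        using h a ET.r_closed[OF inB[OF b] x] by (simp add: S_def)
    qed
    then show ?thesis
      using E'T.l_closed[OF inB[OF b] hE] b
      by (simp add: S_def dual_left_def ET.l_closed ET.r_closed)
  qed
  \<comment> \<open>Scalars preserve \<open>A X + X A\<close> by
    \<open>\<alpha> (a x) = (\<alpha> a) x\<close> and
    \<open>\<alpha> (x a) = (\<alpha> x) a\<close>.\<close>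
  have S_k: "(\<lambda>x\<in>carrier E. h (lk (diag \<alpha>) x)) \<in> S" if h: "h \<in> S" and \<alpha>: "\<alpha> \<in> carrier K" for h \<alpha>
  proof -
    have hE: "h \<in> carrier (dual_space E)" using h S by blast
    have "h (lk (diag \<alpha>) (l' (inA a) x)) = 0 \<and> h (lk (diag \<alpha>) (r' x (inA a))) = 0"
      if a: "a \<in> carrier A" and x: "x \<in> carrier E" for a x
    proof -
      have "lT (diag \<alpha>) (inA a) = inA (lA \<alpha> a)"
        using equivariant_inA \<alpha> a by (simp add: equivariant_def)
      then have "lk (diag \<alpha>) (l' (inA a) x) = l' (inA (lA \<alpha> a)) x"
        "lk (diag \<alpha>) (r' x (inA a)) = r' (lk (diag \<alpha>) x) (inA a)"
        using compat[OF diag[OF \<alpha>] inA[OF a] x] by simp_all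
      then show ?thesis
        using h \<alpha> a x A.l_closed EK.l_closed[OF diag[OF \<alpha>] x] by (simp add: S_def)
    qed
    moreover have "(\<lambda>x\<in>carrier E. h (lk (diag \<alpha>) x)) \<in> carrier (dual_space E)"
      using banach_bimodule.dual_banach_bimodule[OF EK.banach_bimodule_axioms] hE \<alpha>
        banach_right_module.r_closed[of \<Delta> "dual_space E" "dual_right E lk" "diag \<alpha>" h]
      by (simp add: banach_bimodule_def dual_right_def)
    ultimately show ?thesis
      by (simp add: S_def ET.l_closed ET.r_closed)
  qed

  have DB: "module_derivation K B lB rB (dual_space E) (dual_left E (\<lambda>x b. r' x (inB b)))
      (dual_right E (\<lambda>b. l' (inB b))) (dual_left E (\<lambda>x \<alpha>. rk x (diag \<alpha>)))
      (dual_right E (\<lambda>\<alpha>. lk (diag \<alpha>))) (\<lambda>b. D' (inB b))"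
    using module_derivation_pullback[OF D' bounded_hom_inB diag' equivariant_inB B.cnormed_space_axioms
        ET.dual_cnormed_space]
    by (simp add: dual_left_def[abs_def] dual_right_def[abs_def])
  have "\<exists>g\<in>carrier (dual_space E). fibrewise p E g \<and>
      (\<forall>b\<in>carrier B. \<forall>x\<in>carrier E. D' (inB b) x = g (r' x (inB b)) - g (l' (inB b) x))"
  proof (rule quotient_map.module_amenable_quotient[OF p amenB commB B.cnormed_space_axioms
        B.mult_closed _ _ _ _ _ DB])
    show "lB \<alpha> b \<in> carrier B \<and> rB b \<alpha> \<in> carrier B" if "\<alpha> \<in> carrier K" "b \<in> carrier B" for \<alpha> b
      using that by (simp add: B.l_closed B.r_closed)
    show "fibrewise p E (\<lambda>x. p (l' (inB b) x))" if "b \<in> carrier B" for b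
      using that S_l by (intro fib) (simp_all add: ET.l_closed)
    show "fibrewise p E (\<lambda>x. p (r' x (inB b)))" if "b \<in> carrier B" for b
      using that S_r by (intro fib) (simp_all add: ET.r_closed)
    show lk: "fibrewise p E (\<lambda>x. p (lk (diag \<alpha>) x))" if "\<alpha> \<in> carrier K" for \<alpha>
      using that S_k by (intro fib) (simp_all add: EK.l_closed)
    show "fibrewise p E (\<lambda>x. p (rk x (diag \<alpha>)))" if "\<alpha> \<in> carrier K" for \<alpha>
    proof -
      have "p (rk x (diag \<alpha>)) = p (lk (diag \<alpha>) x)" if "x \<in> carrier E" for x
        \<comment> \<open>The fact \<open>commute\<close> shares its premises with
          \<open>compat\<close> and therefore asks for an element of \<open>T\<close>; zero
          serves.\<close>
        using commute[OF diag[OF \<open>\<alpha> \<in> carrier K\<close>] T.zero_closed that] by simp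
      then show ?thesis
        using lk[OF that] unfolding fibrewise_def by metis
    qed
    show "fibrewise p E (D' (inB b))" if "b \<in> carrier B" for b
      using D'_inB[OF that] p_iff by (simp add: fibrewise_def)
  qed
  then obtain g where g: "g \<in> carrier (dual_space E)" "fibrewise p E g"
    "\<And>b x. \<lbrakk>b \<in> carrier B; x \<in> carrier E\<rbrakk> \<Longrightarrow> D' (inB b) x = g (r' x (inB b)) - g (l' (inB b) x)"
    by blast
  \<comment> \<open>Every member of \<open>S\<close> vanishes at \<open>a x\<close> and
    \<open>x a\<close>, so both lie in the fibre of zero, on which \<open>g\<close> is
    constant.\<close>
  have g_inA: "g (l' (inA a) x) = 0" "g (r' x (inA a)) = 0" if a: "a \<in> carrier A" and x: "x \<in> carrier E" for a x
  proof -
    have "p (l' (inA a) x) = p \<zero>\<^bsub>E\<^esub>" "p (r' x (inA a)) = p \<zero>\<^bsub>E\<^esub>"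
      using a x S ET.l_closed[OF inA[OF a] x] ET.r_closed[OF inA[OF a] x]
      by (auto simp: p_iff S_def ET.dual_zero)
    then show "g (l' (inA a) x) = 0" "g (r' x (inA a)) = 0"
      using g(1,2) a x ET.l_closed[OF inA[OF a] x] ET.r_closed[OF inA[OF a] x] ET.dual_zero[OF g(1)]
      unfolding fibrewise_def by (metis ET.zero_closed)+
  qed
  have fg: "f \<oplus>\<^bsub>dual_space E\<^esub> g \<in> carrier (dual_space E)"
    using f(1) g(1) by (rule E'.add.m_closed)
  have "D t x = (f \<oplus>\<^bsub>dual_space E\<^esub> g) (r' x t) - (f \<oplus>\<^bsub>dual_space E\<^esub> g) (l' t x)"
    if t: "t \<in> carrier T" and x: "x \<in> carrier E" for t x
  proof -
    \<comment> \<open>Here \<open>M = 0\<close> enters: a matrix is the sum of its two diagonal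
      parts.\<close>
    obtain a b where ab: "a \<in> carrier A" "b \<in> carrier B" "t = inA a \<oplus>\<^bsub>T\<^esub> inB b"
    proof
      show "e11 t \<in> carrier A" "e22 t \<in> carrier B" "t = inA (e11 t) \<oplus>\<^bsub>T\<^esub> inB (e22 t)"
        using t M_zero by (cases t; simp)+
    qed
    have r't: "r' x t = r' x (inA a) \<oplus>\<^bsub>E\<^esub> r' x (inB b)"
      unfolding ab(3) by (rule ET.r_add_right[OF inA[OF ab(1)] inB[OF ab(2)] x])
    have l't: "l' t x = l' (inA a) x \<oplus>\<^bsub>E\<^esub> l' (inB b) x"
      unfolding ab(3) by (rule ET.l_add_left[OF inA[OF ab(1)] inB[OF ab(2)] x])
    note closed = ET.l_closed[OF inA[OF ab(1)] x] ET.l_closed[OF inB[OF ab(2)] x]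
      ET.r_closed[OF inA[OF ab(1)] x] ET.r_closed[OF inB[OF ab(2)] x]
    have "D' t x = D' (inA a) x + D' (inB b) x"
      unfolding ab(3) using module_derivation_add[OF D' inA[OF ab(1)] inB[OF ab(2)]] x by simp
    also have "\<dots> = g (r' x (inB b)) - g (l' (inB b) x)"
      using D'_inA g(3) ab x by simp
    also have "\<dots> = g (r' x t) - g (l' t x)"
      using closed g_inA[OF ab(1) x] unfolding r't l't by (simp add: dual_add[OF g(1)])
    finally show ?thesis
      using D'_apply[OF t x] ET.l_closed[OF t x] ET.r_closed[OF t x] by (simp add: algebra_simps)
  qed
  then show "\<exists>f\<in>carrier (dual_space E). \<forall>t\<in>carrier T. \<forall>x\<in>carrier E. D t x = f (r' x t) - f (l' t x)"
    using fg by blast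
qed

end

theorem theorem2p3:
  fixes K :: "'k cnormed" and A :: "'a cnormed" and M :: "'m cnormed" and B :: "'b cnormed"
    and lA :: "'k \<Rightarrow> 'a \<Rightarrow> 'a" and rA :: "'a \<Rightarrow> 'k \<Rightarrow> 'a"
    and lB :: "'k \<Rightarrow> 'b \<Rightarrow> 'b" and rB :: "'b \<Rightarrow> 'k \<Rightarrow> 'b"
    and l :: "'a \<Rightarrow> 'm \<Rightarrow> 'm" and r :: "'m \<Rightarrow> 'b \<Rightarrow> 'm"
    and lM :: "'k \<Rightarrow> 'm \<Rightarrow> 'm" and rM :: "'m \<Rightarrow> 'k \<Rightarrow> 'm"
  assumes "banach_algebra K"
    and "banach_algebra_module K A lA rA"
    and "banach_algebra_module K B lB rB"
    and "banach_bimodule A B M l r"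
    and "banach_bimodule K K M lM rM"
    and "compatible_actions K A lA rA B lB rB M l r lM rM"
    and "commutative_actions K M lM rM"
    and "large_universe TYPE('u) K A M B"
  shows "module_amenable TYPE('u) (scalar_diagonal K) (triangular A M B l r)
           (tri_left lA lM lB) (tri_right rA rM rB) \<longleftrightarrow>
         module_amenable TYPE('u) K A lA rA \<and> module_amenable TYPE('u) K B lB rB \<and>
         carrier M = {\<zero>\<^bsub>M\<^esub>}"
proof -
  interpret triangular_data K A M B lA rA lB rB l r lM rM
    using assms(1-7) by (intro triangular_data.intro triangular_data_axioms.intro)
  obtain \<iota> :: "('k + 'a + 'm + 'b \<Rightarrow> complex) \<Rightarrow> 'u" where \<iota>: "inj \<iota>"
    using assms(8) by (auto simp: large_universe_def)
  \<comment> \<open>Extension by zero places the functions on \<open>'m\<close>, among them the dual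
    of \<open>M\<close>, inside the function space that \<open>large_universe\<close> embeds into
    \<open>'u\<close>.\<close>
  define \<epsilon> :: "('m \<Rightarrow> complex) \<Rightarrow> 'k + 'a + 'm + 'b \<Rightarrow> complex"
    where "\<epsilon> f = case_sum (\<lambda>_. 0) (case_sum (\<lambda>_. 0) (case_sum f (\<lambda>_. 0)))" for f
  have "inj \<epsilon>"
  proof (rule injI, rule ext)
    fix f g m assume "\<epsilon> f = \<epsilon> g"
    from fun_cong[OF this, of "Inr (Inr (Inl m))"] show "f m = g m"
      by (simp add: \<epsilon>_def)
  qed
  with \<iota> have "inj (\<iota> \<circ> \<epsilon>)" by (rule inj_compose)
  then show ?thesis
    using module_amenable_corners off_diagonal_trivial[of "\<iota> \<circ> \<epsilon>"] module_amenable_product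
    by blast
qed

end
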